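(* Let $\mathcal{A}\subseteq\mathbb{P}^2$ be an arrangement of $d$ distinct lines which is a $(k,m)$-net (i.e. there is a finite set of points $Z$ such that $(\mathcal{A},Z)$ is a $k$-net of order $m$). Then there are divisors $A,B$ on the blowup $X$ of $\mathbb{P}^2$ at the points of $L_2(\mathcal{A})$ such that $D_{\mathcal{A}}=A+B$, with $$h^0(A)=2\quad\text{and}\quad h^0(B)\ge km-\binom{m+1}{2}.$$
   Context: All varieties are over $\mathbb{C}$. $L_2(\mathcal{A})$ is the set of points of $\mathbb{P}^2$ lying on at least two of the lines of $\mathcal{A}$; for $p\in L_2(\mathcal{A})$, $\mu(p)$ is one less than the number of lines of $\mathcal{A}$ through $p$. On $X$, $E_0$ is the class of the pullback of a line in $\mathbb{P}^2$ and $E_p$ is the exceptional curve over $p$; $D_{\mathcal{A}}=(d-1)E_0-\sum_{p\in L_2(\mathcal{A})}\mu(p)E_p$. $h^0(D)=\dim_{\mathbb{C}}H^0(X,\mathcal{O}_X(D))$. Nets: let $k\ge3$ be an integer. A $k$-net in $\mathbb{P}^2$ is a pair $(\mathcal{A},Z)$ where $\mathcal{A}$ is a finite set of distinct lines partitioned into $k$ (nonempty) subsets $\mathcal{A}=\bigcup_{i=1}^k\mathcal{A}_i$ and $Z$ is a finite set of points, such that: (1) for every $i\ne j$ and every $L\in\mathcal{A}_i$, $L'\in\mathcal{A}_j$, one has $L\cap L'\in Z$; (2) for every $p\in Z$ and every $i\in\{1,\dots,k\}$ there exists a unique $L\in\mathcal{A}_i$ containing $p$. For a $k$-net, $|\mathcal{A}_i|=|L\cap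 Z|$ for any block $\mathcal{A}_i$ and any line $L\in\mathcal{A}$; this common number is denoted $m$ and called the order of the net, which is then called a $(k,m)$-net (so $d=km$ and $|Z|=m^2$). *)

theory Defs
  imports
    "HOL-Analysis.Analysis"
    "HOL-Library.Disjoint_Sets"
    "HOL-Computational_Algebra.Polynomial"
begin

section \<open>The projective plane and its lines\<close>

type_synonym vec3 = "complex ^ 3"

definition proportional :: "vec3 \<Rightarrow> vec3 \<Rightarrow> bool" where
  "proportional u v \<longleftrightarrow> u \<noteq> 0 \<and> v \<noteq> 0 \<and> (\<exists>c. v = c *s u)"

lemma proportional_sym: "proportional u v \<Longrightarrow> proportional v u"
  unfolding proportional_def
proof (elim conjE exE, intro conjI)
  fix c assume "u \<noteq> 0" "v \<noteq> 0" "v = c *s u"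
  then have "u = inverse c *s v"
    by (auto simp: vec_eq_iff field_simps)
  then show "\<exists>d. u = d *s v" ..
qed

lemma proportional_trans: "proportional u v \<Longrightarrow> proportional v w \<Longrightarrow> proportional u w"
  unfolding proportional_def by (metis vector_smult_assoc)

quotient_type proj_plane = vec3 / partial: proportional
proof (rule part_equivpI)
  have "proportional (\<chi> i. 1) (\<chi> i. 1)"
    unfolding proportional_def by (auto simp: vec_eq_iff intro!: exI[of _ 1])
  then show "\<exists>v. proportional v v" ..
  show "symp proportional" by (rule sympI) (rule proportional_sym)
  show "transp proportional" by (rule transpI) (rule proportional_trans)
qed

text \<open>A line is a point of the dual plane: the class of \<open>a\<close> stands for the line with
  equation \<open>a\<^sub>1 x\<^sub>1 + a\<^sub>2 x\<^sub>2 + a\<^sub>3 x\<^sub>3 = 0\<close>.\<close>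

type_synonym line = proj_plane

lift_definition incident :: "proj_plane \<Rightarrow> line \<Rightarrow> bool" (infix "on" 50)
  is "\<lambda>v a. scalar_product a v = 0"
proof -
  fix u v a b :: vec3
  assume "proportional u v" "proportional a b"
  then obtain c d where cd: "v = c *s u" "b = d *s a" "v \<noteq> 0" "b \<noteq> 0"
    by (auto simp: proportional_def)
  then have nz: "c \<noteq> 0" "d \<noteq> 0" by auto
  have "scalar_product b v = (d * c) * scalar_product a u"
    unfolding cd scalar_product_def by (simp add: sum_distrib_left mult_ac)
  then show "(scalar_product a u = 0) = (scalar_product b v = 0)" using nz by simp
qed

definition line_points :: "line \<Rightarrow> proj_plane set" where
  "line_points L = {p. p on L}"


section \<open>Line arrangements and nets\<close>

definition L2 :: "line set \<Rightarrow> proj_plane set" where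
  "L2 \<A> = {p. card {L \<in> \<A>. p on L} \<ge> 2}"

definition mu :: "line set \<Rightarrow> proj_plane \<Rightarrow> int" where
  "mu \<A> p = int (card {L \<in> \<A>. p on L}) - 1"

definition is_net :: "nat \<Rightarrow> line set \<Rightarrow> line set set \<Rightarrow> proj_plane set \<Rightarrow> bool" where
  "is_net k \<A> P Z \<longleftrightarrow>
     3 \<le> k \<and> finite \<A> \<and> partition_on \<A> P \<and> card P = k \<and> finite Z \<and>
     (\<forall>B\<in>P. \<forall>B'\<in>P. B \<noteq> B' \<longrightarrow> (\<forall>L\<in>B. \<forall>L'\<in>B'. line_points L \<inter> line_points L' \<subseteq> Z)) \<and>
     (\<forall>p\<in>Z. \<forall>B\<in>P. \<exists>!L. L \<in> B \<and> p on L)"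

definition net_order :: "line set \<Rightarrow> line set set \<Rightarrow> proj_plane set \<Rightarrow> nat \<Rightarrow> bool" where
  "net_order \<A> P Z m \<longleftrightarrow>
     (\<forall>B\<in>P. card B = m) \<and> (\<forall>L\<in>\<A>. card (line_points L \<inter> Z) = m)"

definition is_km_net :: "nat \<Rightarrow> nat \<Rightarrow> line set \<Rightarrow> bool" where
  "is_km_net k m \<A> \<longleftrightarrow> (\<exists>P Z. is_net k \<A> P Z \<and> net_order \<A> P Z m)"


section \<open>Rational functions on the plane\<close>

text \<open>Since the complex numbers are an infinite field, a form may be identified with the
  function it induces.\<close>

inductive form :: "nat \<Rightarrow> (vec3 \<Rightarrow> complex) \<Rightarrow> bool" where
  form_const: "form 0 (\<lambda>v. c)"
| form_coord: "form 1 (\<lambda>v. v $ i)"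
| form_add: "form n F \<Longrightarrow> form n G \<Longrightarrow> form n (\<lambda>v. F v + G v)"
| form_mult: "form m F \<Longrightarrow> form n G \<Longrightarrow> form (m + n) (\<lambda>v. F v * G v)"

lemma form_smult: "form n F \<Longrightarrow> form n (\<lambda>v. c * F v)"
  using form_mult[OF form_const[of c], of n F] by simp

lemma form_poly_on_line:
  assumes "form n F"
  shows "\<exists>p. \<forall>t. F (u + t *s w) = poly p t"
  using assms
proof induction
  case (form_const c)
  show ?case by (rule exI[of _ "[:c:]"]) simp
next
  case (form_coord i)
  show ?case by (rule exI[of _ "[:u $ i, w $ i:]"]) simp
next
  case (form_add n F G)
  then show ?case by (metis poly_add)
next
  case (form_mult m F n G)
  then show ?case by (metis poly_mult)
qed

lemma form_nonzero_mult:
  assumes "form m F" "form n G" "F u \<noteq> 0" "G w \<noteq> 0"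
  shows "\<exists>v. F v * G v \<noteq> 0"
proof -
  obtain p where p: "\<And>t. F (u + t *s (w - u)) = poly p t"
    using form_poly_on_line[OF assms(1)] by blast
  obtain q where q: "\<And>t. G (u + t *s (w - u)) = poly q t"
    using form_poly_on_line[OF assms(2)] by blast
  have "poly p 0 \<noteq> 0" using p[of 0] assms(3) by simp
  moreover have "poly q 1 \<noteq> 0" using q[of 1] assms(4) by simp
  ultimately have "p * q \<noteq> 0" by auto
  then obtain t where "poly (p * q) t \<noteq> 0" using poly_all_0_iff_0 by blast
  then show ?thesis by (metis p q poly_mult)
qed

lemma form_cancel:
  assumes "form m F" "form m F'" "form n G" "G w \<noteq> 0" "\<And>v. F v * G v = F' v * G v"
  shows "F v = F' v"
proof (rule ccontr)
  assume "F v \<noteq> F' v"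
  moreover have "form m (\<lambda>v. F v + (-1) * F' v)"
    by (intro form_add form_smult assms)
  ultimately obtain x where "(F x + (-1) * F' x) * G x \<noteq> 0"
    using form_nonzero_mult[of m "\<lambda>v. F v + (-1) * F' v" n G v w] assms by auto
  then show False using assms(5)[of x] by (simp add: algebra_simps)
qed

definition frac_valid :: "(vec3 \<Rightarrow> complex) \<times> (vec3 \<Rightarrow> complex) \<Rightarrow> bool" where
  "frac_valid x \<longleftrightarrow> (\<exists>n. form n (fst x) \<and> form n (snd x)) \<and> (\<exists>v. snd x v \<noteq> 0)"

definition frac_rel ::
  "(vec3 \<Rightarrow> complex) \<times> (vec3 \<Rightarrow> complex) \<Rightarrow> (vec3 \<Rightarrow> complex) \<times> (vec3 \<Rightarrow> complex) \<Rightarrow> bool" where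
  "frac_rel x y \<longleftrightarrow> frac_valid x \<and> frac_valid y \<and> (\<forall>v. fst x v * snd y v = fst y v * snd x v)"

lemma frac_rel_trans:
  assumes "frac_rel x y" "frac_rel y z"
  shows "frac_rel x z"
proof -
  obtain m where m: "form m (fst x)" "form m (snd x)"
    using assms by (auto simp: frac_rel_def frac_valid_def)
  obtain n w where n: "form n (snd y)" "snd y w \<noteq> 0"
    using assms by (auto simp: frac_rel_def frac_valid_def)
  obtain l where l: "form l (fst z)" "form l (snd z)"
    using assms by (auto simp: frac_rel_def frac_valid_def)
  have eqs: "fst x v * snd y v = fst y v * snd x v" "fst y v * snd z v = fst z v * snd y v" for v
    using assms by (auto simp: frac_rel_def)
  have "(fst x v * snd z v) * snd y v = (fst z v * snd x v) * snd y v" for v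
  proof -
    have "(fst x v * snd z v) * snd y v = (fst x v * snd y v) * snd z v" by simp
    also have "\<dots> = (fst y v * snd z v) * snd x v" by (simp add: eqs(1))
    also have "\<dots> = (fst z v * snd x v) * snd y v" by (simp add: eqs(2))
    finally show ?thesis .
  qed
  then have "fst x v * snd z v = fst z v * snd x v" for v
    using form_cancel[of "m + l" "\<lambda>v. fst x v * snd z v" "\<lambda>v. fst z v * snd x v" n "snd y" w v]
      form_mult[OF m(1) l(2)] form_mult[OF l(1) m(2)] n by (simp add: add.commute)
  then show ?thesis using assms by (auto simp: frac_rel_def)
qed

quotient_type ratfun = "(vec3 \<Rightarrow> complex) \<times> (vec3 \<Rightarrow> complex)" / partial: frac_rel
  morphisms rep_ratfun abs_ratfun
proof (rule part_equivpI)
  have "frac_valid (\<lambda>_. 0, \<lambda>_. 1)"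
    unfolding frac_valid_def using form_const by auto
  then have "frac_rel (\<lambda>_. 0, \<lambda>_. 1) (\<lambda>_. 0, \<lambda>_. 1)"
    by (simp add: frac_rel_def)
  then show "\<exists>x. frac_rel x x" ..
  show "symp frac_rel" by (rule sympI) (simp add: frac_rel_def)
  show "transp frac_rel" by (rule transpI) (rule frac_rel_trans)
qed

type_synonym frac = "(vec3 \<Rightarrow> complex) \<times> (vec3 \<Rightarrow> complex)"

definition frac_const :: "complex \<Rightarrow> frac" where
  "frac_const c = (\<lambda>_. c, \<lambda>_. 1)"

definition frac_uminus :: "frac \<Rightarrow> frac" where
  "frac_uminus x = (\<lambda>v. - fst x v, snd x)"

definition frac_plus :: "frac \<Rightarrow> frac \<Rightarrow> frac" where
  "frac_plus x y = (\<lambda>v. fst x v * snd y v + fst y v * snd x v, \<lambda>v. snd x v * snd y v)"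

definition frac_times :: "frac \<Rightarrow> frac \<Rightarrow> frac" where
  "frac_times x y = (\<lambda>v. fst x v * fst y v, \<lambda>v. snd x v * snd y v)"

definition frac_inverse :: "frac \<Rightarrow> frac" where
  "frac_inverse x = (if \<forall>v. fst x v = 0 then frac_const 0 else (snd x, fst x))"

lemma frac_sel:
  "fst (frac_const c) v = c" "snd (frac_const c) v = 1"
  "fst (frac_uminus x) v = - fst x v" "snd (frac_uminus x) v = snd x v"
  "fst (frac_plus x y) v = fst x v * snd y v + fst y v * snd x v"
  "snd (frac_plus x y) v = snd x v * snd y v"
  "fst (frac_times x y) v = fst x v * fst y v"
  "snd (frac_times x y) v = snd x v * snd y v"
  by (simp_all add: frac_const_def frac_uminus_def frac_plus_def frac_times_def)

lemma frac_valid_const: "frac_valid (frac_const c)"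
  unfolding frac_valid_def frac_const_def using form_const by auto

lemma frac_valid_uminus: "frac_valid x \<Longrightarrow> frac_valid (frac_uminus x)"
  unfolding frac_valid_def frac_uminus_def using form_smult[of _ "fst x" "-1"] by auto

lemma frac_valid_times:
  assumes "frac_valid x" "frac_valid y"
  shows "frac_valid (frac_times x y)"
proof -
  obtain m n u w where f: "form m (fst x)" "form m (snd x)" "form n (fst y)" "form n (snd y)"
      "snd x u \<noteq> 0" "snd y w \<noteq> 0"
    using assms unfolding frac_valid_def by auto
  show ?thesis
    using form_mult[OF f(1,3)] form_mult[OF f(2,4)] form_nonzero_mult[OF f(2,4,5,6)]
    by (auto simp: frac_valid_def frac_times_def)
qed

lemma frac_valid_plus:
  assumes "frac_valid x" "frac_valid y"
  shows "frac_valid (frac_plus x y)"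
proof -
  obtain m n where f: "form m (fst x)" "form m (snd x)" "form n (fst y)" "form n (snd y)"
    using assms unfolding frac_valid_def by auto
  have "form (m + n) (\<lambda>v. fst x v * snd y v + fst y v * snd x v)"
    using form_add[OF form_mult[OF f(1,4)], of "\<lambda>v. fst y v * snd x v"] form_mult[OF f(3,2)]
    by (simp add: add.commute)
  moreover have "form (m + n) (\<lambda>v. snd x v * snd y v)" by (rule form_mult[OF f(2,4)])
  moreover have "\<exists>v. snd x v * snd y v \<noteq> 0"
    using frac_valid_times[OF assms] by (simp add: frac_valid_def frac_times_def)
  ultimately show ?thesis by (auto simp: frac_valid_def frac_plus_def)
qed

lemma frac_valid_inverse: "frac_valid x \<Longrightarrow> frac_valid (frac_inverse x)"
  using frac_valid_const[of 0] by (auto simp: frac_inverse_def frac_valid_def)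

lemmas frac_valid_intros =
  frac_valid_const frac_valid_uminus frac_valid_plus frac_valid_times frac_valid_inverse

lemma frac_rel_zero:
  assumes "frac_rel x y" "\<forall>v. fst x v = 0"
  shows "\<forall>v. fst y v = 0"
proof (rule ccontr)
  assume "\<not> (\<forall>v. fst y v = 0)"
  then obtain u where u: "fst y u \<noteq> 0" by blast
  obtain w m n where w: "snd x w \<noteq> 0" "form m (fst y)" "form n (snd x)"
    using assms by (auto simp: frac_rel_def frac_valid_def)
  obtain v where "fst y v * snd x v \<noteq> 0" using form_nonzero_mult[OF w(2,3) u w(1)] by blast
  then show False using assms by (auto simp: frac_rel_def)
qed

instantiation ratfun :: field
begin

lift_definition zero_ratfun :: ratfun is "frac_const 0"
  by (simp add: frac_rel_def frac_valid_const)

lift_definition one_ratfun :: ratfun is "frac_const 1"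
  by (simp add: frac_rel_def frac_valid_const)

lift_definition uminus_ratfun :: "ratfun \<Rightarrow> ratfun" is frac_uminus
  by (simp add: frac_rel_def frac_valid_uminus frac_sel)

lift_definition plus_ratfun :: "ratfun \<Rightarrow> ratfun \<Rightarrow> ratfun" is frac_plus
proof -
  fix x y z w
  assume r: "frac_rel x y" "frac_rel z w"
  have 1: "fst x v * snd y v = fst y v * snd x v" "fst z v * snd w v = fst w v * snd z v" for v
    using r by (auto simp: frac_rel_def)
  have "(fst x v * snd z v + fst z v * snd x v) * (snd y v * snd w v) =
      (fst y v * snd w v + fst w v * snd y v) * (snd x v * snd z v)" for v
  proof -
    have "(fst x v * snd z v + fst z v * snd x v) * (snd y v * snd w v) =
        (fst x v * snd y v) * (snd z v * snd w v) + (fst z v * snd w v) * (snd x v * snd y v)"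
      by (simp add: algebra_simps)
    also have "\<dots> = (fst y v * snd x v) * (snd z v * snd w v)
        + (fst w v * snd z v) * (snd x v * snd y v)"
      by (simp only: 1)
    also have "\<dots> = (fst y v * snd w v + fst w v * snd y v) * (snd x v * snd z v)"
      by (simp add: algebra_simps)
    finally show ?thesis .
  qed
  then show "frac_rel (frac_plus x z) (frac_plus y w)"
    using r by (simp add: frac_rel_def frac_valid_plus frac_sel)
qed

lift_definition times_ratfun :: "ratfun \<Rightarrow> ratfun \<Rightarrow> ratfun" is frac_times
proof -
  fix x y z w
  assume r: "frac_rel x y" "frac_rel z w"
  have "(fst x v * snd y v) * (fst z v * snd w v) = (fst y v * snd x v) * (fst w v * snd z v)"
    for v using r by (simp add: frac_rel_def)
  then show "frac_rel (frac_times x z) (frac_times y w)"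
    using r by (simp add: frac_rel_def frac_valid_times frac_sel mult_ac)
qed

lift_definition inverse_ratfun :: "ratfun \<Rightarrow> ratfun" is frac_inverse
proof -
  fix x y
  assume r: "frac_rel x y"
  then have r': "frac_rel y x" by (simp add: frac_rel_def)
  have iff: "(\<forall>v. fst x v = 0) \<longleftrightarrow> (\<forall>v. fst y v = 0)"
    using frac_rel_zero[OF r] frac_rel_zero[OF r'] by blast
  have "frac_valid (frac_inverse x)" "frac_valid (frac_inverse y)"
    using r by (simp_all add: frac_rel_def frac_valid_inverse)
  then show "frac_rel (frac_inverse x) (frac_inverse y)"
    using r iff by (auto simp: frac_rel_def frac_inverse_def mult.commute)
qed

definition minus_ratfun :: "ratfun \<Rightarrow> ratfun \<Rightarrow> ratfun" where
  "minus_ratfun f g = f + - g"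

definition divide_ratfun :: "ratfun \<Rightarrow> ratfun \<Rightarrow> ratfun" where
  "divide_ratfun f g = f * inverse g"

instance
proof
  fix f g h :: ratfun
  show "f + g + h = f + (g + h)"
    by transfer (simp add: frac_rel_def frac_valid_intros frac_sel algebra_simps)
  show "f + g = g + f"
    by transfer (simp add: frac_rel_def frac_valid_intros frac_sel algebra_simps)
  show "0 + f = f"
    by transfer (simp add: frac_rel_def frac_valid_intros frac_sel)
  show "- f + f = 0"
    by transfer (simp add: frac_rel_def frac_valid_intros frac_sel)
  show "f - g = f + - g" by (rule minus_ratfun_def)
  show "f * g * h = f * (g * h)"
    by transfer (simp add: frac_rel_def frac_valid_intros frac_sel algebra_simps)
  show "f * g = g * f"
    by transfer (simp add: frac_rel_def frac_valid_intros frac_sel algebra_simps)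
  show "1 * f = f"
    by transfer (simp add: frac_rel_def frac_valid_intros frac_sel)
  show "(f + g) * h = f * h + g * h"
    by transfer (simp add: frac_rel_def frac_valid_intros frac_sel algebra_simps)
  show "(0::ratfun) \<noteq> 1"
    by transfer (simp add: frac_rel_def frac_sel)
  show "f \<noteq> 0 \<Longrightarrow> inverse f * f = 1"
  proof transfer
    fix x assume x: "frac_rel x x" "\<not> frac_rel x (frac_const 0)"
    then have "\<not> (\<forall>v. fst x v = 0)" by (simp add: frac_rel_def frac_valid_const frac_sel)
    then have "frac_inverse x = (snd x, fst x)"
      unfolding frac_inverse_def by (rule if_not_P)
    moreover have "frac_valid (frac_times (frac_inverse x) x)"
      using x by (simp add: frac_rel_def frac_valid_intros)
    ultimately show "frac_rel (frac_times (frac_inverse x) x) (frac_const 1)"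
      by (simp add: frac_rel_def frac_valid_const frac_sel mult.commute)
  qed
  show "f div g = f * inverse g" by (rule divide_ratfun_def)
  show "inverse (0::ratfun) = 0"
    by transfer (simp add: frac_rel_def frac_valid_intros frac_sel frac_inverse_def)
qed

end

lift_definition const_ratfun :: "complex \<Rightarrow> ratfun" is frac_const
  by (simp add: frac_rel_def frac_valid_const)

definition scale_ratfun :: "complex \<Rightarrow> ratfun \<Rightarrow> ratfun" where
  "scale_ratfun c f = const_ratfun c * f"

interpretation ratfun: vector_space scale_ratfun
proof
  fix a b :: complex and f g :: ratfun
  have "const_ratfun (a + b) = const_ratfun a + const_ratfun b"
    by transfer (simp add: frac_rel_def frac_valid_intros frac_sel)
  then show "scale_ratfun (a + b) f = scale_ratfun a f + scale_ratfun b f"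
    by (simp add: scale_ratfun_def distrib_right)
  have "const_ratfun (a * b) = const_ratfun a * const_ratfun b"
    by transfer (simp add: frac_rel_def frac_valid_intros frac_sel)
  then show "scale_ratfun a (scale_ratfun b f) = scale_ratfun (a * b) f"
    by (simp add: scale_ratfun_def)
  have "const_ratfun 1 = 1"
    by transfer (simp add: frac_rel_def frac_valid_const)
  then show "scale_ratfun 1 f = f" by (simp add: scale_ratfun_def)
  show "scale_ratfun a (f + g) = scale_ratfun a f + scale_ratfun a g"
    by (simp add: scale_ratfun_def distrib_left)
qed

text \<open>\<open>quot F G\<close> is the rational function \<open>F / G\<close>; only meaningful if \<open>F\<close> and \<open>G\<close> are forms of
  the same degree and \<open>G\<close> is not zero.\<close>

definition quot :: "(vec3 \<Rightarrow> complex) \<Rightarrow> (vec3 \<Rightarrow> complex) \<Rightarrow> ratfun" where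
  "quot F G = abs_ratfun (F, G)"


section \<open>The blow-up of the plane at a finite set of points\<close>

text \<open>A point of the blow-up at \<open>S\<close> is a point \<open>q\<close> of the plane together with, for every centre
  \<open>p \<in> S\<close>, a line through \<open>p\<close> and \<open>q\<close>. Thus the blow-up is a closed subvariety of the product
  of the plane with one copy of the dual plane for each centre; it is the fibre product over
  the plane of the blow-ups \<open>{(q, l). p \<in> l \<and> q \<in> l}\<close> at the single centres.\<close>

type_synonym blowup_point = "proj_plane \<times> (proj_plane \<Rightarrow> line)"

definition blowup :: "proj_plane set \<Rightarrow> blowup_point set" where
  "blowup S = {(q, l). l \<in> extensional S \<and> (\<forall>p\<in>S. p on l p \<and> q on l p)}"

text \<open>Multihomogeneous polynomials on the ambient product: degree \<open>n\<close> in the coordinates \<open>v\<close> of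
  the plane and degree \<open>e p\<close> in the coordinates \<open>w p\<close> of the dual plane belonging to \<open>p\<close>.\<close>

type_synonym multifun = "vec3 \<Rightarrow> (proj_plane \<Rightarrow> vec3) \<Rightarrow> complex"

inductive multiform :: "proj_plane set \<Rightarrow> nat \<Rightarrow> (proj_plane \<Rightarrow> nat) \<Rightarrow> multifun \<Rightarrow> bool"
  for S :: "proj_plane set" where
  multiform_const: "multiform S 0 (\<lambda>_. 0) (\<lambda>v w. c)"
| multiform_base: "multiform S 1 (\<lambda>_. 0) (\<lambda>v w. v $ i)"
| multiform_fibre: "p \<in> S \<Longrightarrow> multiform S 0 ((\<lambda>_. 0)(p := 1)) (\<lambda>v w. w p $ i)"
| multiform_add:
    "multiform S n e P \<Longrightarrow> multiform S n e Q \<Longrightarrow> multiform S n e (\<lambda>v w. P v w + Q v w)"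
| multiform_mult:
    "multiform S n e P \<Longrightarrow> multiform S n' e' Q \<Longrightarrow>
     multiform S (n + n') (\<lambda>p. e p + e' p) (\<lambda>v w. P v w * Q v w)"

text \<open>Evaluation uses chosen homogeneous coordinates. Whether a multihomogeneous polynomial
  vanishes at a point, and whether an identity between multihomogeneous polynomials of equal
  multidegree holds there, does not depend on the choice.\<close>

definition eval_at :: "multifun \<Rightarrow> blowup_point \<Rightarrow> complex" where
  "eval_at P x = P (rep_proj_plane (fst x)) (\<lambda>p. rep_proj_plane (snd x p))"

text \<open>The function field of the blow-up is identified with that of the plane by pulling back
  along the projection \<open>fst\<close>. A rational function \<open>f = F / G\<close> is regular at \<open>x\<close> if its pullback
  is a quotient \<open>P / Q\<close> of multihomogeneous polynomials of the same multidegree with \<open>Q\<close>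
  nonzero at \<open>x\<close>; since the blow-up is irreducible, \<open>F / G = P / Q\<close> means that the
  cross-multiplied identity holds on all of it.\<close>

definition local_ring :: "proj_plane set \<Rightarrow> blowup_point \<Rightarrow> ratfun set" where
  "local_ring S x = {f. \<exists>F G n P Q e k.
     form n F \<and> form n G \<and> (\<exists>v. G v \<noteq> 0) \<and> f = quot F G \<and>
     multiform S k e P \<and> multiform S k e Q \<and> eval_at Q x \<noteq> 0 \<and>
     (\<forall>y\<in>blowup S. F (rep_proj_plane (fst y)) * eval_at Q y =
                     G (rep_proj_plane (fst y)) * eval_at P y)}"

definition local_units :: "proj_plane set \<Rightarrow> blowup_point \<Rightarrow> ratfun set" where
  "local_units S x = {f \<in> local_ring S x. f \<noteq> 0 \<and> inverse f \<in> local_ring S x}"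


section \<open>Divisors on the blow-up\<close>

text \<open>The blow-up is smooth, so divisors are Cartier divisors. A divisor is represented by
  a choice of local equation at every point, and each of these has to be a local equation at all
  nearby points as well; the sets where some multihomogeneous \<open>Q\<close> is nonzero form a basis of the
  Zariski topology. Sums and multiples of divisors are products and powers of local equations.\<close>

type_synonym divisor = "blowup_point \<Rightarrow> ratfun"

definition is_divisor :: "proj_plane set \<Rightarrow> divisor \<Rightarrow> bool" where
  "is_divisor S D \<longleftrightarrow> (\<forall>x\<in>blowup S. D x \<noteq> 0 \<and>
     (\<exists>n e Q. multiform S n e Q \<and> eval_at Q x \<noteq> 0 \<and>
        (\<forall>y\<in>blowup S. eval_at Q y \<noteq> 0 \<longrightarrow> D y / D x \<in> local_units S y)))"

definition div_plus :: "divisor \<Rightarrow> divisor \<Rightarrow> divisor" where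
  "div_plus D D' = (\<lambda>x. D x * D' x)"

definition div_minus :: "divisor \<Rightarrow> divisor \<Rightarrow> divisor" where
  "div_minus D D' = (\<lambda>x. D x / D' x)"

definition div_mult :: "int \<Rightarrow> divisor \<Rightarrow> divisor" where
  "div_mult n D = (\<lambda>x. D x powi n)"

definition div_sum :: "('a \<Rightarrow> divisor) \<Rightarrow> 'a set \<Rightarrow> divisor" where
  "div_sum D I = (\<lambda>x. \<Prod>i\<in>I. D i x)"

text \<open>The witness \<open>f\<close> is the global rational function whose principal divisor is the difference
  of \<open>D\<close> and \<open>D'\<close>. This relation also identifies different local equations of one divisor.\<close>

definition lin_equiv :: "proj_plane set \<Rightarrow> divisor \<Rightarrow> divisor \<Rightarrow> bool" where
  "lin_equiv S D D' \<longleftrightarrow>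
     (\<exists>f. f \<noteq> 0 \<and> (\<forall>x\<in>blowup S. D x / (f * D' x) \<in> local_units S x))"

text \<open>The stalk of the sheaf of \<open>D\<close> at \<open>x\<close> is generated by the inverse of the local equation.\<close>

definition global_sections :: "proj_plane set \<Rightarrow> divisor \<Rightarrow> ratfun set" where
  "global_sections S D = {f. \<forall>x\<in>blowup S. f * D x \<in> local_ring S x}"

definition h0 :: "proj_plane set \<Rightarrow> divisor \<Rightarrow> nat" where
  "h0 S D = ratfun.dim (global_sections S D)"

text \<open>The stalk at \<open>q\<close> of the ideal sheaf of a closed subset \<open>C\<close> of the plane. The pullback of \<open>C\<close>
  is the divisor of the inverse image ideal sheaf, whose stalk at \<open>x\<close> is generated by the
  ideal stalk at \<open>fst x\<close>. A principal ideal of a local ring is generated by a member of any given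
  generating set, so the local equation can be chosen in the ideal stalk itself.\<close>

definition ideal_stalk :: "proj_plane set \<Rightarrow> proj_plane \<Rightarrow> ratfun set" where
  "ideal_stalk C q = {quot F G | F G n. form n F \<and> form n G \<and>
     G (rep_proj_plane q) \<noteq> 0 \<and> (\<forall>r\<in>C. F (rep_proj_plane r) = 0)}"

definition pullback :: "proj_plane set \<Rightarrow> proj_plane set \<Rightarrow> divisor" where
  "pullback S C = (\<lambda>x. SOME f. f \<in> ideal_stalk C (fst x) \<and> f \<noteq> 0 \<and>
     (\<forall>g \<in> ideal_stalk C (fst x). g / f \<in> local_ring S x))"

definition line_divisor :: "proj_plane set \<Rightarrow> line \<Rightarrow> divisor" where
  "line_divisor S H = pullback S (line_points H)"

definition exceptional :: "proj_plane set \<Rightarrow> proj_plane \<Rightarrow> divisor" where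
  "exceptional S p = pullback S {p}"

text \<open>\<open>E\<^sub>0\<close> is a divisor class; \<open>D_arr \<A> H\<close> is the representative of \<open>D\<^sub>\<A>\<close> obtained from the
  pullback of the line \<open>H\<close>.\<close>

definition D_arr :: "line set \<Rightarrow> line \<Rightarrow> divisor" where
  "D_arr \<A> H = div_minus
     (div_mult (int (card \<A>) - 1) (line_divisor (L2 \<A>) H))
     (div_sum (\<lambda>p. div_mult (mu \<A> p) (exceptional (L2 \<A>) p)) (L2 \<A>))"

definition represents_D :: "line set \<Rightarrow> divisor \<Rightarrow> bool" where
  "represents_D \<A> D \<longleftrightarrow> (\<forall>H. lin_equiv (L2 \<A>) D (D_arr \<A> H))"

end

theory Submission
  imports Defs
    "HOL-Computational_Algebra.Polynomial_Factorial"
    "HOL-Computational_Algebra.Field_as_Ring"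
    "HOL-Computational_Algebra.Fundamental_Theorem_Algebra"
begin

text \<open>
  For a \<open>(k, m)\<close>-net with base points \<open>Z\<close>, take
  \<open>A = m E\<^sub>0 - \<Sum>\<^bsub>p \<in> Z\<^esub> E\<^sub>p\<close>, the class of the pencil spanned by the blocks, and
  \<open>B = D\<^sub>\<A> - A\<close>. Exactly \<open>k\<close> lines pass through a point of \<open>Z\<close>, so
  \<open>B = ((k - 1) m - 1) E\<^sub>0 - \<Sum>\<^bsub>p \<in> Z\<^esub> (k - 2) E\<^sub>p - \<Sum>\<^bsub>p \<in> L\<^sub>2 - Z\<^esub> \<mu>(p) E\<^sub>p\<close>.
  A section of \<open>n E\<^sub>0 - \<Sum> m\<^sub>p E\<^sub>p\<close> with nonnegative coefficients is the same as a form of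
  degree \<open>n\<close> vanishing to order \<open>m\<^sub>p\<close> at each \<open>p\<close>; this turns both claims into statements about
  plane curves.

  For \<open>A\<close>: the products of the lines of two blocks are independent forms of degree \<open>m\<close> vanishing
  on \<open>Z\<close>. Conversely let \<open>F\<close> be such a form and \<open>L\<close> a line of the first block. After subtracting
  a multiple of the second product, \<open>F\<close> vanishes at the \<open>m\<close> points of \<open>Z\<close> on \<open>L\<close> and at one more
  point of \<open>L\<close>, hence is divisible by \<open>L\<close>. The quotient has degree \<open>m - 1\<close> and still vanishes at
  the \<open>m\<close> points of \<open>Z\<close> on every other line of that block, so these lines split off as well, and a
  constant times the first product remains (\<open>pencil\<close>).

  For \<open>B\<close>: vanishing to order \<open>e\<close> at a point is \<open>e (e + 1) / 2\<close> linear conditions, and the forms of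
  degree \<open>n\<close> have dimension \<open>(n + 1) (n + 2) / 2\<close> (\<open>dim_sections_ge\<close>). If \<open>r\<^sub>p\<close> lines pass through
  \<open>p\<close>, then the sum of \<open>r\<^sub>p (r\<^sub>p - 1)\<close> over \<open>L\<^sub>2\<close> is at most the number \<open>k m (k m - 1)\<close> of ordered
  pairs of lines, two lines having one common point; lowering the order by one at each of the (at
  least) \<open>m\<^sup>2\<close> points of \<open>Z\<close> saves \<open>k - 1\<close> conditions there. With \<open>n = (k - 1) m - 1\<close>
  the difference is exactly \<open>k m - m (m + 1) / 2\<close>.

  The passage from sections to forms has three ingredients. The blow-up is irreducible, so regularity
  can be tested off the exceptional curves, where the fibre coordinate over \<open>p\<close> is the
  join \<open>p \<times> v\<close> (\<open>eval_at_eq_0\<close>, \<open>local_ring_iff\<close>). A rational function regular off finitely many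
  points has no denominator, because a plane curve is infinite (\<open>quotient_regular_off_points\<close>). And
  a form vanishes to order \<open>e\<close> at \<open>p\<close> iff it can be written with \<open>e\<close> factors \<open>p \<times> v\<close>; on the
  blow-up these are \<open>e\<close> factors of the equation of the exceptional curve (\<open>raise_order\<close>).
\<close>

section \<open>Linear algebra in three-space\<close>

abbreviation dot :: "vec3 \<Rightarrow> vec3 \<Rightarrow> complex" where
  "dot \<equiv> scalar_product"

lemma dot_3: "dot a v = a$1 * v$1 + a$2 * v$2 + a$3 * v$3"
  by (simp add: scalar_product_def sum_3)

definition vcross :: "vec3 \<Rightarrow> vec3 \<Rightarrow> vec3" where
  "vcross u v = vector [u$2 * v$3 - u$3 * v$2, u$3 * v$1 - u$1 * v$3, u$1 * v$2 - u$2 * v$1]"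

lemma vcross_nth [simp]:
  "vcross u v $ 1 = u$2 * v$3 - u$3 * v$2"
  "vcross u v $ 2 = u$3 * v$1 - u$1 * v$3"
  "vcross u v $ 3 = u$1 * v$2 - u$2 * v$1"
  by (simp_all add: vcross_def)

lemma dot_commute: "dot a b = dot b a"
  by (simp add: dot_3)

lemma dot_zero [simp]: "dot a 0 = 0" "dot 0 a = 0"
  by (simp_all add: dot_3)

lemma dot_diff: "dot a (u - v) = dot a u - dot a v"
  by (simp add: dot_3 algebra_simps)

lemma dot_smult: "dot a (c *s u) = c * dot a u" "dot (c *s a) u = c * dot a u"
  by (simp_all add: dot_3 algebra_simps)

lemma vcross_self [simp]: "vcross u u = 0"
  by (simp add: vec_eq_iff forall_3)

lemma vcross_add: "vcross u (v + w) = vcross u v + vcross u w"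
  by (simp add: vec_eq_iff forall_3 algebra_simps)

lemma vcross_smult:
  "vcross u (c *s v) = c *s vcross u v" "vcross (c *s u) v = c *s vcross u v"
  by (simp_all add: vec_eq_iff forall_3 algebra_simps)

lemma vcross_zero [simp]: "vcross u 0 = 0" "vcross 0 u = 0"
  by (simp_all add: vec_eq_iff forall_3)

lemma dot_vcross [simp]:
  "dot u (vcross u v) = 0" "dot v (vcross u v) = 0"
  "dot (vcross u v) u = 0" "dot (vcross u v) v = 0"
  by (simp_all add: dot_3 algebra_simps)

lemma triple_product: "vcross a (vcross b c) = dot a c *s b - dot a b *s c"
  by (simp add: vec_eq_iff forall_3 dot_3 algebra_simps)

lemma dot_cnj_nonzero:
  assumes "v \<noteq> 0"
  shows "dot (\<chi> i. cnj (v $ i)) v \<noteq> 0"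
proof
  assume "dot (\<chi> i. cnj (v $ i)) v = 0"
  then have "complex_of_real ((cmod (v$1))\<^sup>2 + (cmod (v$2))\<^sup>2 + (cmod (v$3))\<^sup>2) = 0"
    by (simp add: dot_3 complex_norm_square mult.commute del: of_real_power)
  then have "(cmod (v$1))\<^sup>2 + (cmod (v$2))\<^sup>2 + (cmod (v$3))\<^sup>2 = 0"
    using of_real_eq_0_iff by blast
  then have "v$1 = 0 \<and> v$2 = 0 \<and> v$3 = 0"
    by (smt (verit) norm_eq_zero zero_le_power2 power2_eq_square mult_eq_0_iff)
  then show False using assms by (simp add: vec_eq_iff forall_3)
qed

lemma dot_normalised:
  assumes "v \<noteq> 0"
  obtains c where "dot c v = 1"
proof
  show "dot (inverse (dot (\<chi> i. cnj (v $ i)) v) *s (\<chi> i. cnj (v $ i))) v = 1"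
    using dot_cnj_nonzero[OF assms] by (simp add: dot_smult)
qed

lemma orthogonal_imp_vcross:
  assumes "dot a p = 0" "p \<noteq> 0"
  obtains z where "a = vcross p z"
proof -
  obtain c where c: "dot c p = 1" using dot_normalised[OF assms(2)] .
  have "vcross p (vcross a c) = a"
    using assms(1) c by (simp add: triple_product dot_commute[of p])
  then show thesis using that by metis
qed

lemma vcross_eq_0_imp:
  assumes "vcross u v = 0" "u \<noteq> 0"
  obtains c where "v = c *s u"
proof -
  obtain c where c: "dot c u = 1" using dot_normalised[OF assms(2)] .
  have "vcross c (vcross u v) = 0" by (simp add: assms(1))
  then have "v = dot c v *s u" by (simp add: triple_product c)
  then show thesis using that by metis
qed

text \<open>Intersecting two lines, or joining two points, is the cross product.\<close>

lemma common_orthogonal: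
  assumes "vcross a b \<noteq> 0" "dot a v = 0" "dot b v = 0"
  obtains c where "v = c *s vcross a b"
proof -
  have "vcross v (vcross a b) = 0"
    using assms by (simp add: triple_product dot_commute[of v])
  then have "vcross (vcross a b) v = 0"
    by (simp add: vec_eq_iff forall_3 algebra_simps)
  then show thesis using vcross_eq_0_imp assms(1) that by blast
qed

text \<open>The basis of the plane orthogonal to \<open>p\<close> is given in the form \<open>p \<times> y\<close>, \<open>p \<times> z\<close>, so that it
  parametrises the lines through \<open>p\<close> by directions \<open>y\<close>, \<open>z\<close>.\<close>

lemma plane_basis:
  assumes "p \<noteq> 0"
  obtains y z where "\<And>w. dot w p = 0 \<Longrightarrow> \<exists>a b. w = a *s vcross p y + b *s vcross p z"
proof -
  have "\<exists>u v. dot u p = 0 \<and> dot v p = 0 \<and> (\<forall>w. dot w p = 0 \<longrightarrow> (\<exists>a b. w = a *s u + b *s v))"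
  proof -
    consider "p$1 \<noteq> 0" | "p$2 \<noteq> 0" | "p$3 \<noteq> 0"
      using assms by (auto simp: vec_eq_iff forall_3)
    then show ?thesis
    proof cases
      case 1
      show ?thesis
      proof (rule exI[of _ "vector [- p$2 / p$1, 1, 0] :: vec3"], rule exI[of _ "vector [- p$3 / p$1, 0, 1] :: vec3"],
          intro conjI allI impI)
        fix w :: vec3 assume w: "dot w p = 0"
        have "w = w$2 *s vector [- p$2 / p$1, 1, 0] + w$3 *s vector [- p$3 / p$1, 0, 1]"
          using w 1 by (simp add: vec_eq_iff forall_3 dot_3 field_simps, algebra)
        then show "\<exists>a b. w = a *s vector [- p$2 / p$1, 1, 0] + b *s vector [- p$3 / p$1, 0, 1]" by blast
      qed (use 1 in \<open>simp_all add: dot_3\<close>)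
    next
      case 2
      show ?thesis
      proof (rule exI[of _ "vector [1, - p$1 / p$2, 0] :: vec3"], rule exI[of _ "vector [0, - p$3 / p$2, 1] :: vec3"],
          intro conjI allI impI)
        fix w :: vec3 assume w: "dot w p = 0"
        have "w = w$1 *s vector [1, - p$1 / p$2, 0] + w$3 *s vector [0, - p$3 / p$2, 1]"
          using w 2 by (simp add: vec_eq_iff forall_3 dot_3 field_simps, algebra)
        then show "\<exists>a b. w = a *s vector [1, - p$1 / p$2, 0] + b *s vector [0, - p$3 / p$2, 1]" by blast
      qed (use 2 in \<open>simp_all add: dot_3\<close>)
    next
      case 3
      show ?thesis
      proof (rule exI[of _ "vector [1, 0, - p$1 / p$3] :: vec3"], rule exI[of _ "vector [0, 1, - p$2 / p$3] :: vec3"],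
          intro conjI allI impI)
        fix w :: vec3 assume w: "dot w p = 0"
        have "w = w$1 *s vector [1, 0, - p$1 / p$3] + w$2 *s vector [0, 1, - p$2 / p$3]"
          using w 3 by (simp add: vec_eq_iff forall_3 dot_3 field_simps, algebra)
        then show "\<exists>a b. w = a *s vector [1, 0, - p$1 / p$3] + b *s vector [0, 1, - p$2 / p$3]" by blast
      qed (use 3 in \<open>simp_all add: dot_3\<close>)
    qed
  qed
  then show thesis using that assms orthogonal_imp_vcross by metis
qed


section \<open>Homogeneous coordinates\<close>

abbreviation rp :: "proj_plane \<Rightarrow> vec3" where
  "rp \<equiv> rep_proj_plane"

lemma rp_proportional: "proportional (rp q) (rp q)"
  by (rule Quotient3_rep_reflp[OF Quotient3_proj_plane])

lemma rp_nonzero [simp]: "rp q \<noteq> 0"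
  using rp_proportional by (simp add: proportional_def)

lemma abs_rp: "abs_proj_plane (rp q) = q"
  by (rule Quotient3_abs_rep[OF Quotient3_proj_plane])

lemma rp_smult_eq:
  assumes "rp q = c *s rp q'"
  shows "q = q'"
proof -
  have "proportional (rp q') (rp q)" using assms unfolding proportional_def by auto
  then have "abs_proj_plane (rp q') = abs_proj_plane (rp q)"
    using Quotient3_rel[OF Quotient3_proj_plane] by blast
  then show ?thesis by (simp add: abs_rp)
qed

lemma rp_abs:
  assumes "v \<noteq> 0"
  obtains c where "c \<noteq> 0" "rp (abs_proj_plane v) = c *s v"
proof -
  have "proportional v v" using assms unfolding proportional_def by (auto intro: exI[of _ 1])
  then have "proportional v (rp (abs_proj_plane v))"
    using Quotient3_rel[OF Quotient3_proj_plane, of v "rp (abs_proj_plane v)"]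
    by (simp add: rp_proportional abs_rp)
  then obtain c where "rp (abs_proj_plane v) = c *s v" unfolding proportional_def by auto
  then show thesis using that[of c] rp_nonzero[of "abs_proj_plane v"] by (metis vector_smult_lzero)
qed

lemma on_iff: "q on L \<longleftrightarrow> dot (rp L) (rp q) = 0"
  by (simp add: incident_def map_fun_def)

lemma vcross_rp_nonzero: "q \<noteq> q' \<Longrightarrow> vcross (rp q) (rp q') \<noteq> 0"
  by (metis vcross_eq_0_imp rp_nonzero rp_smult_eq)

lemma lines_meet_unique:
  assumes "L \<noteq> L'" "q on L" "q on L'" "q' on L" "q' on L'"
  shows "q = q'"
proof -
  obtain c where c: "rp q = c *s vcross (rp L) (rp L')"
    using common_orthogonal[OF vcross_rp_nonzero] assms on_iff by metis
  obtain d where d: "rp q' = d *s vcross (rp L) (rp L')"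
    using common_orthogonal[OF vcross_rp_nonzero] assms on_iff by metis
  have "d \<noteq> 0" using d by (metis rp_nonzero vector_smult_lzero)
  then have "rp q = (c / d) *s rp q'" using c d by (simp add: vector_smult_assoc)
  then show ?thesis by (rule rp_smult_eq)
qed

lemma lines_meet:
  assumes "L \<noteq> L'"
  obtains q where "q on L" "q on L'"
proof -
  obtain c where "rp (abs_proj_plane (vcross (rp L) (rp L'))) = c *s vcross (rp L) (rp L')"
    using rp_abs vcross_rp_nonzero[OF assms] by metis
  then show thesis using that[of "abs_proj_plane (vcross (rp L) (rp L'))"]
    by (simp add: on_iff dot_smult)
qed

lemma line_through_unique:
  assumes "q \<noteq> p" "p on L" "q on L"
  obtains c where "c \<noteq> 0" "rp L = c *s vcross (rp p) (rp q)"
proof -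
  obtain c where c: "rp L = c *s vcross (rp p) (rp q)"
    using common_orthogonal[OF vcross_rp_nonzero, of p q "rp L"] assms
    unfolding on_iff by (metis dot_commute)
  moreover have "c \<noteq> 0" using c rp_nonzero[of L] by (metis vector_smult_lzero)
  ultimately show thesis using that by blast
qed


section \<open>Forms\<close>

lemma form_cong: "form n F \<Longrightarrow> n = n' \<Longrightarrow> (\<And>v. F v = F' v) \<Longrightarrow> form n' F'"
  by (metis ext)

lemma form_zero: "form n (\<lambda>v. 0)"
proof (induction n)
  case 0
  show ?case by (rule form_const)
next
  case (Suc n)
  from form_mult[OF form_coord[of 1] this] show ?case by simp
qed

lemma form_dot: "form 1 (\<lambda>v. dot a v)"
  unfolding dot_3 by (intro form_add form_smult form_coord)

lemma form_power:
  assumes "form n F"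
  shows "form (n * k) (\<lambda>v. F v ^ k)"
proof (induction k)
  case 0
  show ?case using form_const[of 1] by simp
next
  case (Suc k)
  from form_mult[OF assms this] show ?case by simp
qed

lemma form_dot_power: "form k (\<lambda>v. dot a v ^ k)"
  using form_power[OF form_dot[of a], of k] by simp

lemma form_prod:
  assumes "finite I" "\<And>i. i \<in> I \<Longrightarrow> form (n i) (F i)"
  shows "form (\<Sum>i\<in>I. n i) (\<lambda>v. \<Prod>i\<in>I. F i v)"
  using assms
proof (induction I)
  case empty
  show ?case using form_const[of 1] by simp
next
  case (insert i I)
  have "form (n i + (\<Sum>i\<in>I. n i)) (\<lambda>v. F i v * (\<Prod>i\<in>I. F i v))"
    using insert by (intro form_mult) auto
  then show ?case using insert by simp
qed

lemma form_sum:
  assumes "\<And>i. i \<in> I \<Longrightarrow> form n (F i)"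
  shows "form n (\<lambda>v. \<Sum>i\<in>I. F i v)"
  using assms
proof (induction I rule: infinite_finite_induct)
  case (insert i I)
  have "form n (\<lambda>v. F i v + (\<Sum>i\<in>I. F i v))"
    using insert by (intro form_add) auto
  then show ?case using insert by simp
qed (simp_all add: form_zero)

lemma form_diff:
  assumes "form n F" "form n G"
  shows "form n (\<lambda>v. F v - G v)"
  using form_add[OF assms(1) form_smult[OF assms(2), of "-1"]] by simp

lemma form_scale: "form n F \<Longrightarrow> F (c *s v) = c ^ n * F v"
  by (induction rule: form.induct) (simp_all add: algebra_simps power_add)

lemma form_at_0: "form n F \<Longrightarrow> 0 < n \<Longrightarrow> F 0 = 0"
  using form_scale[of n F 0 0] by (simp add: power_0_left)

lemma form_compose:
  assumes "form n F" "\<And>i. form 1 (\<lambda>v. f v $ i)"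
  shows "form n (\<lambda>v. F (f v))"
  using assms(1)
  by (induction rule: form.induct) (use assms(2) in \<open>auto intro: form.intros\<close>)

lemma coeff_mult_bounded:
  fixes p q :: "'a :: comm_semiring_0 poly"
  assumes "degree p \<le> m" "degree q \<le> n"
  shows "coeff (p * q) (m + n) = coeff p m * coeff q n"
proof (cases "degree p = m \<and> degree q = n")
  case True
  then show ?thesis using coeff_mult_degree_sum[of p q] by auto
next
  case False
  then have "degree (p * q) < m + n" "coeff p m = 0 \<or> coeff q n = 0"
    using assms degree_mult_le[of p q] by (auto intro: coeff_eq_0)
  then show ?thesis using coeff_eq_0 by fastforce
qed

text \<open>The coefficient of \<open>t ^ n\<close> is the value at the point at infinity \<open>w\<close> of the line.\<close>

lemma form_poly_bounded:
  assumes "form n F"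
  shows "\<exists>p. degree p \<le> n \<and> coeff p n = F w \<and> (\<forall>t. F (u + t *s w) = poly p t)"
  using assms
proof induction
  case (form_const c)
  show ?case by (rule exI[of _ "[:c:]"]) simp
next
  case (form_coord i)
  show ?case by (rule exI[of _ "[:u $ i, w $ i:]"]) simp
next
  case (form_add n F G)
  then show ?case by (metis poly_add degree_add_le coeff_add)
next
  case (form_mult m F n G)
  then obtain p q where "degree p \<le> m" "coeff p m = F w" "\<forall>t. F (u + t *s w) = poly p t"
    "degree q \<le> n" "coeff q n = G w" "\<forall>t. G (u + t *s w) = poly q t" by auto
  then show ?case
    using degree_mult_le[of p q] coeff_mult_bounded[of p m q n]
    by (intro exI[of _ "p * q"]) auto
qed

lemma exists_nonparallel:
  assumes "p \<noteq> 0"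
  obtains z where "vcross p z \<noteq> 0"
proof (rule ccontr)
  assume "\<not> thesis"
  then have "vcross p z = 0" for z using that by blast
  then have "vcross p (vector [1, 0, 0]) = 0" "vcross p (vector [0, 1, 0]) = 0" by blast+
  then show False using assms by (simp add: vec_eq_iff forall_3)
qed

lemma form_prod_nonzero:
  assumes "finite I" "\<And>i. i \<in> I \<Longrightarrow> form (n i) (F i)" "\<And>i. i \<in> I \<Longrightarrow> \<exists>v. F i v \<noteq> 0"
  shows "\<exists>v. (\<Prod>i\<in>I. F i v) \<noteq> 0"
  using assms
proof (induction I)
  case (insert i I)
  obtain u w where "F i u \<noteq> 0" "(\<Prod>i\<in>I. F i w) \<noteq> 0" using insert by blast
  moreover have "form (\<Sum>i\<in>I. n i) (\<lambda>v. \<Prod>i\<in>I. F i v)"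
    using insert by (intro form_prod) auto
  moreover have "form (n i) (F i)" using insert by simp
  ultimately show ?case using form_nonzero_mult[of "n i" "F i"] insert by fastforce
qed simp

text \<open>Finitely many points are avoided by multiplying with linear forms through them. The map \<open>f\<close>
  allows the same argument for the restriction to the image of a linear map, in practice a line.\<close>

lemma form_nonzero_off_points:
  assumes F: "form n F" "F u \<noteq> 0" and T: "finite T"
    and f: "\<And>i. form 1 (\<lambda>v. f v $ i)" "f u' \<noteq> 0"
    and sep: "\<And>p. p \<in> T \<Longrightarrow> \<exists>a v. dot a (rp p) = 0 \<and> dot a (f v) \<noteq> 0"
  shows "\<exists>v. F v \<noteq> 0 \<and> f v \<noteq> 0 \<and> abs_proj_plane (f v) \<notin> T"
proof -
  obtain a where a: "\<And>p. p \<in> T \<Longrightarrow> dot (a p) (rp p) = 0 \<and> (\<exists>v. dot (a p) (f v) \<noteq> 0)"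
    using sep by metis
  \<comment> \<open>Multiply \<open>F\<close> by a linear form through each point of \<open>T\<close>, and by a coordinate to exclude
    \<open>f v = 0\<close>: the product is a nonzero form.\<close>
  obtain i where i: "f u' $ i \<noteq> 0" using f(2) by (auto simp: vec_eq_iff)
  have lin: "form 1 (\<lambda>v. dot b (f v))" for b
    using form_compose[OF form_dot f(1)] .
  have "\<exists>v. (\<Prod>p\<in>T. dot (a p) (f v)) \<noteq> 0"
    using a lin by (intro form_prod_nonzero[OF T]) auto
  moreover have "form (\<Sum>p\<in>T. 1) (\<lambda>v. \<Prod>p\<in>T. dot (a p) (f v))"
    using lin by (intro form_prod[OF T])
  ultimately obtain w where w: "(\<Prod>p\<in>T. dot (a p) (f w)) * f w $ i \<noteq> 0"
    using form_nonzero_mult f(1) i by blast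
  have "form ((\<Sum>p\<in>T. 1) + 1) (\<lambda>v. (\<Prod>p\<in>T. dot (a p) (f v)) * f v $ i)"
    by (rule form_mult) fact+
  then obtain v where v: "F v * ((\<Prod>p\<in>T. dot (a p) (f v)) * f v $ i) \<noteq> 0"
    using form_nonzero_mult[OF F(1) _ F(2),
        of _ "\<lambda>v. (\<Prod>p\<in>T. dot (a p) (f v)) * f v $ i" w] w by blast
  then have nz: "f v \<noteq> 0" by auto
  have "abs_proj_plane (f v) \<notin> T"
  proof
    assume p: "abs_proj_plane (f v) \<in> T"
    obtain c where "c \<noteq> 0" "rp (abs_proj_plane (f v)) = c *s f v" using rp_abs[OF nz] .
    then have "dot (a (abs_proj_plane (f v))) (f v) = 0"
      using a[OF p] by (auto simp: dot_smult)
    then show False using v p T by (metis mult_zero_left mult_zero_right prod_zero)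
  qed
  then show ?thesis using v nz by auto
qed

lemma form_zero_off_points:
  assumes "form n F" "finite T" "\<And>v. v \<noteq> 0 \<Longrightarrow> abs_proj_plane v \<notin> T \<Longrightarrow> F v = 0"
  shows "F v = 0"
proof (rule ccontr)
  assume "F v \<noteq> 0"
  moreover have "\<exists>a v. dot a (rp p) = 0 \<and> dot a v \<noteq> 0" for p
  proof -
    obtain s where "vcross (rp p) s \<noteq> 0" using exists_nonparallel[OF rp_nonzero] .
    then show ?thesis using dot_cnj_nonzero[of "vcross (rp p) s"] dot_vcross
      by (metis dot_commute)
  qed
  ultimately show False
    using form_nonzero_off_points[OF assms(1) _ assms(2), of v "\<lambda>v. v" "vector [1, 0, 0]"] assms(3)
      form_coord by (auto simp: vec_eq_iff forall_3)
qed


section \<open>Multihomogeneous polynomials\<close>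

lemma multiform_cong:
  assumes "multiform S n e P" "n = n'" "\<And>p. e p = e' p" "\<And>v w. P v w = P' v w"
  shows "multiform S n' e' P'"
proof -
  have "e = e'" by (rule ext) (rule assms(3))
  moreover have "P = P'" by (intro ext) (rule assms(4))
  ultimately show ?thesis using assms(1,2) by simp
qed

lemma multiform_of_form:
  assumes "form n F"
  shows "multiform S n (\<lambda>_. 0) (\<lambda>v w. F v)"
  using assms
proof induction
  case (form_mult m F n G)
  then show ?case using multiform_mult by fastforce
next
  case (form_add n F G)
  then show ?case by (intro multiform_add)
qed (rule multiform_const multiform_base)+

lemma multiform_smult: "multiform S n e P \<Longrightarrow> multiform S n e (\<lambda>v w. c * P v w)"
  using multiform_mult[OF multiform_const[of S c], of n e P] by simp

lemma multiform_times_form: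
  assumes "form m F" "multiform S n e P"
  shows "multiform S (m + n) e (\<lambda>v w. F v * P v w)"
  using multiform_mult[OF multiform_of_form[OF assms(1)] assms(2)] by simp

lemma multiform_power:
  assumes "multiform S n e P"
  shows "multiform S (n * k) (\<lambda>p. e p * k) (\<lambda>v w. P v w ^ k)"
proof (induction k)
  case 0
  show ?case using multiform_const[of S 1] by simp
next
  case (Suc k)
  from multiform_mult[OF assms this] show ?case by simp
qed

lemma multiform_diff:
  assumes "multiform S n e P" "multiform S n e Q"
  shows "multiform S n e (\<lambda>v w. P v w - Q v w)"
  using multiform_add[OF assms(1) multiform_smult[OF assms(2), of "-1"]] by simp

lemma multiform_fibre_dot:
  assumes "p \<in> S"
  shows "multiform S 0 ((\<lambda>_. 0)(p := 1)) (\<lambda>v w. dot s (w p))"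
  unfolding dot_3 by (intro multiform_add multiform_smult multiform_fibre assms)

lemma multiform_fibre_dot_power:
  assumes "p \<in> S"
  shows "multiform S 0 ((\<lambda>_. 0)(p := k)) (\<lambda>v w. dot s (w p) ^ k)"
  by (rule multiform_cong[OF multiform_power[OF multiform_fibre_dot[OF assms]]]) auto

lemma multiform_supportD: "multiform S n e P \<Longrightarrow> 0 < e p \<Longrightarrow> p \<in> S"
  by (induction rule: multiform.induct) (auto split: if_splits)

lemma multiform_depends:
  assumes "multiform S n e P" "\<And>p. e p \<noteq> 0 \<Longrightarrow> w p = w' p"
  shows "P v w = P v w'"
  using assms by (induction rule: multiform.induct) auto

lemma multiform_scale:
  assumes "multiform S n e P" "finite S"
  shows "P (c *s v) (\<lambda>p. d p *s w p) = c ^ n * (\<Prod>p\<in>S. d p ^ e p) * P v w"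
  using assms(1)
proof (induction rule: multiform.induct)
  case (multiform_fibre p i)
  have "(\<Prod>p'\<in>S. d p' ^ ((\<lambda>_. 0)(p := 1)) p') = (\<Prod>p'\<in>S. if p = p' then d p' else 1)"
    by (rule prod.cong) auto
  then show ?case using multiform_fibre assms(2) by simp
qed (simp_all add: algebra_simps power_add prod.distrib)

text \<open>The degree of \<open>P\<close> along an arc; if \<open>z = 0\<close> only the fibre coordinates move, and then the
  degree in \<open>v\<close> does not contribute (\<open>k = 0\<close>).\<close>

lemma multiform_arc:
  assumes "multiform S n e P" "finite S" "z = 0 \<or> 1 \<le> k"
  shows "\<exists>r. degree r \<le> k * n + (\<Sum>p\<in>S. e p) \<and>
    (\<forall>t. P (u + t *s z) (\<lambda>p. a p + t *s b p) = poly r t)"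
  using assms(1)
proof (induction rule: multiform.induct)
  case (multiform_const c)
  show ?case by (rule exI[of _ "[:c:]"]) simp
next
  case (multiform_base i)
  show ?case by (rule exI[of _ "[:u $ i, z $ i:]"]) (use assms(3) in auto)
next
  case (multiform_fibre p i)
  have "(\<Sum>p'\<in>S. ((\<lambda>_. 0)(p := 1)) p') = (\<Sum>p'\<in>S. if p = p' then 1 else 0 :: nat)"
    by (rule sum.cong) auto
  then show ?case using multiform_fibre assms(2)
    by (intro exI[of _ "[:a p $ i, b p $ i:]"]) simp
next
  case (multiform_add n e P Q)
  then show ?case by (metis poly_add degree_add_le)
next
  case (multiform_mult n e P n' e' Q)
  then obtain p q where "degree p \<le> k * n + sum e S"
      "\<forall>t. P (u + t *s z) (\<lambda>p. a p + t *s b p) = poly p t"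
      "degree q \<le> k * n' + sum e' S"
      "\<forall>t. Q (u + t *s z) (\<lambda>p. a p + t *s b p) = poly q t" by auto
  then show ?case using degree_mult_le[of p q]
    by (intro exI[of _ "p * q"]) (auto simp: sum.distrib algebra_simps)
qed

text \<open>A difference quotient for a linear substitution \<open>v \<mapsto> f v\<close> whose defect \<open>v - f v\<close> is a
  combination of the linear forms \<open>s i\<close>: this is how vanishing on a line or at a point is
  turned into membership in the ideal of the line or of the point.\<close>

lemma multiform_difference:
  assumes P: "multiform S n e P" and I: "finite I"
    and f: "\<And>i. form 1 (\<lambda>v. f v $ i)" and s: "\<And>j. j \<in> I \<Longrightarrow> form 1 (s j)"
    and v: "\<And>v. v = f v + (\<Sum>j\<in>I. s j v *s d j)"
  shows "\<exists>G. (\<forall>j. multiform S (n - 1) e (G j) \<and> (n = 0 \<longrightarrow> G j = (\<lambda>v w. 0))) \<and>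
    multiform S n e (\<lambda>v w. P (f v) w) \<and>
    (\<forall>v w. P v w - P (f v) w = (\<Sum>j\<in>I. s j v * G j v w))"
  using P
proof (induction rule: multiform.induct)
  case (multiform_const c)
  show ?case
    by (rule exI[of _ "\<lambda>j v w. 0"]) (auto intro: multiform.multiform_const)
next
  case (multiform_base i)
  have "v $ i - f v $ i = (\<Sum>j\<in>I. s j v * d j $ i)" for v
    using arg_cong[OF v[of v], of "\<lambda>x. x $ i"] by simp
  then show ?case
    by (intro exI[of _ "\<lambda>j v w. d j $ i"])
      (auto intro: multiform.multiform_const multiform_of_form[OF f, simplified])
next
  case (multiform_fibre p i)
  have z: "multiform S 0 ((\<lambda>_. 0)(p := 1)) (\<lambda>v w. 0)"
    using multiform_smult[OF multiform.multiform_fibre[OF multiform_fibre, of i], of 0] by simp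
  show ?case
  proof (rule exI[of _ "\<lambda>j v w. 0"], intro conjI allI impI)
    show "multiform S (0 - 1) ((\<lambda>_. 0)(p := 1)) (\<lambda>v w. 0)" using z by (simp only: diff_0_eq_0)
    show "multiform S 0 ((\<lambda>_. 0)(p := 1)) (\<lambda>v w. w p $ i)"
      by (rule multiform.multiform_fibre[OF multiform_fibre])
  qed simp_all
next
  case (multiform_add n e P Q)
  then obtain G H where
    "(\<forall>j. multiform S (n - 1) e (G j) \<and> (n = 0 \<longrightarrow> G j = (\<lambda>v w. 0))) \<and>
     multiform S n e (\<lambda>v w. P (f v) w) \<and>
     (\<forall>v w. P v w - P (f v) w = (\<Sum>j\<in>I. s j v * G j v w))"
    "(\<forall>j. multiform S (n - 1) e (H j) \<and> (n = 0 \<longrightarrow> H j = (\<lambda>v w. 0))) \<and>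
     multiform S n e (\<lambda>v w. Q (f v) w) \<and>
     (\<forall>v w. Q v w - Q (f v) w = (\<Sum>j\<in>I. s j v * H j v w))" by blast
  then show ?case
    by (intro exI[of _ "\<lambda>j v w. G j v w + H j v w"])
      (auto intro!: multiform.multiform_add simp: distrib_left sum.distrib add_diff_add)
next
  case (multiform_mult n e P n' e' Q)
  then obtain G H where
    G: "\<And>j. multiform S (n - 1) e (G j)" "\<And>j. n = 0 \<Longrightarrow> G j = (\<lambda>v w. 0)"
      "multiform S n e (\<lambda>v w. P (f v) w)"
      "\<And>v w. P v w - P (f v) w = (\<Sum>j\<in>I. s j v * G j v w)" and
    H: "\<And>j. multiform S (n' - 1) e' (H j)" "\<And>j. n' = 0 \<Longrightarrow> H j = (\<lambda>v w. 0)"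
      "multiform S n' e' (\<lambda>v w. Q (f v) w)"
      "\<And>v w. Q v w - Q (f v) w = (\<Sum>j\<in>I. s j v * H j v w)"
    by blast
  define K where "K j v w = G j v w * Q v w + P (f v) w * H j v w" for j v w
  have "multiform S (n + n' - 1) (\<lambda>p. e p + e' p) (K j)" for j
  proof -
    have g: "multiform S (n - 1 + n') (\<lambda>p. e p + e' p) (\<lambda>v w. G j v w * Q v w)"
      using G(1) multiform_mult(2) by (rule multiform.multiform_mult)
    have h: "multiform S (n + (n' - 1)) (\<lambda>p. e p + e' p) (\<lambda>v w. P (f v) w * H j v w)"
      using G(3) H(1) by (rule multiform.multiform_mult)
    consider "n = 0" | "n' = 0" "n > 0" | "n > 0" "n' > 0" by auto
    then show ?thesis
    proof cases
      case 1
      then show ?thesis using G(2) by (intro multiform_cong[OF h]) (auto simp: K_def)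
    next
      case 2
      then show ?thesis using H(2) by (intro multiform_cong[OF g]) (auto simp: K_def)
    next
      case 3
      have "multiform S (n - 1 + n') (\<lambda>p. e p + e' p) (\<lambda>v w. P (f v) w * H j v w)"
        using 3 by (intro multiform_cong[OF h]) auto
      from multiform.multiform_add[OF g this] show ?thesis
        using 3 by (elim multiform_cong) (auto simp: K_def)
    qed
  qed
  moreover have "n + n' = 0 \<longrightarrow> K j = (\<lambda>v w. 0)" for j
    using G(2) H(2) by (auto simp: K_def[abs_def])
  moreover have "multiform S (n + n') (\<lambda>p. e p + e' p) (\<lambda>v w. P (f v) w * Q (f v) w)"
    using G(3) H(3) by (rule multiform.multiform_mult)
  moreover have "P v w * Q v w - P (f v) w * Q (f v) w = (\<Sum>j\<in>I. s j v * K j v w)" for v w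
  proof -
    have "P v w * Q v w - P (f v) w * Q (f v) w =
        (P v w - P (f v) w) * Q v w + P (f v) w * (Q v w - Q (f v) w)"
      by (simp add: algebra_simps)
    also have "\<dots> = (\<Sum>j\<in>I. s j v * K j v w)"
      unfolding G(4) H(4) K_def
      by (simp add: sum_distrib_left sum_distrib_right sum.distrib algebra_simps)
    finally show ?thesis .
  qed
  ultimately show ?case by blast
qed

text \<open>Off the centres, the fibre coordinates of a point of the blow-up are determined by the
  point \<open>v\<close> of the plane: they are the joins \<open>p \<times> v\<close>. Substituting them turns a
  multihomogeneous polynomial into a form.\<close>

definition on_plane :: "multifun \<Rightarrow> vec3 \<Rightarrow> complex" where
  "on_plane P v = P v (\<lambda>p. vcross (rp p) v)"

lemma form_vcross: "form 1 (\<lambda>v. vcross p v $ i)"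
proof -
  have "form 1 (\<lambda>v. p $ a * v $ b - p $ c * v $ d)" for a b c d
    by (intro form_diff form_smult form_coord)
  then show ?thesis using exhaust_3[of i] by auto
qed

lemma form_on_plane:
  assumes "multiform S n e P" "finite S"
  shows "form (n + (\<Sum>p\<in>S. e p)) (on_plane P)"
  using assms(1)
proof (induction rule: multiform.induct)
  case (multiform_const c)
  show ?case by (simp add: on_plane_def[abs_def] form_const)
next
  case (multiform_base i)
  show ?case using form_coord by (simp add: on_plane_def[abs_def])
next
  case (multiform_fibre p i)
  have "(\<Sum>p'\<in>S. ((\<lambda>_. 0)(p := 1)) p') = (\<Sum>p'\<in>S. if p = p' then 1 else 0 :: nat)"
    by (rule sum.cong) auto
  then show ?case using multiform_fibre assms(2) form_vcross
    by (simp add: on_plane_def[abs_def])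
next
  case (multiform_add n e P Q)
  then show ?case using form_add by (simp add: on_plane_def[abs_def])
next
  case (multiform_mult n e P n' e' Q)
  from form_mult[OF multiform_mult(3,4)] show ?case
    by (simp add: on_plane_def[abs_def] sum.distrib algebra_simps)
qed

lemma blowup_fibre_coordinates:
  assumes "(q, l) \<in> blowup S" "p \<in> S" "q \<noteq> p"
  obtains c where "c \<noteq> 0" "rp (l p) = c *s vcross (rp p) (rp q)"
  using assms line_through_unique[of q p "l p"] by (auto simp: blowup_def)

lemma eval_at_off_centres:
  assumes "finite S" "(q, l) \<in> blowup S" "q \<notin> S"
  obtains c where "\<And>p. c p \<noteq> 0"
    "\<And>n e P. multiform S n e P \<Longrightarrow>
      eval_at P (q, l) = (\<Prod>p\<in>S. c p ^ e p) * on_plane P (rp q)"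
proof -
  have "\<exists>c. c \<noteq> 0 \<and> (p \<in> S \<longrightarrow> rp (l p) = c *s vcross (rp p) (rp q))" for p
    using blowup_fibre_coordinates[OF assms(2), of p] assms(3) by (metis one_neq_zero)
  then obtain c where c: "\<And>p. c p \<noteq> 0 \<and> (p \<in> S \<longrightarrow> rp (l p) = c p *s vcross (rp p) (rp q))"
    by metis
  show thesis
  proof (rule that[of c])
    fix n e P assume P: "multiform S n e P"
    have "eval_at P (q, l) = P (1 *s rp q) (\<lambda>p. c p *s vcross (rp p) (rp q))"
      unfolding eval_at_def using c
      by (auto intro!: multiform_depends[OF P] dest!: multiform_supportD[OF P])
    also have "\<dots> = (\<Prod>p\<in>S. c p ^ e p) * on_plane P (rp q)"
      unfolding multiform_scale[OF P assms(1)] by (simp add: on_plane_def)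
    finally show "eval_at P (q, l) = (\<Prod>p\<in>S. c p ^ e p) * on_plane P (rp q)" .
  qed (use c in auto)
qed

text \<open>The complement of the exceptional curves is dense: a point over a centre \<open>q\<close> is the limit
  along the line through \<open>q\<close> that it prescribes.\<close>

lemma eval_at_eq_0:
  assumes "multiform S n e R" "finite S" "\<And>v. on_plane R v = 0" "(q, l) \<in> blowup S"
  shows "eval_at R (q, l) = 0"
proof -
  \<comment> \<open>The arc is \<open>q + t z\<close> in the plane. Over \<open>q\<close> itself the join \<open>q \<times> (q + t z) = t (q \<times> z)\<close> is
    divided by \<open>t\<close>, which makes it the prescribed line in the limit.\<close>
  have "\<exists>z. q \<in> S \<longrightarrow> rp (l q) = vcross (rp q) z"
    using assms(4) orthogonal_imp_vcross[of "rp (l q)" "rp q"]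
    by (auto simp: blowup_def on_iff)
  then obtain z where z: "q \<in> S \<Longrightarrow> rp (l q) = vcross (rp q) z" by blast
  define a where "a p = (if p = q then vcross (rp q) z else vcross (rp p) (rp q))" for p
  define b where "b p = (if p = q then 0 else vcross (rp p) z)" for p
  obtain r where r: "\<And>t. R (rp q + t *s z) (\<lambda>p. a p + t *s b p) = poly r t"
    using multiform_arc[OF assms(1,2), of z 1 "rp q" a b] by auto
  have "poly r t = 0" if "t \<noteq> 0" for t
  proof -
    define d where "d p = (if p = q then t else 1)" for p
    have "vcross (rp p) (rp q + t *s z) = d p *s (a p + t *s b p)" for p
      by (auto simp: a_def b_def d_def vcross_add vcross_smult)
    then have "on_plane R (rp q + t *s z) =
        R (1 *s (rp q + t *s z)) (\<lambda>p. d p *s (a p + t *s b p))"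
      by (simp add: on_plane_def)
    also have "\<dots> = (\<Prod>p\<in>S. d p ^ e p) * poly r t"
      unfolding multiform_scale[OF assms(1,2)] r by simp
    finally show ?thesis using assms(2,3) that by (auto simp: d_def prod_zero_iff split: if_splits)
  qed
  then have "r = 0"
    using poly_roots_finite[of r] infinite_UNIV_char_0[where ?'a = complex]
      finite_subset[of UNIV "insert 0 {t. poly r t = 0}"] by auto
  then have 0: "R (rp q) a = 0" using r[of 0] by simp
  have "\<exists>c. p \<in> S \<longrightarrow> rp (l p) = c *s a p" for p
    using z blowup_fibre_coordinates[OF assms(4), of p] vector_smult_lid[of "rp (l q)"]
    unfolding a_def by metis
  then obtain c where c: "\<And>p. p \<in> S \<Longrightarrow> rp (l p) = c p *s a p" by metis
  have "eval_at R (q, l) = R (1 *s rp q) (\<lambda>p. c p *s a p)"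
    unfolding eval_at_def using c
    by (auto intro!: multiform_depends[OF assms(1)] dest!: multiform_supportD[OF assms(1)])
  also have "\<dots> = 0" unfolding multiform_scale[OF assms(1,2)] by (simp add: 0)
  finally show ?thesis .
qed

section \<open>Rational functions and local rings\<close>

lemma ratfun_cases:
  obtains n F G u where "form n F" "form n G" "G u \<noteq> 0" "f = quot F G"
proof -
  have "frac_rel (rep_ratfun f) (rep_ratfun f)"
    by (rule Quotient3_rep_reflp[OF Quotient3_ratfun])
  moreover have "f = quot (fst (rep_ratfun f)) (snd (rep_ratfun f))"
    unfolding quot_def by (simp add: Quotient3_abs_rep[OF Quotient3_ratfun])
  ultimately show thesis using that by (auto simp: frac_rel_def frac_valid_def)
qed

lemma frac_rel_refl:
  "form n F \<Longrightarrow> form n G \<Longrightarrow> G u \<noteq> 0 \<Longrightarrow> frac_rel (F, G) (F, G)"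
  by (auto simp: frac_rel_def frac_valid_def)

lemma quot_eq_iff:
  assumes "form n F" "form n G" "G u \<noteq> 0" "form n' F'" "form n' G'" "G' u' \<noteq> 0"
  shows "quot F G = quot F' G' \<longleftrightarrow> (\<forall>v. F v * G' v = F' v * G v)"
proof -
  have "frac_rel (F, G) (F', G') \<longleftrightarrow> quot F G = quot F' G'"
    unfolding quot_def
    using Quotient3_rel[OF Quotient3_ratfun, of "(F, G)" "(F', G')"]
      frac_rel_refl[of n F G u] frac_rel_refl[of n' F' G' u'] assms by simp
  then show ?thesis using assms by (auto simp: frac_rel_def frac_valid_def)
qed

lemma quot_mult:
  assumes "form n F" "form n G" "G u \<noteq> 0" "form n' F'" "form n' G'" "G' u' \<noteq> 0"
  shows "quot F G * quot F' G' = quot (\<lambda>v. F v * F' v) (\<lambda>v. G v * G' v)"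
  unfolding quot_def
  using times_ratfun.abs_eq[OF frac_rel_refl frac_rel_refl, OF assms]
  by (simp add: frac_times_def)

lemma quot_zero: "quot (\<lambda>v. 0) (\<lambda>v. 1) = 0"
  by (simp add: quot_def zero_ratfun_def frac_const_def)

lemma quot_one: "quot (\<lambda>v. 1) (\<lambda>v. 1) = 1"
  by (simp add: quot_def one_ratfun_def frac_const_def)

lemma quot_eq_0_iff:
  assumes "form n F" "form n G" "G u \<noteq> 0"
  shows "quot F G = 0 \<longleftrightarrow> (\<forall>v. F v = 0)"
  using quot_eq_iff[OF assms form_const[of 0] form_const[of 1]] by (simp add: quot_zero)

lemma quot_eq_1_iff:
  assumes "form n F" "form n G" "G u \<noteq> 0"
  shows "quot F G = 1 \<longleftrightarrow> (\<forall>v. F v = G v)"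
  using quot_eq_iff[OF assms form_const[of 1] form_const[of 1]] by (simp add: quot_one)

lemma quot_chain:
  assumes "form n F" "form n G" "form n H" "G u \<noteq> 0" "H w \<noteq> 0"
  shows "quot F H = quot F G * quot G H"
proof -
  obtain z where z: "G z * H z \<noteq> 0" using form_nonzero_mult[OF assms(2-5)] by blast
  have "quot F G * quot G H = quot (\<lambda>v. F v * G v) (\<lambda>v. G v * H v)"
    by (rule quot_mult[OF assms(1,2,4) assms(2,3,5)])
  then show ?thesis
    using quot_eq_iff[OF assms(1,3,5) form_mult[OF assms(1,2)] form_mult[OF assms(2,3)] z]
    by (simp add: mult_ac)
qed

lemma quot_inverse:
  assumes "form n F" "form n G" "G u \<noteq> 0" "F u' \<noteq> 0"
  shows "inverse (quot F G) = quot G F"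
proof -
  obtain w where "G w * F w \<noteq> 0" using form_nonzero_mult[OF assms(2,1,3,4)] by blast
  then have "quot F G * quot G F = 1"
    unfolding quot_mult[OF assms(1-3) assms(2,1,4)]
    using quot_eq_1_iff[OF form_mult[OF assms(1,2)] form_mult[OF assms(2,1)]]
    by (simp add: mult.commute)
  then show ?thesis by (rule inverse_unique)
qed

lemma quot_divide:
  assumes "form n F" "form n G" "G u \<noteq> 0" "form n' F'" "form n' G'" "G' u' \<noteq> 0" "F' u'' \<noteq> 0"
  shows "quot F G / quot F' G' = quot (\<lambda>v. F v * G' v) (\<lambda>v. G v * F' v)"
  unfolding divide_inverse quot_inverse[OF assms(4-7)]
  by (rule quot_mult[OF assms(1-3) assms(5,4,7)])

lemma quot_power:
  assumes "form n F" "form n G" "G u \<noteq> 0"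
  shows "quot F G ^ k = quot (\<lambda>v. F v ^ k) (\<lambda>v. G v ^ k)"
proof (induction k)
  case 0
  show ?case by (simp add: quot_one)
next
  case (Suc k)
  have "G u ^ k \<noteq> 0" using assms(3) by simp
  from quot_mult[OF assms form_power[OF assms(1)] form_power[OF assms(2)] this] show ?case
    using Suc by simp
qed

lemma quot_add:
  assumes "form n F" "form n F'" "form n G" "G u \<noteq> 0"
  shows "quot F G + quot F' G = quot (\<lambda>v. F v + F' v) G"
proof -
  have "quot F G + quot F' G = quot (\<lambda>v. F v * G v + F' v * G v) (\<lambda>v. G v * G v)"
    using plus_ratfun.abs_eq[OF frac_rel_refl[OF assms(1,3,4)] frac_rel_refl[OF assms(2-4)]]
    by (simp add: quot_def frac_plus_def)
  also have "\<dots> = quot (\<lambda>v. F v + F' v) G"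
    by (subst quot_eq_iff[OF form_add[OF form_mult[OF assms(1,3)] form_mult[OF assms(2,3)]]
          form_mult[OF assms(3,3)] _ form_add[OF assms(1,2)] assms(3,4)])
      (use assms(4) in \<open>auto simp: algebra_simps\<close>)
  finally show ?thesis .
qed

lemma scale_quot:
  assumes "form n F" "form n G" "G u \<noteq> 0"
  shows "scale_ratfun c (quot F G) = quot (\<lambda>v. c * F v) G"
proof -
  have "const_ratfun c = quot (\<lambda>v. c) (\<lambda>v. 1)"
    by (simp add: quot_def const_ratfun_def frac_const_def)
  then show ?thesis
    using quot_mult[OF form_const[of c] form_const[of 1] _ assms] by (simp add: scale_ratfun_def)
qed

lemma blowup_nonempty_fibre:
  obtains l where "(q, l) \<in> blowup S"
proof
  define a where "a p = (if q = p then SOME b. b \<noteq> 0 \<and> dot b (rp p) = 0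
    else vcross (rp p) (rp q))" for p
  have "a p \<noteq> 0 \<and> dot (a p) (rp p) = 0 \<and> dot (a p) (rp q) = 0" for p
  proof (cases "q = p")
    case True
    have "\<exists>b. b \<noteq> 0 \<and> dot b (rp p) = 0"
      using exists_nonparallel[OF rp_nonzero] dot_vcross(3) by metis
    from someI_ex[OF this] show ?thesis using True by (simp add: a_def)
  next
    case False
    then show ?thesis using vcross_rp_nonzero[of p q] by (auto simp: a_def)
  qed
  then have "p on abs_proj_plane (a p) \<and> q on abs_proj_plane (a p)" for p
    using rp_abs[of "a p"] by (metis dot_smult(2) mult_zero_right on_iff)
  then show "(q, \<lambda>p. if p \<in> S then abs_proj_plane (a p) else undefined) \<in> blowup S"
    by (auto simp: blowup_def extensional_def)
qed

text \<open>Regularity at a point of the blow-up, tested on the plane with the joins \<open>p \<times> v\<close>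
  substituted for the fibre coordinates, and for any given representation of the function: this
  is where the density of the complement of the exceptional curves enters.\<close>

lemma local_ring_iff:
  assumes S: "finite S" and x: "x \<in> blowup S" and F: "form n F" and G: "form n G" "G u \<noteq> 0"
  shows "quot F G \<in> local_ring S x \<longleftrightarrow> (\<exists>k e P Q. multiform S k e P \<and> multiform S k e Q \<and>
    eval_at Q x \<noteq> 0 \<and> (\<forall>v. F v * on_plane Q v = G v * on_plane P v))"
proof
  assume "quot F G \<in> local_ring S x"
  then obtain F' G' n' P Q e k w where f: "form n' F'" "form n' G'" "G' w \<noteq> 0"
      "quot F G = quot F' G'" and PQ: "multiform S k e P" "multiform S k e Q" "eval_at Q x \<noteq> 0" and
      eq: "\<And>y. y \<in> blowup S \<Longrightarrow> F' (rp (fst y)) * eval_at Q y = G' (rp (fst y)) * eval_at P y"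
    unfolding local_ring_def by blast
  have cross: "F v * G' v = F' v * G v" for v
    using quot_eq_iff[OF F G f(1-3)] f(4) by blast
  let ?m = "n' + (k + (\<Sum>p\<in>S. e p))"
  have form': "form ?m (\<lambda>v. F' v * on_plane Q v)" "form ?m (\<lambda>v. G' v * on_plane P v)"
    by (intro form_mult f form_on_plane PQ S)+
  \<comment> \<open>Every point of the plane off the centres lies under a point of the blow-up, so the identity
    that defines regularity becomes an identity of forms.\<close>
  have 0: "F' v * on_plane Q v - G' v * on_plane P v = 0" for v
  proof (rule form_zero_off_points[OF form_diff[OF form'] S])
    fix v :: vec3 assume v: "v \<noteq> 0" "abs_proj_plane v \<notin> S"
    let ?q = "abs_proj_plane v"
    obtain c where c: "c \<noteq> 0" "rp ?q = c *s v" using rp_abs[OF v(1)] .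
    obtain l where y: "(?q, l) \<in> blowup S" using blowup_nonempty_fibre .
    obtain b where b: "\<And>p. b p \<noteq> 0" "\<And>n e P. multiform S n e P \<Longrightarrow>
        eval_at P (?q, l) = (\<Prod>p\<in>S. b p ^ e p) * on_plane P (rp ?q)"
      using eval_at_off_centres[OF S y v(2)] by blast
    have "(\<Prod>p\<in>S. b p ^ e p) \<noteq> 0" using S b(1) by simp
    then have "F' (rp ?q) * on_plane Q (rp ?q) = G' (rp ?q) * on_plane P (rp ?q)"
      using eq[OF y] b(2)[OF PQ(1)] b(2)[OF PQ(2)] by simp
    then have "c ^ ?m * (F' v * on_plane Q v - G' v * on_plane P v) = 0"
      unfolding c(2) using form_scale[OF form'(1), of c v] form_scale[OF form'(2), of c v]
      by (simp add: algebra_simps)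
    then show "F' v * on_plane Q v - G' v * on_plane P v = 0" using c(1) by simp
  qed
  have fF: "form (n + (k + sum e S)) (\<lambda>v. F v * on_plane Q v)"
    and fG: "form (n + (k + sum e S)) (\<lambda>v. G v * on_plane P v)"
    by (intro form_mult F G form_on_plane PQ S)+
  have "F v * on_plane Q v = G v * on_plane P v" for v
  proof (rule form_cancel[OF fF fG f(2,3)])
    fix v
    have "F v * on_plane Q v * G' v = (F v * G' v) * on_plane Q v" by (simp add: algebra_simps)
    also have "\<dots> = G v * (F' v * on_plane Q v)" unfolding cross by (simp add: algebra_simps)
    also have "\<dots> = G v * (G' v * on_plane P v)" using 0[of v] by simp
    finally show "F v * on_plane Q v * G' v = G v * on_plane P v * G' v"
      by (simp add: algebra_simps)
  qed
  then show "\<exists>k e P Q. multiform S k e P \<and> multiform S k e Q \<and>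
    eval_at Q x \<noteq> 0 \<and> (\<forall>v. F v * on_plane Q v = G v * on_plane P v)" using PQ by blast
next
  assume "\<exists>k e P Q. multiform S k e P \<and> multiform S k e Q \<and>
    eval_at Q x \<noteq> 0 \<and> (\<forall>v. F v * on_plane Q v = G v * on_plane P v)"
  then obtain k e P Q where PQ: "multiform S k e P" "multiform S k e Q" "eval_at Q x \<noteq> 0"
    and eq: "\<And>v. F v * on_plane Q v = G v * on_plane P v" by blast
  have R: "multiform S (n + k) e (\<lambda>v w. F v * Q v w - G v * P v w)"
    by (intro multiform_diff multiform_times_form F G PQ)
  have "eval_at (\<lambda>v w. F v * Q v w - G v * P v w) (q, l) = 0" if "(q, l) \<in> blowup S" for q l
    by (rule eval_at_eq_0[OF R S _ that]) (use eq in \<open>simp add: on_plane_def\<close>)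
  then have "\<forall>y\<in>blowup S. F (rp (fst y)) * eval_at Q y = G (rp (fst y)) * eval_at P y"
    by (auto simp: eval_at_def)
  then show "quot F G \<in> local_ring S x" unfolding local_ring_def using F G PQ by blast
qed

lemma local_ringI:
  assumes "finite S" "x \<in> blowup S" "form n F" "form n G" "G u \<noteq> 0"
    "multiform S k e P" "multiform S k e Q" "eval_at Q x \<noteq> 0"
    "\<And>v. F v * on_plane Q v = G v * on_plane P v"
  shows "quot F G \<in> local_ring S x"
  using local_ring_iff[OF assms(1-5)] assms(6-9) by blast

lemma local_ring_cases:
  assumes "finite S" "x \<in> blowup S" "f \<in> local_ring S x"
  obtains n F G u k e P Q where "form n F" "form n G" "G u \<noteq> 0" "f = quot F G"
    "multiform S k e P" "multiform S k e Q" "eval_at Q x \<noteq> 0"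
    "\<And>v. F v * on_plane Q v = G v * on_plane P v"
    "\<And>y. y \<in> blowup S \<Longrightarrow> eval_at Q y \<noteq> 0 \<Longrightarrow> f \<in> local_ring S y"
proof -
  obtain n F G u where f: "form n F" "form n G" "G u \<noteq> 0" "f = quot F G" by (rule ratfun_cases)
  then obtain k e P Q where PQ: "multiform S k e P" "multiform S k e Q" "eval_at Q x \<noteq> 0"
    "\<And>v. F v * on_plane Q v = G v * on_plane P v"
    using local_ring_iff[OF assms(1,2) f(1-3)] assms(3) by blast
  show thesis
    by (rule that[OF f PQ]) (use f PQ assms(1) in \<open>auto intro: local_ringI\<close>)
qed

lemma local_ring_mult:
  assumes S: "finite S" "x \<in> blowup S" and f: "f \<in> local_ring S x" "g \<in> local_ring S x"
  shows "f * g \<in> local_ring S x"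
proof -
  obtain n F G u k e P Q where 1: "form n F" "form n G" "G u \<noteq> 0" "f = quot F G"
    "multiform S k e P" "multiform S k e Q" "eval_at Q x \<noteq> 0"
    "\<And>v. F v * on_plane Q v = G v * on_plane P v"
    using local_ring_cases[OF S f(1)] by metis
  obtain n' F' G' u' k' e' P' Q' where 2: "form n' F'" "form n' G'" "G' u' \<noteq> 0" "g = quot F' G'"
    "multiform S k' e' P'" "multiform S k' e' Q'" "eval_at Q' x \<noteq> 0"
    "\<And>v. F' v * on_plane Q' v = G' v * on_plane P' v"
    using local_ring_cases[OF S f(2)] by metis
  obtain w where w: "G w * G' w \<noteq> 0" using form_nonzero_mult[OF 1(2) 2(2) 1(3) 2(3)] by blast
  show ?thesis
    unfolding 1(4) 2(4) quot_mult[OF 1(1-3) 2(1-3)]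
  proof (rule local_ringI[OF S form_mult[OF 1(1) 2(1)] form_mult[OF 1(2) 2(2)] w
        multiform_mult[OF 1(5) 2(5)] multiform_mult[OF 1(6) 2(6)]])
    show "eval_at (\<lambda>v w. Q v w * Q' v w) x \<noteq> 0" using 1(7) 2(7) by (simp add: eval_at_def)
    fix v
    have "F v * F' v * on_plane (\<lambda>v w. Q v w * Q' v w) v =
        (F v * on_plane Q v) * (F' v * on_plane Q' v)"
      by (simp add: on_plane_def)
    then show "F v * F' v * on_plane (\<lambda>v w. Q v w * Q' v w) v =
        G v * G' v * on_plane (\<lambda>v w. P v w * P' v w) v"
      unfolding 1(8) 2(8) by (simp add: on_plane_def)
  qed
qed

lemma local_ring_one:
  assumes "finite S" "x \<in> blowup S"
  shows "1 \<in> local_ring S x"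
  unfolding quot_one[symmetric]
  by (rule local_ringI[OF assms form_const[of 1] form_const[of 1] _
      multiform_const[of _ 1] multiform_const[of _ 1]])
    (auto simp: eval_at_def on_plane_def)

lemma local_units_mult:
  "finite S \<Longrightarrow> x \<in> blowup S \<Longrightarrow> f \<in> local_units S x \<Longrightarrow> g \<in> local_units S x \<Longrightarrow>
    f * g \<in> local_units S x"
  by (simp add: local_units_def local_ring_mult)

lemma local_units_one: "finite S \<Longrightarrow> x \<in> blowup S \<Longrightarrow> 1 \<in> local_units S x"
  by (simp add: local_units_def local_ring_one)

lemma local_units_inverse: "f \<in> local_units S x \<Longrightarrow> inverse f \<in> local_units S x"
  by (simp add: local_units_def)

lemma local_units_powi:
  assumes "finite S" "x \<in> blowup S" "f \<in> local_units S x"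
  shows "f powi k \<in> local_units S x"
proof -
  have pw: "f ^ j \<in> local_units S x" for j
    by (induction j) (simp_all add: assms local_units_one local_units_mult)
  then show ?thesis
    using pw[of "nat (- k)"] pw[of "nat k"] local_units_inverse[of "f ^ nat (- k)"] by (auto simp: power_int_def power_inverse)
qed

lemma local_units_prod:
  assumes "finite S" "x \<in> blowup S" "\<And>i. i \<in> I \<Longrightarrow> f i \<in> local_units S x"
  shows "(\<Prod>i\<in>I. f i) \<in> local_units S x"
  using assms(3)
  by (induction I rule: infinite_finite_induct)
    (simp_all add: assms(1,2) local_units_one local_units_mult)

lemma local_units_cancel:
  assumes "finite S" "x \<in> blowup S" "g \<in> local_units S x" "f * g \<in> local_ring S x"
  shows "f \<in> local_ring S x"
proof -
  have "f * g * inverse g \<in> local_ring S x"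
    using assms by (intro local_ring_mult[of S x "f * g"]) (auto simp: local_units_def)
  moreover have "g \<noteq> 0" using assms(3) by (simp add: local_units_def)
  ultimately show ?thesis by (simp add: mult.assoc)
qed

section \<open>Forms vanishing on a line or at a point\<close>

text \<open>If \<open>n = 0\<close> then \<open>F\<close> is constant and vanishes at the origin; the quotient is then \<open>0\<close>, which
  has the truncated degree \<open>n - 1 = 0\<close> as well.\<close>

lemma form_div_line:
  assumes F: "form n F" and a: "a \<noteq> 0" and van: "\<And>v. dot a v = 0 \<Longrightarrow> F v = 0"
  shows "\<exists>G. form (n - 1) G \<and> (n = 0 \<longrightarrow> G = (\<lambda>v. 0)) \<and> (\<forall>v. F v = dot a v * G v)"
proof -
  obtain u where u: "dot a u = 1" using dot_normalised[OF a] by (metis dot_commute)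
  \<comment> \<open>the projection to the line with centre \<open>u\<close>\<close>
  define f where "f v = v - dot a v *s u" for v
  have lin: "form 1 (\<lambda>v. f v $ i)" for i
    using form_diff[OF form_coord[of i] form_smult[OF form_dot[of a], of "u $ i"]]
    by (simp add: f_def mult.commute)
  have "\<exists>G. (\<forall>j. multiform {} (n - 1) (\<lambda>_. 0) (G j) \<and> (n = 0 \<longrightarrow> G j = (\<lambda>v w. 0))) \<and>
      multiform {} n (\<lambda>_. 0) (\<lambda>v w. F (f v)) \<and>
      (\<forall>v w. F v - F (f v) = (\<Sum>j\<in>{()}. dot a v * G j v w))"
    by (rule multiform_difference[OF multiform_of_form[OF F, of "{}"], where d = "\<lambda>_. u"])
      (use lin form_dot in \<open>simp_all add: f_def\<close>)
  then obtain G where G: "multiform {} (n - 1) (\<lambda>_. 0) (G ())"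
      "n = 0 \<Longrightarrow> G () = (\<lambda>v w. 0)" "\<And>v w. F v - F (f v) = dot a v * G () v w"
    by auto
  have "dot a (f v) = 0" for v
    using u by (simp add: f_def dot_diff dot_smult)
  then have "F v = dot a v * on_plane (G ()) v" for v
    using G(3)[of v "\<lambda>p. vcross (rp p) v"] van by (simp add: on_plane_def)
  moreover have "form (n - 1) (on_plane (G ()))" using form_on_plane[OF G(1)] by simp
  moreover have "n = 0 \<longrightarrow> on_plane (G ()) = (\<lambda>v. 0)" using G(2) by (auto simp: on_plane_def)
  ultimately show ?thesis by blast
qed

text \<open>One more order of vanishing at the centre \<open>p\<close> is one more factor from the fibre
  coordinates \<open>w p\<close>, which are \<open>p \<times> v\<close> off the exceptional curves.\<close>

lemma raise_order:
  assumes P: "multiform S (Suc a) e P" and S: "finite S" "p \<in> S"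
    and van: "\<And>v. P (rp p) (\<lambda>p'. vcross (rp p') v) = 0"
  shows "\<exists>Q. multiform S a (e(p := Suc (e p))) Q \<and> on_plane Q = on_plane P"
proof -
  obtain c where c: "dot c (rp p) = 1" using dot_normalised[OF rp_nonzero] by blast
  \<comment> \<open>By the expansion of the triple product, \<open>v - f v\<close> is linear in \<open>p \<times> v\<close>.\<close>
  define f where "f v = dot c v *s rp p" for v
  have lin: "form 1 (\<lambda>v. f v $ i)" for i
    using form_smult[OF form_dot[of c], of "rp p $ i"] by (simp add: f_def mult.commute)
  have split: "v = f v + (\<Sum>j\<in>UNIV. vcross (rp p) v $ j *s (- vcross c (axis j 1)))" for v
  proof -
    have "v - f v = - vcross c (vcross (rp p) v)"
      unfolding triple_product f_def using c by simp
    also have "\<dots> = (\<Sum>j\<in>UNIV. vcross (rp p) v $ j *s (- vcross c (axis j 1)))"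
      by (simp add: vec_eq_iff forall_3 sum_3 axis_def algebra_simps)
    finally show ?thesis by (simp add: algebra_simps)
  qed
  have "\<exists>G. (\<forall>j. multiform S (Suc a - 1) e (G j) \<and> (Suc a = 0 \<longrightarrow> G j = (\<lambda>v w. 0))) \<and>
      multiform S (Suc a) e (\<lambda>v w. P (f v) w) \<and>
      (\<forall>v w. P v w - P (f v) w = (\<Sum>j\<in>UNIV. vcross (rp p) v $ j * G j v w))"
    by (rule multiform_difference[OF P finite lin form_vcross split])
  then obtain G where G: "\<And>j. multiform S a e (G j)"
      "\<And>v w. P v w - P (f v) w = (\<Sum>j\<in>UNIV. vcross (rp p) v $ j * G j v w)"
    by auto
  define Q where "Q v w = (\<Sum>j\<in>UNIV. w p $ j * G j v w)" for v w
  have "multiform S a (e(p := Suc (e p))) (\<lambda>v w. w p $ j * G j v w)" for j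
    by (rule multiform_cong[OF multiform_mult[OF multiform_fibre[OF S(2), of j] G(1)[of j]]]) auto
  then have "multiform S a (e(p := Suc (e p))) Q"
    unfolding Q_def[abs_def] sum_3 by (intro multiform_add)
  moreover have "on_plane Q v = on_plane P v" for v
  proof -
    have "P (f v) (\<lambda>p'. 1 *s vcross (rp p') v) = 0"
      unfolding f_def multiform_scale[OF P S(1)] using van by simp
    then show ?thesis
      using G(2)[of v "\<lambda>p'. vcross (rp p') v"] by (simp add: on_plane_def Q_def)
  qed
  ultimately show ?thesis by blast
qed


section \<open>Local equations\<close>

text \<open>Every point has a canonical linear form that does not vanish at it, the one with the
  conjugate coefficients. So there are explicit local equations: for the line \<open>a\<close>, the
  form \<open>a\<close> over \<open>unit_form x\<close>; for the exceptional curve over \<open>p\<close>, the form \<open>s (p \<times> v)\<close> over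
  \<open>unit_form x\<close>, where \<open>s\<close> does not vanish on the line through \<open>p\<close> that belongs to \<open>x\<close>. The latter
  is a unit if \<open>x\<close> does not lie over \<open>p\<close>, so no case distinction is needed.\<close>

definition unit_form :: "blowup_point \<Rightarrow> vec3 \<Rightarrow> complex" where
  "unit_form x = dot (\<chi> i. cnj (rp (fst x) $ i))"

definition centre_form :: "proj_plane \<Rightarrow> blowup_point \<Rightarrow> vec3 \<Rightarrow> complex" where
  "centre_form p x v = dot (\<chi> i. cnj (rp (snd x p) $ i)) (vcross (rp p) v)"

definition line_eq :: "vec3 \<Rightarrow> blowup_point \<Rightarrow> ratfun" where
  "line_eq a x = quot (dot a) (unit_form x)"

definition centre_eq :: "proj_plane \<Rightarrow> blowup_point \<Rightarrow> ratfun" where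
  "centre_eq p x = quot (centre_form p x) (unit_form x)"

lemma form_unit_form: "form 1 (unit_form x)"
  unfolding unit_form_def by (rule form_dot)

lemma unit_form_nonzero: "unit_form x (rp (fst x)) \<noteq> 0"
  unfolding unit_form_def by (rule dot_cnj_nonzero) simp

lemma form_dot_vcross: "form 1 (\<lambda>v. dot s (vcross p v))"
  by (rule form_compose[OF form_dot form_vcross])

lemma form_centre_form: "form 1 (centre_form p x)"
  unfolding centre_form_def[abs_def] by (rule form_dot_vcross)

lemma dot_vcross_nonzero:
  assumes "(q, l) \<in> blowup S" "p \<in> S" "dot s (rp (l p)) \<noteq> 0"
  obtains v where "dot s (vcross (rp p) v) \<noteq> 0"
proof -
  have "dot (rp (l p)) (rp p) = 0" using assms by (auto simp: blowup_def on_iff)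
  then obtain z where "rp (l p) = vcross (rp p) z" using orthogonal_imp_vcross rp_nonzero by blast
  then show thesis using that assms by metis
qed

lemma centre_form_nonzero:
  assumes "x \<in> blowup S" "p \<in> S"
  obtains v where "centre_form p x v \<noteq> 0"
  using dot_vcross_nonzero[of "fst x" "snd x" S p] assms dot_cnj_nonzero[OF rp_nonzero]
  unfolding centre_form_def by (metis prod.collapse)

lemma centre_form_off_centre:
  assumes "x \<in> blowup S" "p \<in> S" "fst x \<noteq> p"
  shows "centre_form p x (rp (fst x)) \<noteq> 0"
proof -
  obtain c where "c \<noteq> 0" "rp (snd x p) = c *s vcross (rp p) (rp (fst x))"
    using blowup_fibre_coordinates[of "fst x" "snd x" S p] assms by auto
  then show ?thesis
    using dot_cnj_nonzero[OF rp_nonzero[of "snd x p"]] unfolding centre_form_def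
    by (metis dot_smult(1) mult_zero_right)
qed

lemma quot_regular:
  assumes "finite S" "x \<in> blowup S" "form n F" "form n G" "G (rp (fst x)) \<noteq> 0"
  shows "quot F G \<in> local_ring S x"
  by (rule local_ringI[OF assms multiform_of_form[OF assms(3)] multiform_of_form[OF assms(4)]])
    (use assms(5) in \<open>auto simp: eval_at_def on_plane_def\<close>)

lemma quot_unit:
  assumes "finite S" "x \<in> blowup S" "form n F" "form n G"
    "F (rp (fst x)) \<noteq> 0" "G (rp (fst x)) \<noteq> 0"
  shows "quot F G \<in> local_units S x"
  using quot_regular[OF assms(1-4,6)] quot_regular[OF assms(1,2,4,3,5)]
    quot_inverse[OF assms(3,4,6,5)] quot_eq_0_iff[OF assms(3,4,6)] assms(5)
  by (auto simp: local_units_def)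

text \<open>On the blow-up, \<open>s (p \<times> v)\<close> and \<open>s' (p \<times> v)\<close> share the factor that vanishes on the
  exceptional curve; their quotient is that of the values of \<open>s\<close> and \<open>s'\<close> on the fibre coordinate.\<close>

lemma fibre_quot_unit:
  assumes S: "finite S" and x: "x \<in> blowup S" and p: "p \<in> S"
    and s: "dot s (rp (snd x p)) \<noteq> 0" "dot s' (rp (snd x p)) \<noteq> 0"
  shows "quot (\<lambda>v. dot s (vcross (rp p) v)) (\<lambda>v. dot s' (vcross (rp p) v)) \<in> local_units S x"
proof -
  have x': "(fst x, snd x) \<in> blowup S" using x by simp
  obtain u where u: "dot s (vcross (rp p) u) \<noteq> 0" using dot_vcross_nonzero[OF x' p s(1)] .
  obtain u' where u': "dot s' (vcross (rp p) u') \<noteq> 0" using dot_vcross_nonzero[OF x' p s(2)] .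
  have "quot (\<lambda>v. dot b (vcross (rp p) v)) (\<lambda>v. dot b' (vcross (rp p) v)) \<in> local_ring S x"
    if "dot b' (rp (snd x p)) \<noteq> 0" "dot b' (vcross (rp p) w) \<noteq> 0" for b b' w
    by (rule local_ringI[OF S x form_dot_vcross form_dot_vcross that(2)
        multiform_fibre_dot[OF p, of b] multiform_fibre_dot[OF p, of b']])
      (use that in \<open>auto simp: eval_at_def on_plane_def\<close>)
  from this[OF s(2) u'] this[OF s(1) u] show ?thesis
    using quot_inverse[OF form_dot_vcross form_dot_vcross u' u]
      quot_eq_0_iff[OF form_dot_vcross form_dot_vcross u'] u by (auto simp: local_units_def)
qed

lemma centre_eq_unit:
  assumes "finite S" "x \<in> blowup S" "p \<in> S" "fst x \<noteq> p"
  shows "centre_eq p x \<in> local_units S x"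
  unfolding centre_eq_def
  by (rule quot_unit[OF assms(1,2) form_centre_form form_unit_form
      centre_form_off_centre[OF assms(2-4)] unit_form_nonzero])

lemma line_eq_nonzero: "a \<noteq> 0 \<Longrightarrow> line_eq a x \<noteq> 0"
  unfolding line_eq_def
  using quot_eq_0_iff[OF form_dot form_unit_form unit_form_nonzero] dot_cnj_nonzero[of a]
  by (metis dot_commute)

lemma centre_eq_nonzero: "x \<in> blowup S \<Longrightarrow> p \<in> S \<Longrightarrow> centre_eq p x \<noteq> 0"
  unfolding centre_eq_def
  using quot_eq_0_iff[OF form_centre_form form_unit_form unit_form_nonzero] centre_form_nonzero
  by metis

text \<open>The property for which \<open>pullback\<close> chooses a witness. Any two witnesses generate the same
  ideal, so the choice is immaterial up to units.\<close>

definition local_equation :: "proj_plane set \<Rightarrow> proj_plane set \<Rightarrow> blowup_point \<Rightarrow> ratfun \<Rightarrow> bool" where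
  "local_equation S C x f \<longleftrightarrow> f \<in> ideal_stalk C (fst x) \<and> f \<noteq> 0 \<and>
     (\<forall>g \<in> ideal_stalk C (fst x). g / f \<in> local_ring S x)"

lemma pullback_unit:
  assumes "local_equation S C x f"
  shows "pullback S C x / f \<in> local_units S x"
proof -
  have "local_equation S C x (pullback S C x)"
    unfolding pullback_def local_equation_def
    by (rule someI_ex) (use assms in \<open>auto simp: local_equation_def\<close>)
  then show ?thesis using assms by (auto simp: local_equation_def local_units_def)
qed

text \<open>A form vanishing at all points of the line is a multiple of its equation.\<close>

lemma line_eq_local_equation:
  assumes S: "finite S" and x: "x \<in> blowup S"
  shows "local_equation S (line_points H) x (line_eq (rp H) x)"
  unfolding local_equation_def
proof (intro conjI ballI)
  show "line_eq (rp H) x \<in> ideal_stalk (line_points H) (fst x)"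
    unfolding ideal_stalk_def line_eq_def
    using form_dot[of "rp H"] form_unit_form[of x] unit_form_nonzero[of x]
    by (fastforce simp: line_points_def on_iff)
  show "line_eq (rp H) x \<noteq> 0" by (rule line_eq_nonzero) simp
  fix g assume "g \<in> ideal_stalk (line_points H) (fst x)"
  then obtain F G n where g: "g = quot F G" "form n F" "form n G" "G (rp (fst x)) \<noteq> 0"
    "\<And>r. r on H \<Longrightarrow> F (rp r) = 0" by (auto simp: ideal_stalk_def line_points_def)
  have "F v = 0" if nz: "dot (rp H) v = 0" "v \<noteq> 0" for v
  proof -
    obtain c where c: "c \<noteq> 0" "rp (abs_proj_plane v) = c *s v" using rp_abs[OF nz(2)] .
    then have "abs_proj_plane v on H" using nz by (simp add: on_iff dot_smult)
    then show ?thesis using g(5)[of "abs_proj_plane v"] form_scale[OF g(2), of c v] c by simp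
  qed
  moreover have "F 0 = 0"
  proof (cases n)
    case 0
    obtain z where "vcross (rp H) z \<noteq> 0" using exists_nonparallel[OF rp_nonzero] .
    then have "F (vcross (rp H) z) = 0" using calculation[of "vcross (rp H) z"] by simp
    then show ?thesis
      using form_scale[OF g(2), of 0 "vcross (rp H) z"] 0 by simp
  next
    case (Suc k)
    then show ?thesis using form_at_0[OF g(2)] by simp
  qed
  ultimately obtain F1 where F1: "form (n - 1) F1" "n = 0 \<Longrightarrow> F1 = (\<lambda>v. 0)"
    "\<And>v. F v = dot (rp H) v * F1 v"
    using form_div_line[OF g(2), of "rp H"] rp_nonzero by metis
  obtain u where u: "dot (rp H) u \<noteq> 0" using dot_cnj_nonzero[OF rp_nonzero] dot_commute by metis
  have F1u: "form n (\<lambda>v. F1 v * unit_form x v)"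
  proof (cases n)
    case 0
    then show ?thesis using F1(2) form_const[of 0] by simp
  next
    case (Suc k)
    then show ?thesis using form_mult[OF F1(1) form_unit_form[of x]] by simp
  qed
  obtain w where w: "G w * dot (rp H) w \<noteq> 0"
    using form_nonzero_mult[OF g(3) form_dot g(4) u] by blast
  have "g / line_eq (rp H) x = quot (\<lambda>v. F v * unit_form x v) (\<lambda>v. G v * dot (rp H) v)"
    unfolding g(1) line_eq_def
    by (rule quot_divide[OF g(2,3,4) form_dot form_unit_form unit_form_nonzero u])
  also have "\<dots> = quot (\<lambda>v. F1 v * unit_form x v) G"
    using quot_eq_iff[OF form_mult[OF g(2) form_unit_form] form_mult[OF g(3) form_dot] w F1u g(3,4)]
      F1(3) by simp
  also have "\<dots> \<in> local_ring S x" by (rule quot_regular[OF S x F1u g(3,4)])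
  finally show "g / line_eq (rp H) x \<in> local_ring S x" .
qed

text \<open>A form vanishing at \<open>p\<close> is a combination of the coordinates of \<open>p \<times> v\<close>, and on the blow-up
  each of these is divisible by \<open>s (p \<times> v)\<close>.\<close>

lemma centre_eq_local_equation:
  assumes S: "finite S" and x: "x \<in> blowup S" and p: "p \<in> S"
  shows "local_equation S {p} x (centre_eq p x)"
  unfolding local_equation_def
proof (intro conjI ballI)
  show "centre_eq p x \<in> ideal_stalk {p} (fst x)"
    unfolding ideal_stalk_def centre_eq_def
    using form_centre_form[of p x] form_unit_form[of x] unit_form_nonzero[of x]
    by (fastforce simp: centre_form_def)
  show "centre_eq p x \<noteq> 0" by (rule centre_eq_nonzero[OF x p])
  fix g assume "g \<in> ideal_stalk {p} (fst x)"
  then obtain F G n where g: "g = quot F G" "form n F" "form n G" "G (rp (fst x)) \<noteq> 0"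
    "F (rp p) = 0" by (auto simp: ideal_stalk_def)
  show "g / centre_eq p x \<in> local_ring S x"
  proof (cases n)
    case 0
    have "F v = 0" for v
      using form_scale[OF g(2), of 0 v] form_scale[OF g(2), of 0 "rp p"] g(5) 0 by simp
    then have "g = 0" unfolding g(1) using quot_eq_0_iff[OF g(2-4)] by blast
    then have "g / centre_eq p x = quot (\<lambda>v. 0) (\<lambda>v. 1)" by (simp add: quot_zero)
    then show ?thesis using quot_regular[OF S x form_const[of 0] form_const[of 1]] by simp
  next
    case (Suc a)
    obtain Q where Q: "multiform S a ((\<lambda>_. 0)(p := Suc 0)) Q" "on_plane Q = F"
      using raise_order[OF multiform_of_form[OF g(2)[unfolded Suc]] S p] g(5)
      by (auto simp: on_plane_def[of "\<lambda>v w. F v", abs_def])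
    let ?s = "\<chi> i. cnj (rp (snd x p) $ i)"
    obtain u where u: "centre_form p x u \<noteq> 0" using centre_form_nonzero[OF x p] .
    obtain w where w: "G w * centre_form p x w \<noteq> 0"
      using form_nonzero_mult[OF g(3) form_centre_form g(4) u] by blast
    have "g / centre_eq p x = quot (\<lambda>v. F v * unit_form x v) (\<lambda>v. G v * centre_form p x v)"
      unfolding g(1) centre_eq_def
      by (rule quot_divide[OF g(2,3,4) form_centre_form form_unit_form unit_form_nonzero u])
    also have "\<dots> \<in> local_ring S x"
    proof (rule local_ringI[OF S x form_mult[OF g(2) form_unit_form]
          form_mult[OF g(3) form_centre_form] w])
      show "multiform S n ((\<lambda>_. 0)(p := 1)) (\<lambda>v w. unit_form x v * Q v w)"
        using multiform_times_form[OF form_unit_form Q(1), of x] Suc by simp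
      show "multiform S n ((\<lambda>_. 0)(p := 1)) (\<lambda>v w. G v * dot ?s (w p))"
        using multiform_times_form[OF g(3) multiform_fibre_dot[OF p]] by simp
      show "eval_at (\<lambda>v w. G v * dot ?s (w p)) x \<noteq> 0"
        using g(4) dot_cnj_nonzero[OF rp_nonzero] by (simp add: eval_at_def)
      show "F v * unit_form x v * on_plane (\<lambda>v w. G v * dot ?s (w p)) v =
          G v * centre_form p x v * on_plane (\<lambda>v w. unit_form x v * Q v w) v" for v
        using Q(2) by (auto simp: on_plane_def centre_form_def)
    qed
    finally show ?thesis .
  qed
qed

section \<open>Regularity off a finite set\<close>

text \<open>Polynomials in two variables are polynomials in \<open>y\<close> with coefficients in the ring of
  polynomials in \<open>x\<close>: in this shape they form a factorial ring.\<close>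

definition ev2 :: "complex poly poly \<Rightarrow> complex \<Rightarrow> complex \<Rightarrow> complex" where
  "ev2 P x y = poly (poly P [:y:]) x"

lemma ev2_simps [simp]:
  "ev2 (P + Q) x y = ev2 P x y + ev2 Q x y"
  "ev2 (P * Q) x y = ev2 P x y * ev2 Q x y"
  "ev2 (pCons a P) x y = poly a x + y * ev2 P x y"
  "ev2 0 x y = 0" "ev2 1 x y = 1"
  by (simp_all add: ev2_def)

lemma ev2_eq_0:
  assumes "\<And>x y. ev2 P x y = 0"
  shows "P = 0"
proof (rule ccontr)
  assume P: "P \<noteq> 0"
  have "poly P [:y:] = 0" for y
    using assms poly_all_0_iff_0[of "poly P [:y:]"] by (simp add: ev2_def)
  then have "range (\<lambda>y. [:y:]) \<subseteq> {q. poly P q = 0}" by auto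
  moreover have "infinite (range (\<lambda>y::complex. [:y:]))"
    using finite_imageD[of "\<lambda>y::complex. [:y:]" UNIV] infinite_UNIV_char_0
    by (auto simp: inj_on_def)
  ultimately show False using poly_roots_finite[OF P] finite_subset by blast
qed

lemma ev2_eqI:
  assumes "\<And>x y. ev2 P x y = ev2 Q x y"
  shows "P = Q"
  using ev2_eq_0[of "P - Q"] assms by (simp add: ev2_def)

lemma dehomogenise:
  assumes "form n F"
  shows "\<exists>P. \<forall>x y. F (vector [x, y, 1]) = ev2 P x y"
  using assms
proof induction
  case (form_const c)
  show ?case by (rule exI[of _ "[:[:c:]:]"]) simp
next
  case (form_coord i)
  consider "i = 1" | "i = 2" | "i = 3" using exhaust_3[of i] by blast
  then show ?case
  proof cases
    case 1
    then show ?thesis by (intro exI[of _ "[:[:0, 1:]:]"]) simp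
  next
    case 2
    then show ?thesis by (intro exI[of _ "[:0, 1:]"]) simp
  next
    case 3
    then show ?thesis by (intro exI[of _ 1]) simp
  qed
next
  case (form_add n F G)
  then show ?case by (metis ev2_simps(1))
next
  case (form_mult m F n G)
  then show ?case by (metis ev2_simps(2))
qed

lemma form_affine_chart:
  assumes "form n F" "v $ 3 \<noteq> 0"
  shows "F v = v $ 3 ^ n * F (vector [v $ 1 / v $ 3, v $ 2 / v $ 3, 1])"
proof -
  have "v = v $ 3 *s vector [v $ 1 / v $ 3, v $ 2 / v $ 3, 1]"
    using assms(2) by (simp add: vec_eq_iff forall_3)
  then show ?thesis using form_scale[OF assms(1)] by metis
qed

lemma form_eq_0_on_chart:
  assumes "form n F" "\<And>v. v $ 3 \<noteq> 0 \<Longrightarrow> F v = 0"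
  shows "F v = 0"
proof (rule ccontr)
  assume "F v \<noteq> 0"
  then obtain w where "F w * w $ 3 \<noteq> 0"
    using form_nonzero_mult[OF assms(1) form_coord[of 3], of v "vector [0, 0, 1]"] by auto
  then show False using assms(2)[of w] by auto
qed

lemma homogenise_univariate:
  "\<exists>N \<Phi>. form N \<Phi> \<and> (\<forall>v. v $ 3 \<noteq> 0 \<longrightarrow> \<Phi> v = v $ 3 ^ N * poly p (v $ 1 / v $ 3))"
proof (induction p)
  case 0
  show ?case using form_const[of 0] by (intro exI[of _ 0] exI[of _ "\<lambda>v. 0"]) simp
next
  case (pCons a p)
  then obtain N \<Phi> where \<Phi>: "form N \<Phi>"
    "\<And>v. v $ 3 \<noteq> 0 \<Longrightarrow> \<Phi> v = v $ 3 ^ N * poly p (v $ 1 / v $ 3)" by blast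
  have "form (N + 1) (\<lambda>v. v $ 3 ^ (N + 1) * a + \<Phi> v * v $ 1)"
    using form_power[OF form_coord[of 3], of "N + 1"] form_mult[OF \<Phi>(1) form_coord[of 1]]
      form_smult[of "N + 1" "\<lambda>v. v $ 3 ^ (N + 1)" a]
    by (intro form_add) (simp_all add: mult.commute)
  moreover have "v $ 3 ^ (N + 1) * a + \<Phi> v * v $ 1 =
      v $ 3 ^ (N + 1) * poly (pCons a p) (v $ 1 / v $ 3)" if "v $ 3 \<noteq> 0" for v
    unfolding \<Phi>(2)[OF that] using that by (simp add: algebra_simps)
  ultimately show ?case by blast
qed

lemma homogenise:
  "\<exists>N \<Phi>. form N \<Phi> \<and> (\<forall>v. v $ 3 \<noteq> 0 \<longrightarrow> \<Phi> v = v $ 3 ^ N * ev2 P (v $ 1 / v $ 3) (v $ 2 / v $ 3))"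
proof (induction P)
  case 0
  show ?case using form_const[of 0] by (intro exI[of _ 0] exI[of _ "\<lambda>v. 0"]) simp
next
  case (pCons a P)
  then obtain N \<Phi> where \<Phi>: "form N \<Phi>"
    "\<And>v. v $ 3 \<noteq> 0 \<Longrightarrow> \<Phi> v = v $ 3 ^ N * ev2 P (v $ 1 / v $ 3) (v $ 2 / v $ 3)" by blast
  obtain N' \<Psi> where \<Psi>: "form N' \<Psi>"
    "\<And>v. v $ 3 \<noteq> 0 \<Longrightarrow> \<Psi> v = v $ 3 ^ N' * poly a (v $ 1 / v $ 3)"
    using homogenise_univariate by blast
  have z: "form k (\<lambda>v. v $ 3 ^ k)" for k using form_power[OF form_coord[of 3], of k] by simp
  have "form (N + N' + 1) (\<lambda>v. v $ 3 ^ (N + 1) * \<Psi> v + v $ 3 ^ N' * (\<Phi> v * v $ 2))"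
  proof (rule form_add)
    show "form (N + N' + 1) (\<lambda>v. v $ 3 ^ (N + 1) * \<Psi> v)"
      using form_mult[OF z[of "N + 1"] \<Psi>(1)] by (simp add: algebra_simps)
    show "form (N + N' + 1) (\<lambda>v. v $ 3 ^ N' * (\<Phi> v * v $ 2))"
      using form_mult[OF z[of N'] form_mult[OF \<Phi>(1) form_coord[of 2]]]
      by (simp add: algebra_simps)
  qed
  moreover have "v $ 3 ^ (N + 1) * \<Psi> v + v $ 3 ^ N' * (\<Phi> v * v $ 2) =
      v $ 3 ^ (N + N' + 1) * ev2 (pCons a P) (v $ 1 / v $ 3) (v $ 2 / v $ 3)"
    if "v $ 3 \<noteq> 0" for v
    unfolding \<Phi>(2)[OF that] \<Psi>(2)[OF that] using that by (simp add: algebra_simps power_add)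
  ultimately show ?case by blast
qed

text \<open>A plane affine curve over the complex numbers is infinite.\<close>

lemma finite_zeros_imp_unit:
  assumes fin: "finite {(x, y). ev2 g x y = 0}" and g: "g \<noteq> 0"
  shows "is_unit g"
proof (cases "degree g = 0")
  case True
  then obtain a where a: "g = [:a:]" by (rule degree_eq_zeroE)
  have "degree a = 0"
  proof (rule ccontr)
    assume "degree a \<noteq> 0"
    then obtain x where x: "poly a x = 0"
      using fundamental_theorem_of_algebra[of a] constant_degree[of a] by auto
    have "(\<lambda>y. (x, y)) ` UNIV \<subseteq> {(x, y). ev2 g x y = 0}" using x a by auto
    then have "finite ((\<lambda>y::complex. (x, y)) ` UNIV)" using fin finite_subset by blast
    then show False using finite_imageD[of "\<lambda>y::complex. (x, y)" UNIV] infinite_UNIV_char_0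
      by (auto simp: inj_on_def)
  qed
  then obtain c where "a = [:c:]" by (rule degree_eq_zeroE)
  then show ?thesis using a g by (auto simp: is_unit_poly_iff is_unit_const_poly_iff dvd_field_iff)
next
  case False
  let ?B = "{x. poly (lead_coeff g) x = 0}"
  have "finite ?B" using g by (intro poly_roots_finite) simp
  moreover have "- ?B \<subseteq> fst ` {(x, y). ev2 g x y = 0}"
  proof
    fix x assume x: "x \<in> - ?B"
    define p where "p = map_poly (\<lambda>a. poly a x) g"
    have p: "poly p y = ev2 g x y" for y
      unfolding p_def by (induction g) (auto simp: map_poly_pCons)
    have "coeff p (degree g) \<noteq> 0" using x by (simp add: p_def coeff_map_poly)
    then have "degree p \<noteq> 0" using False le_degree by fastforce
    then obtain y where "poly p y = 0"
      using fundamental_theorem_of_algebra[of p] constant_degree[of p] by auto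
    then show "x \<in> fst ` {(x, y). ev2 g x y = 0}" using p by force
  qed
  ultimately have "finite (UNIV :: complex set)"
    using fin finite_subset[of "- ?B"] by (metis Compl_partition finite_Un finite_imageI)
  then show ?thesis using infinite_UNIV_char_0 by blast
qed

lemma affine_point_inj:
  assumes "abs_proj_plane (vector [x, y, 1]) = abs_proj_plane (vector [x', y', 1])"
  shows "x = x' \<and> y = y'"
proof -
  have nz: "vector [x, y, 1] \<noteq> (0 :: vec3)" for x y by (simp add: vec_eq_iff forall_3)
  obtain c where c: "c \<noteq> 0" "rp (abs_proj_plane (vector [x, y, 1])) = c *s vector [x, y, 1]"
    using rp_abs[OF nz] .
  obtain d where d: "rp (abs_proj_plane (vector [x', y', 1])) = d *s vector [x', y', 1]"
    using rp_abs[OF nz] .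
  have "c *s vector [x, y, 1] = d *s (vector [x', y', 1] :: vec3)" using c(2) d assms by simp
  then show ?thesis using c(1) by (auto simp: vec_eq_iff forall_3)
qed

text \<open>The plane has no curve inside a finite set, so a quotient of forms which is regular off a
  finite set has, after cancelling common factors, a constant denominator. Cancelling takes place
  in the factorial ring of polynomials on the chart where the last coordinate is nonzero; the
  power of that coordinate that homogenising back costs is removed by the same regularity.\<close>

lemma quotient_regular_off_points:
  assumes M: "form (n + g) M" and G: "form g G" "G u \<noteq> 0" and T: "finite T"
    and loc: "\<And>v. v \<noteq> 0 \<Longrightarrow> abs_proj_plane v \<notin> T \<Longrightarrow>
      \<exists>k Q P. form k Q \<and> form (n + k) P \<and> Q v \<noteq> 0 \<and> (\<forall>w. M w * Q w = G w * P w)"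
  shows "\<exists>F. form n F \<and> (\<forall>v. M v = G v * F v)"
proof -
  obtain m where m: "\<And>x y. M (vector [x, y, 1]) = ev2 m x y" using dehomogenise[OF M] by blast
  obtain \<gamma> where \<gamma>: "\<And>x y. G (vector [x, y, 1]) = ev2 \<gamma> x y" using dehomogenise[OF G(1)] by blast
  have "\<gamma> \<noteq> 0"
    using G(2) form_eq_0_on_chart[OF G(1)] form_affine_chart[OF G(1)] \<gamma> by force
  then have "gcd m \<gamma> \<noteq> 0" by simp
  then obtain m1 \<gamma>1 D where 1: "m = m1 * D" "\<gamma> = \<gamma>1 * D" "coprime m1 \<gamma>1" and d: "D \<noteq> 0"
    using gcd_coprime_exists by blast
  \<comment> \<open>Where the quotient is regular, the reduced denominator divides a nonvanishing polynomial.\<close>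
  have "(x, y) \<in> {(x, y). abs_proj_plane (vector [x, y, 1]) \<in> T}" if z: "ev2 \<gamma>1 x y = 0" for x y
  proof (rule ccontr)
    let ?v = "vector [x, y, 1] :: vec3"
    assume "(x, y) \<notin> {(x, y). abs_proj_plane (vector [x, y, 1]) \<in> T}"
    then obtain k Q P where Q: "form k Q" "form (n + k) P" "Q ?v \<noteq> 0"
      "\<And>w. M w * Q w = G w * P w"
      using loc[of ?v] by (auto simp: vec_eq_iff forall_3)
    obtain q where q: "\<And>x y. Q (vector [x, y, 1]) = ev2 q x y" using dehomogenise[OF Q(1)] by blast
    obtain p where p: "\<And>x y. P (vector [x, y, 1]) = ev2 p x y" using dehomogenise[OF Q(2)] by blast
    have "m * q = \<gamma> * p"
      by (rule ev2_eqI) (use Q(4) in \<open>simp flip: m \<gamma> q p\<close>)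
    then have "D * (m1 * q) = D * (\<gamma>1 * p)" unfolding 1(1,2) by (simp only: mult_ac)
    then have "m1 * q = \<gamma>1 * p" using d by simp
    then have "\<gamma>1 dvd m1 * q" by simp
    then have "\<gamma>1 dvd q" using 1(3) by (simp add: coprime_commute coprime_dvd_mult_right_iff)
    then have "Q ?v = 0" using z q by auto
    then show False using Q(3) by simp
  qed
  then have "{(x, y). ev2 \<gamma>1 x y = 0} \<subseteq> {(x, y). abs_proj_plane (vector [x, y, 1]) \<in> T}" by auto
  moreover have "finite {(x, y). abs_proj_plane (vector [x, y, 1]) \<in> T}"
    by (rule inj_on_finite[OF _ _ T, of "\<lambda>(x, y). abs_proj_plane (vector [x, y, 1])"])
      (auto simp: inj_on_def dest: affine_point_inj)
  moreover have "\<gamma>1 \<noteq> 0" using \<open>\<gamma> \<noteq> 0\<close> 1(2) by auto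
  ultimately have "is_unit \<gamma>1" using finite_zeros_imp_unit finite_subset by blast
  then have "\<gamma> dvd m"
    unfolding 1(1,2) by (simp add: unit_imp_dvd)
  then obtain r where r: "m = \<gamma> * r" by auto
  obtain N \<Phi> where \<Phi>: "form N \<Phi>"
    "\<And>v. v $ 3 \<noteq> 0 \<Longrightarrow> \<Phi> v = v $ 3 ^ N * ev2 r (v $ 1 / v $ 3) (v $ 2 / v $ 3)"
    using homogenise by blast
  have z: "form k (\<lambda>v. v $ 3 ^ k)" for k using form_power[OF form_coord[of 3], of k] by simp
  have "\<exists>\<Phi>. form (n + N) \<Phi> \<and> (\<forall>v. v $ 3 ^ N * M v = G v * \<Phi> v)"
  proof (intro exI[of _ "\<lambda>v. v $ 3 ^ n * \<Phi> v"] conjI allI)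
    show \<Phi>': "form (n + N) (\<lambda>v. v $ 3 ^ n * \<Phi> v)" by (rule form_mult[OF z \<Phi>(1)])
    have f1: "form (n + N + g) (\<lambda>v. v $ 3 ^ N * M v)"
      by (rule form_cong[OF form_mult[OF z M]]) auto
    have f2: "form (n + N + g) (\<lambda>v. G v * (v $ 3 ^ n * \<Phi> v))"
      by (rule form_cong[OF form_mult[OF G(1) \<Phi>']]) auto
    fix v
    have "v $ 3 ^ N * M v - G v * (v $ 3 ^ n * \<Phi> v) = 0"
    proof (rule form_eq_0_on_chart[OF form_diff[OF f1 f2]])
      fix v :: vec3 assume v: "v $ 3 \<noteq> 0"
      have "v $ 3 ^ N * M v = v $ 3 ^ N * (v $ 3 ^ (n + g) *
          (ev2 \<gamma> (v $ 1 / v $ 3) (v $ 2 / v $ 3) * ev2 r (v $ 1 / v $ 3) (v $ 2 / v $ 3)))"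
        unfolding form_affine_chart[OF M v] m r by simp
      also have "\<dots> = G v * (v $ 3 ^ n * \<Phi> v)"
        unfolding form_affine_chart[OF G(1) v] \<gamma> \<Phi>(2)[OF v] by (simp add: power_add algebra_simps)
      finally show "v $ 3 ^ N * M v - G v * (v $ 3 ^ n * \<Phi> v) = 0" by simp
    qed
    then show "v $ 3 ^ N * M v = G v * (v $ 3 ^ n * \<Phi> v)" by simp
  qed
  then show ?thesis
  proof (induction N)
    case 0
    then show ?case by auto
  next
    case (Suc N)
    then obtain \<Phi> where \<Phi>: "form (n + Suc N) \<Phi>" "\<And>v. v $ 3 ^ Suc N * M v = G v * \<Phi> v" by blast
    define f :: "vec3 \<Rightarrow> vec3" where "f v = vector [v $ 1, v $ 2, 0]" for v
    have lin: "form 1 (\<lambda>v. f v $ i)" for i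
      using exhaust_3[of i] form_coord form_zero[of 1] by (auto simp: f_def)
    \<comment> \<open>\<open>M / G\<close> is regular at almost all points of the line \<open>v $ 3 = 0\<close>, so \<open>\<Phi>\<close> vanishes on it.\<close>
    have "\<Phi> v = 0" if v: "v $ 3 = 0" for v
    proof (rule ccontr)
      assume "\<Phi> v \<noteq> 0"
      moreover have "f v = v" using v by (simp add: f_def vec_eq_iff forall_3)
      ultimately have nz: "\<Phi> (f v) \<noteq> 0" by simp
      have sep: "\<exists>a v. dot a (rp p) = 0 \<and> dot a (f v) \<noteq> 0" for p
      proof (cases "rp p $ 1 = 0 \<and> rp p $ 2 = 0")
        case True
        then show ?thesis
          by (intro exI[of _ "vector [1, 0, 0]"]) (simp add: dot_3 f_def)
      next
        case False
        then show ?thesis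
          by (intro exI[of _ "vector [- (rp p $ 2), rp p $ 1, 0]"]
              exI[of _ "vector [if rp p $ 2 = 0 then 0 else 1, if rp p $ 2 = 0 then 1 else 0, 0]"])
            (auto simp: dot_3 f_def)
      qed
      have "f (vector [1, 0, 0]) \<noteq> 0" by (simp add: f_def vec_eq_iff forall_3)
      from form_nonzero_off_points[OF form_compose[OF \<Phi>(1) lin] nz T lin this sep]
      obtain w where w: "\<Phi> (f w) \<noteq> 0" "f w \<noteq> 0" "abs_proj_plane (f w) \<notin> T" by blast
      obtain k Q P where Q: "form k Q" "form (n + k) P" "Q (f w) \<noteq> 0"
        "\<And>w. M w * Q w = G w * P w" using loc[OF w(2,3)] by blast
      have f1: "form (n + Suc N + k) (\<lambda>v. v $ 3 ^ Suc N * P v)"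
        by (rule form_cong[OF form_mult[OF z Q(2)]]) auto
      have "f w $ 3 ^ Suc N * P (f w) = \<Phi> (f w) * Q (f w)"
      proof (rule form_cancel[OF f1 form_mult[OF \<Phi>(1) Q(1)] G])
        fix v
        have "v $ 3 ^ Suc N * P v * G v = v $ 3 ^ Suc N * (M v * Q v)"
          unfolding Q(4) by (simp add: algebra_simps)
        also have "\<dots> = \<Phi> v * Q v * G v" using \<Phi>(2)[of v] by (simp add: algebra_simps)
        finally show "v $ 3 ^ Suc N * P v * G v = \<Phi> v * Q v * G v" .
      qed
      then show False using w(1) Q(3) by (simp add: f_def)
    qed
    then have "\<exists>\<Psi>. form (n + Suc N - 1) \<Psi> \<and> (n + Suc N = 0 \<longrightarrow> \<Psi> = (\<lambda>v. 0)) \<and>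
        (\<forall>v. \<Phi> v = dot (vector [0, 0, 1]) v * \<Psi> v)"
      by (intro form_div_line[OF \<Phi>(1)]) (simp_all add: dot_3 vec_eq_iff forall_3)
    then obtain \<Psi> where \<Psi>: "form (n + N) \<Psi>" "\<And>v. \<Phi> v = v $ 3 * \<Psi> v" by (auto simp: dot_3)
    have "v $ 3 ^ N * M v = G v * \<Psi> v" for v
    proof (rule form_cancel[OF _ _ form_coord[of 3]])
      show "form (n + N + g) (\<lambda>v. v $ 3 ^ N * M v)"
        by (rule form_cong[OF form_mult[OF z M]]) auto
      show "form (n + N + g) (\<lambda>v. G v * \<Psi> v)"
        by (rule form_cong[OF form_mult[OF G(1) \<Psi>(1)]]) auto
      show "(vector [0, 0, 1] :: vec3) $ 3 \<noteq> 0" by simp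
      show "v $ 3 ^ N * M v * v $ 3 = G v * \<Psi> v * v $ 3" for v
        using \<Phi>(2)[of v] \<Psi>(2)[of v] by (simp add: algebra_simps)
    qed
    then show ?case using Suc.IH \<Psi>(1) by blast
  qed
qed

section \<open>Divisors of a given degree and given multiplicities\<close>

text \<open>The divisor \<open>n E\<^sub>0 - \<Sum> \<mu>(p) E\<^sub>p\<close>, with \<open>E\<^sub>0\<close> represented by the line \<open>a\<close>.\<close>

definition std_divisor :: "proj_plane set \<Rightarrow> vec3 \<Rightarrow> int \<Rightarrow> (proj_plane \<Rightarrow> int) \<Rightarrow> divisor" where
  "std_divisor S a n \<mu> x = line_eq a x powi n * (\<Prod>p\<in>S. centre_eq p x powi (- \<mu> p))"

lemma std_divisor_nonzero:
  "finite S \<Longrightarrow> a \<noteq> 0 \<Longrightarrow> x \<in> blowup S \<Longrightarrow> std_divisor S a n \<mu> x \<noteq> 0"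
  by (simp add: std_divisor_def line_eq_nonzero centre_eq_nonzero)

lemma std_divisor_add:
  assumes "finite S" "a \<noteq> 0" "x \<in> blowup S"
  shows "std_divisor S a (n + n') (\<lambda>p. \<mu> p + \<mu>' p) x = std_divisor S a n \<mu> x * std_divisor S a n' \<mu>' x"
proof -
  have "centre_eq p x powi (- (\<mu> p + \<mu>' p)) = centre_eq p x powi (- \<mu> p) * centre_eq p x powi (- \<mu>' p)"
    if "p \<in> S" for p
    using power_int_add[of "centre_eq p x" "- \<mu> p" "- \<mu>' p"] centre_eq_nonzero[OF assms(3) that]
    by simp
  then show ?thesis
    using power_int_add[of "line_eq a x" n n'] line_eq_nonzero[OF assms(2), of x]
    by (simp add: std_divisor_def prod.distrib mult_ac)
qed

lemma multiform_prod:
  assumes "finite I" "\<And>i. i \<in> I \<Longrightarrow> multiform S (n i) (e i) (P i)"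
  shows "multiform S (\<Sum>i\<in>I. n i) (\<lambda>p. \<Sum>i\<in>I. e i p) (\<lambda>v w. \<Prod>i\<in>I. P i v w)"
  using assms
proof (induction I)
  case empty
  show ?case using multiform_const[of S 1] by simp
next
  case (insert i I)
  have "multiform S (n i + (\<Sum>i\<in>I. n i)) (\<lambda>p. e i p + (\<Sum>i\<in>I. e i p))
      (\<lambda>v w. P i v w * (\<Prod>i\<in>I. P i v w))"
    using insert by (intro multiform_mult) auto
  then show ?case using insert by simp
qed

text \<open>The local equations at \<open>x\<close> and \<open>y\<close> differ by quotients of linear forms in the coordinates
  of the plane and of the fibres, so the equation at \<open>x\<close> is good wherever the linear forms
  chosen at \<open>x\<close> do not vanish.\<close>

lemma std_is_divisor:
  assumes S: "finite S" and a: "a \<noteq> 0"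
  shows "is_divisor S (std_divisor S a n \<mu>)"
  unfolding is_divisor_def
proof (intro ballI conjI)
  fix x assume x: "x \<in> blowup S"
  show "std_divisor S a n \<mu> x \<noteq> 0" by (rule std_divisor_nonzero[OF S a x])
  let ?c = "\<lambda>p. (\<chi> i. cnj (rp (snd x p) $ i)) :: vec3"
  define Q where "Q v w = unit_form x v * (\<Prod>p\<in>S. dot (?c p) (w p))" for v and w :: "proj_plane \<Rightarrow> vec3"
  have "multiform S (1 + (\<Sum>p\<in>S. 0)) (\<lambda>p'. \<Sum>p\<in>S. ((\<lambda>_. 0)(p := 1)) p') Q"
    unfolding Q_def[abs_def]
    by (intro multiform_times_form multiform_prod form_unit_form multiform_fibre_dot S)
  moreover have "eval_at Q x \<noteq> 0"
    using S unit_form_nonzero[of x] dot_cnj_nonzero[OF rp_nonzero]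
    by (simp add: eval_at_def Q_def)
  moreover have "std_divisor S a n \<mu> y / std_divisor S a n \<mu> x \<in> local_units S y"
    if y: "y \<in> blowup S" and Qy: "eval_at Q y \<noteq> 0" for y
  proof -
    have ux: "unit_form x (rp (fst y)) \<noteq> 0" using Qy by (simp add: eval_at_def Q_def)
    have cx: "dot (?c p) (rp (snd y p)) \<noteq> 0" if "p \<in> S" for p
      using Qy S that by (auto simp: eval_at_def Q_def)
    let ?u = "quot (unit_form x) (unit_form y)"
    let ?s = "\<lambda>p. quot (centre_form p y) (centre_form p x)"
    have u: "?u \<in> local_units S y"
      by (rule quot_unit[OF S y form_unit_form form_unit_form ux unit_form_nonzero])
    have s: "?s p \<in> local_units S y" if "p \<in> S" for p
      unfolding centre_form_def
      by (rule fibre_quot_unit[OF S y that]) (use cx[OF that] dot_cnj_nonzero in auto)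
    have line: "line_eq a y = ?u * line_eq a x"
      unfolding line_eq_def
      using quot_chain[OF form_dot form_unit_form form_unit_form unit_form_nonzero unit_form_nonzero]
      by (simp add: mult.commute)
    have centre: "centre_eq p y = (?s p * ?u) * centre_eq p x" if p: "p \<in> S" for p
    proof -
      obtain w where w: "centre_form p x w \<noteq> 0" using centre_form_nonzero[OF x p] .
      have "centre_eq p y = ?s p * quot (centre_form p x) (unit_form y)"
        unfolding centre_eq_def
        by (rule quot_chain[OF form_centre_form form_centre_form form_unit_form w unit_form_nonzero])
      also have "quot (centre_form p x) (unit_form y) = centre_eq p x * ?u"
        unfolding centre_eq_def
        by (rule quot_chain[OF form_centre_form form_unit_form form_unit_form
              unit_form_nonzero unit_form_nonzero])
      finally show ?thesis by (simp add: mult_ac)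
    qed
    have "std_divisor S a n \<mu> y =
        (?u powi n * (\<Prod>p\<in>S. (?s p * ?u) powi (- \<mu> p))) * std_divisor S a n \<mu> x"
      unfolding std_divisor_def line power_int_mult_distrib
      by (simp add: centre power_int_mult_distrib prod.distrib mult_ac cong: prod.cong)
    then have "std_divisor S a n \<mu> y / std_divisor S a n \<mu> x =
        ?u powi n * (\<Prod>p\<in>S. (?s p * ?u) powi (- \<mu> p))"
      using std_divisor_nonzero[OF S a x, of n \<mu>] by simp
    also have "\<dots> \<in> local_units S y"
      using S y u s by (intro local_units_mult local_units_powi local_units_prod) auto
    finally show ?thesis .
  qed
  ultimately show "\<exists>n' e Q. multiform S n' e Q \<and> eval_at Q x \<noteq> 0 \<and> (\<forall>y\<in>blowup S.
      eval_at Q y \<noteq> 0 \<longrightarrow> std_divisor S a n \<mu> y / std_divisor S a n \<mu> x \<in> local_units S y)"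
    by blast
qed

text \<open>Both divisors have the same coefficients; they differ in the choice of local equations, which
  costs units, and of the line, which costs the quotient of the two linear forms.\<close>

lemma std_represents_D:
  assumes S: "finite (L2 \<A>)" and a: "a \<noteq> 0"
    and D: "\<And>x. x \<in> blowup (L2 \<A>) \<Longrightarrow> D x = std_divisor (L2 \<A>) a (int (card \<A>) - 1) (mu \<A>) x"
  shows "represents_D \<A> D"
  unfolding represents_D_def lin_equiv_def
proof (intro allI exI conjI ballI)
  fix H
  let ?S = "L2 \<A>" and ?n = "int (card \<A>) - 1"
  let ?q = "quot (dot a) (dot (rp H))"
  obtain u where u: "dot a u \<noteq> 0" using dot_cnj_nonzero[OF a] dot_commute by metis
  obtain w where w: "dot (rp H) w \<noteq> 0" using dot_cnj_nonzero[OF rp_nonzero] dot_commute by metis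
  have q0: "?q \<noteq> 0" using quot_eq_0_iff[OF form_dot form_dot w] u by blast
  then show "?q powi ?n \<noteq> 0" by simp
  fix x assume x: "x \<in> blowup ?S"
  let ?l = "line_divisor ?S H x" and ?e = "\<lambda>p. exceptional ?S p x"
  have l: "?l / line_eq (rp H) x \<in> local_units ?S x"
    unfolding line_divisor_def by (rule pullback_unit[OF line_eq_local_equation[OF S x]])
  have e: "?e p / centre_eq p x \<in> local_units ?S x" if "p \<in> ?S" for p
    unfolding exceptional_def by (rule pullback_unit[OF centre_eq_local_equation[OF S x that]])
  have l0: "?l \<noteq> 0" and e0: "\<And>p. p \<in> ?S \<Longrightarrow> ?e p \<noteq> 0"
    using l e by (auto simp: local_units_def)
  have "line_eq a x = ?q * line_eq (rp H) x"
    unfolding line_eq_def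
    by (rule quot_chain[OF form_dot form_dot form_unit_form w unit_form_nonzero])
  then have "line_eq a x / (?q * ?l) = inverse (?l / line_eq (rp H) x)"
    using q0 by (simp add: field_simps)
  then have 1: "line_eq a x / (?q * ?l) \<in> local_units ?S x" using local_units_inverse[OF l] by simp
  have "D x / (?q powi ?n * D_arr \<A> H x) =
      (line_eq a x / (?q * ?l)) powi ?n * (\<Prod>p\<in>?S. (?e p / centre_eq p x) powi mu \<A> p)"
    unfolding D[OF x] std_divisor_def D_arr_def div_minus_def div_mult_def div_sum_def
    by (simp add: power_int_divide_distrib power_int_mult_distrib power_int_minus prod_dividef
        prod_inversef[symmetric] field_simps)
  also have "\<dots> \<in> local_units ?S x"
    using S x 1 e by (intro local_units_mult local_units_powi local_units_prod) auto
  finally show "D x / (?q powi ?n * D_arr \<A> H x) \<in> local_units ?S x" .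
qed


section \<open>Global sections are forms\<close>

lemma form_unit_form_power: "form n (\<lambda>v. unit_form x v ^ n)"
  using form_power[OF form_unit_form[of x], of n] by simp

lemma form_centre_form_power: "form n (\<lambda>v. centre_form p x v ^ n)"
  using form_power[OF form_centre_form[of p x], of n] by simp

lemma quot_times_line_eq_power:
  assumes "form n F" "a \<noteq> 0"
  shows "quot F (\<lambda>v. dot a v ^ n) * line_eq a x ^ n = quot F (\<lambda>v. unit_form x v ^ n)"
proof -
  obtain u where "dot a u \<noteq> 0" using dot_cnj_nonzero[OF assms(2)] dot_commute by metis
  then have u: "dot a u ^ n \<noteq> 0" by simp
  have w: "unit_form x (rp (fst x)) ^ n \<noteq> 0" using unit_form_nonzero by simp
  have "line_eq a x ^ n = quot (\<lambda>v. dot a v ^ n) (\<lambda>v. unit_form x v ^ n)"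
    unfolding line_eq_def by (rule quot_power[OF form_dot form_unit_form unit_form_nonzero])
  then show ?thesis
    using quot_chain[OF assms(1) form_dot_power form_unit_form_power u w] by simp
qed

lemma quot_times_centre_eq:
  assumes "form n F" "x \<in> blowup S" "p \<in> S"
  shows "quot F (\<lambda>v. unit_form x v ^ n) * centre_eq p x powi (- int k) =
    quot (\<lambda>v. F v * unit_form x v ^ k) (\<lambda>v. unit_form x v ^ n * centre_form p x v ^ k)"
proof -
  obtain w where w: "centre_form p x w \<noteq> 0" using centre_form_nonzero[OF assms(2,3)] .
  have u: "unit_form x (rp (fst x)) ^ n \<noteq> 0" for n using unit_form_nonzero by simp
  have "centre_eq p x powi (- int k) = quot (unit_form x) (centre_form p x) ^ k"
    unfolding centre_eq_def
    using quot_inverse[OF form_centre_form form_unit_form unit_form_nonzero w]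
    by (simp add: power_int_minus flip: power_inverse)
  also have "\<dots> = quot (\<lambda>v. unit_form x v ^ k) (\<lambda>v. centre_form p x v ^ k)"
    by (rule quot_power[OF form_unit_form form_centre_form w])
  moreover have "centre_form p x w ^ k \<noteq> 0" using w by simp
  ultimately show ?thesis
    using quot_mult[OF assms(1) form_unit_form_power u form_unit_form_power
        form_centre_form_power] by simp
qed

text \<open>Vanishing to order \<open>k\<close> at \<open>p\<close>, that is, membership in the \<open>k\<close>-th power of the ideal
  generated by the coordinates of \<open>p \<times> v\<close>: the factors from this ideal are recorded by the
  degree \<open>k\<close> in the fibre coordinates over \<open>p\<close>, which makes them visible on the blow-up.\<close>

definition vanishes :: "proj_plane set \<Rightarrow> nat \<Rightarrow> proj_plane \<Rightarrow> nat \<Rightarrow> (vec3 \<Rightarrow> complex) \<Rightarrow> bool" where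
  "vanishes S n p k F \<longleftrightarrow> k \<le> n \<and> (\<exists>P. multiform S (n - k) ((\<lambda>_. 0)(p := k)) P \<and> on_plane P = F)"

text \<open>Over \<open>p\<close>, the \<open>k p\<close> factors of \<open>F\<close> from the fibre coordinates cancel the pole along the
  exceptional curve; the equations of the other exceptional curves are units there.\<close>

lemma vanishing_form_is_section:
  assumes S: "finite S" and a: "a \<noteq> 0" and F: "form n F"
    and van: "\<And>p. p \<in> S \<Longrightarrow> vanishes S n p (k p) F"
  shows "quot F (\<lambda>v. dot a v ^ n) \<in> global_sections S (std_divisor S a (int n) (\<lambda>p. int (k p)))"
  unfolding global_sections_def
proof (intro CollectI ballI)
  fix x assume x: "x \<in> blowup S"
  let ?f = "quot F (\<lambda>v. unit_form x v ^ n)"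
  have eq: "quot F (\<lambda>v. dot a v ^ n) * std_divisor S a (int n) (\<lambda>p. int (k p)) x =
      ?f * (\<Prod>p\<in>S. centre_eq p x powi (- int (k p)))"
    unfolding std_divisor_def
    using quot_times_line_eq_power[OF F a, of x] by (simp add: mult.assoc[symmetric])
  have u: "unit_form x (rp (fst x)) ^ n \<noteq> 0" using unit_form_nonzero by simp
  have units: "(\<Prod>p\<in>T. centre_eq p x powi (- int (k p))) \<in> local_units S x"
    if "T \<subseteq> S" "fst x \<notin> T" for T
    by (intro local_units_prod local_units_powi centre_eq_unit S x) (use that in auto)
  show "quot F (\<lambda>v. dot a v ^ n) * std_divisor S a (int n) (\<lambda>p. int (k p)) x \<in> local_ring S x"
  proof (cases "fst x \<in> S")
    case False
    have "?f \<in> local_ring S x" by (rule quot_regular[OF S x F form_unit_form_power u])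
    then show ?thesis
      unfolding eq using units[of S] False S x by (auto simp: local_units_def intro: local_ring_mult)
  next
    case True
    let ?p = "fst x"
    let ?k = "k ?p" and ?s = "(\<chi> i. cnj (rp (snd x (fst x)) $ i)) :: vec3"
    obtain P where P: "multiform S (n - ?k) ((\<lambda>_. 0)(?p := ?k)) P" "on_plane P = F" and kn: "?k \<le> n"
      using van[OF True] by (auto simp: vanishes_def)
    obtain w where "centre_form ?p x w \<noteq> 0" using centre_form_nonzero[OF x True] .
    then have w: "centre_form ?p x w ^ ?k \<noteq> 0" by simp
    obtain z where z: "unit_form x z ^ n * centre_form ?p x z ^ ?k \<noteq> 0"
      using form_nonzero_mult[OF form_unit_form_power form_centre_form_power u w] by blast
    have "?f * centre_eq ?p x powi (- int ?k) =
        quot (\<lambda>v. F v * unit_form x v ^ ?k) (\<lambda>v. unit_form x v ^ n * centre_form ?p x v ^ ?k)"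
      by (rule quot_times_centre_eq[OF F x True])
    also have "\<dots> \<in> local_ring S x"
    proof (rule local_ringI[OF S x form_mult[OF F form_unit_form_power]
          form_mult[OF form_unit_form_power form_centre_form_power] z])
      show "multiform S n ((\<lambda>_. 0)(?p := ?k)) (\<lambda>v w. unit_form x v ^ ?k * P v w)"
        using multiform_times_form[OF form_unit_form_power P(1), of ?k x] kn by simp
      show "multiform S n ((\<lambda>_. 0)(?p := ?k)) (\<lambda>v w. unit_form x v ^ n * dot ?s (w ?p) ^ ?k)"
        using multiform_times_form[OF form_unit_form_power multiform_fibre_dot_power[OF True]]
        by simp
      show "eval_at (\<lambda>v w. unit_form x v ^ n * dot ?s (w ?p) ^ ?k) x \<noteq> 0"
        using unit_form_nonzero[of x] dot_cnj_nonzero[OF rp_nonzero] by (simp add: eval_at_def)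
      show "F v * unit_form x v ^ ?k * on_plane (\<lambda>v w. unit_form x v ^ n * dot ?s (w ?p) ^ ?k) v =
          unit_form x v ^ n * centre_form ?p x v ^ ?k * on_plane (\<lambda>v w. unit_form x v ^ ?k * P v w) v"
        for v using P(2) by (auto simp: on_plane_def centre_form_def)
    qed
    finally have "?f * centre_eq ?p x powi (- int ?k) \<in> local_ring S x" .
    moreover have "(\<Prod>p\<in>S - {?p}. centre_eq p x powi (- int (k p))) \<in> local_units S x"
      by (rule units) auto
    ultimately have "?f * centre_eq ?p x powi (- int ?k) *
        (\<Prod>p\<in>S - {?p}. centre_eq p x powi (- int (k p))) \<in> local_ring S x"
      using S x by (auto simp: local_units_def intro: local_ring_mult)
    then show ?thesis unfolding eq by (subst prod.remove[OF S True]) (simp only: mult.assoc)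
  qed
qed

text \<open>Off the centres the exceptional curves do not matter, and the section has at most a pole of
  order \<open>n\<close> along the line \<open>a\<close>. Finitely many points cannot carry any further pole.\<close>

lemma section_is_form:
  assumes S: "finite S" and a: "a \<noteq> 0"
    and f: "f \<in> global_sections S (std_divisor S a (int n) \<mu>)"
  obtains F where "form n F" "f = quot F (\<lambda>v. dot a v ^ n)"
proof -
  obtain g F0 G0 u where fr: "form g F0" "form g G0" "G0 u \<noteq> 0" "f = quot F0 G0"
    by (rule ratfun_cases)
  obtain b where b: "dot a b ^ n \<noteq> 0"
    using dot_cnj_nonzero[OF a] dot_commute by (metis power_not_zero)
  have M: "form (n + g) (\<lambda>v. F0 v * dot a v ^ n)"
    by (rule form_cong[OF form_mult[OF fr(1) form_dot_power]]) auto
  have "\<exists>k Q P. form k Q \<and> form (n + k) P \<and> Q v \<noteq> 0 \<and> (\<forall>w. F0 w * dot a w ^ n * Q w = G0 w * P w)"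
    if v: "v \<noteq> 0" "abs_proj_plane v \<notin> S" for v
  proof -
    let ?q = "abs_proj_plane v"
    obtain l where x: "(?q, l) \<in> blowup S" using blowup_nonempty_fibre .
    let ?x = "(?q, l)"
    have "(\<Prod>p\<in>S. centre_eq p ?x powi (- \<mu> p)) \<in> local_units S ?x"
      by (intro local_units_prod local_units_powi centre_eq_unit S x) (use v in auto)
    moreover have "f * line_eq a ?x ^ n * (\<Prod>p\<in>S. centre_eq p ?x powi (- \<mu> p)) \<in> local_ring S ?x"
      using f x by (auto simp: global_sections_def std_divisor_def mult.assoc)
    ultimately have reg: "f * line_eq a ?x ^ n \<in> local_ring S ?x"
      by (rule local_units_cancel[OF S x])
    have u0: "unit_form ?x (rp (fst ?x)) ^ n \<noteq> 0" using unit_form_nonzero[of ?x] by simp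
    obtain z where z: "G0 z * unit_form ?x z ^ n \<noteq> 0"
      using form_nonzero_mult[OF fr(2) form_unit_form_power fr(3) u0] by blast
    have "f * line_eq a ?x ^ n = quot F0 G0 * quot (\<lambda>v. dot a v ^ n) (\<lambda>v. unit_form ?x v ^ n)"
      unfolding fr(4) line_eq_def quot_power[OF form_dot form_unit_form unit_form_nonzero] ..
    also have "\<dots> = quot (\<lambda>v. F0 v * dot a v ^ n) (\<lambda>v. G0 v * unit_form ?x v ^ n)"
      by (rule quot_mult[OF fr(1-3) form_dot_power form_unit_form_power u0])
    finally have "quot (\<lambda>v. F0 v * dot a v ^ n) (\<lambda>v. G0 v * unit_form ?x v ^ n) \<in> local_ring S ?x"
      using reg by simp
    then obtain k e P Q where PQ: "multiform S k e P" "multiform S k e Q" "eval_at Q ?x \<noteq> 0"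
      "\<And>v. F0 v * dot a v ^ n * on_plane Q v = G0 v * unit_form ?x v ^ n * on_plane P v"
      using local_ring_iff[OF S x form_mult[OF fr(1) form_dot_power]
          form_mult[OF fr(2) form_unit_form_power] z] by blast
    obtain c where c: "rp ?q = c *s v" using rp_abs[OF v(1)] by metis
    have fQ: "form (k + sum e S) (on_plane Q)" by (rule form_on_plane[OF PQ(2) S])
    have "on_plane Q (rp ?q) \<noteq> 0"
      using eval_at_off_centres[OF S x v(2)] PQ(2,3) by (metis mult_zero_right)
    then have "on_plane Q v \<noteq> 0" using form_scale[OF fQ, of c v] c by auto
    moreover have "form (n + (k + sum e S)) (\<lambda>v. unit_form ?x v ^ n * on_plane P v)"
      by (rule form_mult[OF form_unit_form_power form_on_plane[OF PQ(1) S]])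
    ultimately show ?thesis
      using fQ PQ(4) by (intro exI[of _ "k + sum e S"] exI[of _ "on_plane Q"]
          exI[of _ "\<lambda>v. unit_form ?x v ^ n * on_plane P v"]) (simp add: mult.assoc)
  qed
  from quotient_regular_off_points[OF M fr(2,3) S this]
  obtain F where F: "form n F" "\<And>v. F0 v * dot a v ^ n = G0 v * F v" by blast
  have "f = quot F (\<lambda>v. dot a v ^ n)"
    unfolding fr(4) using quot_eq_iff[OF fr(1-3) F(1) form_dot_power b] F(2)
    by (simp add: mult.commute)
  then show thesis using that F(1) by blast
qed

text \<open>On the blow-up, the form of such a section is divisible by the equation of the exceptional
  curve over \<open>p\<close>; the identity of multihomogeneous polynomials that expresses this is evaluated at
  a point of that curve.\<close>

lemma section_vanishes:
  assumes S: "finite S" and a: "a \<noteq> 0" and F: "form n F" and p: "p \<in> S" "\<mu> p = 1"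
    and f: "quot F (\<lambda>v. dot a v ^ n) \<in> global_sections S (std_divisor S a (int n) \<mu>)"
  shows "F (rp p) = 0"
proof -
  obtain l where x: "(p, l) \<in> blowup S" using blowup_nonempty_fibre .
  let ?x = "(p, l)"
  let ?f = "quot F (\<lambda>v. unit_form ?x v ^ n)"
  have "quot F (\<lambda>v. dot a v ^ n) * std_divisor S a (int n) \<mu> ?x =
      ?f * (\<Prod>p\<in>S. centre_eq p ?x powi (- \<mu> p))"
    unfolding std_divisor_def
    using quot_times_line_eq_power[OF F a, of ?x] by (simp add: mult.assoc[symmetric])
  also have "\<dots> = ?f * centre_eq p ?x powi (- int 1) * (\<Prod>p\<in>S - {p}. centre_eq p ?x powi (- \<mu> p))"
    by (subst prod.remove[OF S p(1)]) (simp only: p(2) mult.assoc of_nat_1)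
  finally have "?f * centre_eq p ?x powi (- int 1) * (\<Prod>p\<in>S - {p}. centre_eq p ?x powi (- \<mu> p))
      \<in> local_ring S ?x"
    using f x by (auto simp: global_sections_def)
  moreover have "(\<Prod>p\<in>S - {p}. centre_eq p ?x powi (- \<mu> p)) \<in> local_units S ?x"
    by (intro local_units_prod local_units_powi centre_eq_unit S x) auto
  ultimately have "?f * centre_eq p ?x powi (- int 1) \<in> local_ring S ?x"
    by (rule local_units_cancel[OF S x, rotated])
  then have reg: "quot (\<lambda>v. F v * unit_form ?x v ^ 1) (\<lambda>v. unit_form ?x v ^ n * centre_form p ?x v ^ 1)
      \<in> local_ring S ?x"
    unfolding quot_times_centre_eq[OF F x p(1)] .
  have u: "unit_form ?x (rp (fst ?x)) ^ n \<noteq> 0" using unit_form_nonzero[of ?x] by simp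
  obtain w where w: "centre_form p ?x w ^ 1 \<noteq> 0" using centre_form_nonzero[OF x p(1)] by auto
  obtain z where z: "unit_form ?x z ^ n * centre_form p ?x z ^ 1 \<noteq> 0"
    using form_nonzero_mult[OF form_unit_form_power form_centre_form_power u w] by blast
  have fN: "form (n + 1) (\<lambda>v. F v * unit_form ?x v ^ 1)"
    and fD: "form (n + 1) (\<lambda>v. unit_form ?x v ^ n * centre_form p ?x v ^ 1)"
    by (intro form_mult F form_unit_form_power form_centre_form_power)+
  obtain k e P Q where PQ: "multiform S k e P" "multiform S k e Q" "eval_at Q ?x \<noteq> 0"
    "\<And>v. F v * unit_form ?x v ^ 1 * on_plane Q v =
      unit_form ?x v ^ n * centre_form p ?x v ^ 1 * on_plane P v"
    using reg local_ring_iff[OF S x fN fD z] by blast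
  let ?R = "\<lambda>v w. (F v * unit_form ?x v ^ 1) * Q v w -
    (unit_form ?x v ^ n * centre_form p ?x v ^ 1) * P v w"
  have R: "multiform S (n + 1 + k) e ?R"
    by (intro multiform_diff multiform_times_form fN fD PQ)
  have "eval_at ?R ?x = 0"
    by (rule eval_at_eq_0[OF R S _ x]) (use PQ(4) in \<open>simp add: on_plane_def\<close>)
  moreover have "centre_form p ?x (rp p) = 0" by (simp add: centre_form_def)
  ultimately have "F (rp p) * unit_form ?x (rp p) * eval_at Q ?x = 0"
    by (simp add: eval_at_def)
  then show ?thesis using PQ(3) unit_form_nonzero[of ?x] by simp
qed

section \<open>Counting conditions\<close>

lemma (in vector_space) independent_family:
  assumes "finite I" and indep: "\<And>c. (\<Sum>i\<in>I. scale (c i) (f i)) = 0 \<Longrightarrow> \<forall>i\<in>I. c i = 0"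
  shows "inj_on f I" "independent (f ` I)"
proof -
  show inj: "inj_on f I"
  proof (rule inj_onI, rule ccontr)
    fix i j assume ij: "i \<in> I" "j \<in> I" "f i = f j" "i \<noteq> j"
    have "(\<Sum>k\<in>I. scale (if k = i then 1 else if k = j then - 1 else 0) (f k)) =
        (\<Sum>k\<in>I. (if k = i then f k else 0) - (if k = j then f k else 0))"
      using ij(4) by (intro sum.cong) auto
    also have "\<dots> = 0" using assms(1) ij by (simp add: sum_subtractf)
    finally show False using indep ij(1) by fastforce
  qed
  show "independent (f ` I)"
  proof (rule independent_if_scalars_zero)
    fix u x assume "(\<Sum>x\<in>f ` I. scale (u x) x) = 0" "x \<in> f ` I"
    then show "u x = 0" using indep[of "\<lambda>i. u (f i)"] by (auto simp: sum.reindex[OF inj])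
  qed (use assms(1) in simp)
qed

text \<open>Each linear condition costs at most one dimension.\<close>

lemma (in vector_space) independent_in_kernel:
  assumes "B \<subseteq> U" "independent B" "finite B" "subspace U"
    and lin: "\<And>x y. x \<in> U \<Longrightarrow> y \<in> U \<Longrightarrow> \<phi> (x + y) = \<phi> x + \<phi> y"
      "\<And>c x. x \<in> U \<Longrightarrow> \<phi> (scale c x) = c * \<phi> x"
  shows "\<exists>B'\<subseteq>{x \<in> U. \<phi> x = 0}. independent B' \<and> finite B' \<and> card B \<le> card B' + 1"
proof (cases "\<forall>b\<in>B. \<phi> b = 0")
  case True
  then show ?thesis using assms(1-3) by (intro exI[of _ B]) auto
next
  case False
  then obtain b0 where b0: "b0 \<in> B" "\<phi> b0 \<noteq> 0" by blast
  \<comment> \<open>Move the other elements of \<open>B\<close> into the kernel along \<open>b0\<close>.\<close>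
  define f where "f b = b + scale (- (\<phi> b / \<phi> b0)) b0" for b
  have U: "scale c b0 \<in> U" for c using b0(1) assms(1,4) subspace_scale by blast
  have "\<forall>b\<in>B - {b0}. c b = 0" if c: "(\<Sum>b\<in>B - {b0}. scale (c b) (f b)) = 0" for c
  proof -
    define s where "s = (\<Sum>b\<in>B - {b0}. c b * (- (\<phi> b / \<phi> b0)))"
    have "(\<Sum>b\<in>B - {b0}. scale (c b) (f b)) = (\<Sum>b\<in>B - {b0}. scale (c b) b) + scale s b0"
      by (simp only: f_def scale_right_distrib scale_scale sum.distrib s_def scale_sum_left)
    also have "\<dots> = (\<Sum>b\<in>B. scale (if b = b0 then s else c b) b)"
      using sum.remove[OF assms(3) b0(1), of "\<lambda>b. scale (if b = b0 then s else c b) b"]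
      by (simp add: add.commute)
    finally have "(\<Sum>b\<in>B. scale (if b = b0 then s else c b) b) = 0" using c by simp
    then have z: "(if b = b0 then s else c b) = 0" if "b \<in> B" for b
      using independentD[OF assms(2,3) subset_refl, of "\<lambda>b. if b = b0 then s else c b" b] that
      by simp
    show ?thesis
    proof
      fix b assume "b \<in> B - {b0}"
      then show "c b = 0" using z[of b] by simp
    qed
  qed
  from independent_family[OF _ this] have 1: "inj_on f (B - {b0})" "independent (f ` (B - {b0}))"
    using assms(3) by auto
  have "f b \<in> U \<and> \<phi> (f b) = 0" if "b \<in> B" for b
  proof -
    have b: "b \<in> U" "b0 \<in> U" using that b0(1) assms(1) by auto
    have "\<phi> (f b) = \<phi> b + (- (\<phi> b / \<phi> b0)) * \<phi> b0"
      unfolding f_def lin(1)[OF b(1) U] lin(2)[OF b(2)] ..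
    then have "\<phi> (f b) = 0" using b0(2) by simp
    moreover have "f b \<in> U" unfolding f_def by (rule subspace_add[OF assms(4) b(1) U])
    ultimately show ?thesis by simp
  qed
  then have "f ` (B - {b0}) \<subseteq> {x \<in> U. \<phi> x = 0}" by auto
  moreover have "card B \<le> card (f ` (B - {b0})) + 1"
    using card_image[OF 1(1)] b0(1) assms(3) by simp
  ultimately show ?thesis using 1(2) assms(3) by blast
qed

lemma (in vector_space) independent_in_common_kernel:
  assumes "finite I" "B \<subseteq> U" "independent B" "finite B" "subspace U"
    and lin: "\<And>i x y. i \<in> I \<Longrightarrow> x \<in> U \<Longrightarrow> y \<in> U \<Longrightarrow> \<phi> i (x + y) = \<phi> i x + \<phi> i y"
      "\<And>i c x. i \<in> I \<Longrightarrow> x \<in> U \<Longrightarrow> \<phi> i (scale c x) = c * \<phi> i x"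
  shows "\<exists>B'\<subseteq>{x \<in> U. \<forall>i\<in>I. \<phi> i x = 0}. independent B' \<and> finite B' \<and> card B \<le> card B' + card I"
  using assms(1) lin
proof (induction I)
  case empty
  then show ?case using assms(2-4) by (intro exI[of _ B]) auto
next
  case (insert i I)
  let ?U = "{x \<in> U. \<forall>i\<in>I. \<phi> i x = 0}"
  have "\<exists>B'\<subseteq>?U. independent B' \<and> finite B' \<and> card B \<le> card B' + card I"
    using insert.prems by (intro insert.IH) auto
  then obtain B' where B': "B' \<subseteq> ?U" "independent B'" "finite B'" "card B \<le> card B' + card I"
    by blast
  have sub: "subspace ?U"
  proof (rule subspaceI)
    have "\<phi> i 0 = 0" if "i \<in> I" for i
      using insert.prems(2)[of i 0 0] that subspace_0[OF assms(5)] by simp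
    then show "0 \<in> ?U" using subspace_0[OF assms(5)] by auto
  qed (use insert.prems assms(5) in \<open>auto intro: subspace_add subspace_scale\<close>)
  have "\<exists>B''\<subseteq>{x \<in> ?U. \<phi> i x = 0}. independent B'' \<and> finite B'' \<and> card B' \<le> card B'' + 1"
    using insert.prems by (intro independent_in_kernel[OF B'(1-3) sub]) auto
  then obtain B'' where "B'' \<subseteq> {x \<in> ?U. \<phi> i x = 0}" "independent B''" "finite B''"
    "card B' \<le> card B'' + 1" by blast
  then show ?case using B'(4) insert(1,2) by (intro exI[of _ B'']) auto
qed


section \<open>Spaces of forms as spaces of rational functions\<close>

text \<open>Sections are rational functions, so forms of degree \<open>n\<close> are represented by the rational
  functions with denominator \<open>a ^ n\<close>, on which the vector space structure is available. The
  numerator is determined by the function, so linear functionals of forms become linear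
  functionals on this space.\<close>

definition over_line :: "vec3 \<Rightarrow> nat \<Rightarrow> (vec3 \<Rightarrow> complex) \<Rightarrow> ratfun" where
  "over_line a n F = quot F (\<lambda>v. dot a v ^ n)"

definition numerator :: "vec3 \<Rightarrow> nat \<Rightarrow> ratfun \<Rightarrow> vec3 \<Rightarrow> complex" where
  "numerator a n f = (SOME F. form n F \<and> f = over_line a n F)"

lemma dot_power_nonzero:
  assumes "a \<noteq> 0"
  obtains u where "dot a u ^ n \<noteq> 0"
  using dot_cnj_nonzero[OF assms] dot_commute by (metis power_not_zero)

lemma over_line_inject:
  assumes "a \<noteq> 0" "form n F" "form n G" "over_line a n F = over_line a n G"
  shows "F = G"
proof
  fix v
  obtain u where u: "dot a u ^ n \<noteq> 0" using dot_power_nonzero[OF assms(1)] .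
  show "F v = G v"
    using assms(4) quot_eq_iff[OF assms(2) form_dot_power u assms(3) form_dot_power u]
    by (intro form_cancel[OF assms(2,3) form_dot_power u]) (auto simp: over_line_def)
qed

lemma numerator_over_line:
  assumes "a \<noteq> 0" "form n F"
  shows "numerator a n (over_line a n F) = F"
proof -
  have "form n (numerator a n (over_line a n F)) \<and>
      over_line a n F = over_line a n (numerator a n (over_line a n F))"
    unfolding numerator_def by (rule someI[of _ F]) (use assms(2) in simp)
  then show ?thesis using over_line_inject[OF assms(1)] assms(2) by metis
qed

lemma over_line_add:
  assumes "a \<noteq> 0" "form n F" "form n G"
  shows "over_line a n F + over_line a n G = over_line a n (\<lambda>v. F v + G v)"
proof -
  obtain u where u: "dot a u ^ n \<noteq> 0" using dot_power_nonzero[OF assms(1)] .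
  show ?thesis unfolding over_line_def by (rule quot_add[OF assms(2,3) form_dot_power u])
qed

lemma over_line_scale:
  assumes "a \<noteq> 0" "form n F"
  shows "scale_ratfun c (over_line a n F) = over_line a n (\<lambda>v. c * F v)"
proof -
  obtain u where u: "dot a u ^ n \<noteq> 0" using dot_power_nonzero[OF assms(1)] .
  show ?thesis unfolding over_line_def by (rule scale_quot[OF assms(2) form_dot_power u])
qed

lemma over_line_eq_0_iff:
  assumes "a \<noteq> 0" "form n F"
  shows "over_line a n F = 0 \<longleftrightarrow> (\<forall>v. F v = 0)"
proof -
  obtain u where u: "dot a u ^ n \<noteq> 0" using dot_power_nonzero[OF assms(1)] .
  show ?thesis unfolding over_line_def by (rule quot_eq_0_iff[OF assms(2) form_dot_power u])
qed

lemma over_line_sum: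
  assumes "a \<noteq> 0" "\<And>i. i \<in> I \<Longrightarrow> form n (F i)"
  shows "(\<Sum>i\<in>I. scale_ratfun (c i) (over_line a n (F i))) = over_line a n (\<lambda>v. \<Sum>i\<in>I. c i * F i v)"
  using assms(2)
proof (induction I rule: infinite_finite_induct)
  case (insert i I)
  have "form n (\<lambda>v. \<Sum>i\<in>I. c i * F i v)" using insert.prems by (intro form_sum form_smult) auto
  then show ?case using insert
    by (simp add: over_line_scale[OF assms(1)] over_line_add[OF assms(1)] form_smult)
qed (use over_line_eq_0_iff[OF assms(1) form_zero] in auto)

definition forms_over :: "vec3 \<Rightarrow> nat \<Rightarrow> ratfun set" where
  "forms_over a n = over_line a n ` Collect (form n)"

lemma subspace_forms_over:
  assumes "a \<noteq> 0"
  shows "ratfun.subspace (forms_over a n)"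
proof (rule ratfun.subspaceI)
  show "0 \<in> forms_over a n"
    using over_line_eq_0_iff[OF assms form_zero] form_zero unfolding forms_over_def by force
qed (auto simp: forms_over_def over_line_add[OF assms] over_line_scale[OF assms]
    intro!: imageI form_add form_smult)

lemma numerator_add:
  assumes "a \<noteq> 0" "f \<in> forms_over a n" "g \<in> forms_over a n"
  shows "numerator a n (f + g) = (\<lambda>v. numerator a n f v + numerator a n g v)"
  using assms by (auto simp: forms_over_def over_line_add numerator_over_line form_add)

lemma numerator_scale:
  assumes "a \<noteq> 0" "f \<in> forms_over a n"
  shows "numerator a n (scale_ratfun c f) = (\<lambda>v. c * numerator a n f v)"
  using assms by (auto simp: forms_over_def over_line_scale numerator_over_line form_smult)

lemma form_numerator: "a \<noteq> 0 \<Longrightarrow> f \<in> forms_over a n \<Longrightarrow> form n (numerator a n f)"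
  by (auto simp: forms_over_def numerator_over_line)

lemma over_line_numerator:
  "a \<noteq> 0 \<Longrightarrow> f \<in> forms_over a n \<Longrightarrow> over_line a n (numerator a n f) = f"
  by (auto simp: forms_over_def numerator_over_line)

definition monomial :: "nat \<Rightarrow> nat \<times> nat \<Rightarrow> vec3 \<Rightarrow> complex" where
  "monomial n = (\<lambda>(i, j) v. v $ 1 ^ i * v $ 2 ^ j * v $ 3 ^ (n - i - j))"

lemma form_monomial:
  assumes "i + j \<le> n"
  shows "form n (monomial n (i, j))"
proof -
  have "form k (\<lambda>v. v $ l ^ k)" for k l using form_power[OF form_coord[of l], of k] by simp
  then have "form (i + j + (n - i - j)) (\<lambda>v. v $ 1 ^ i * v $ 2 ^ j * v $ 3 ^ (n - i - j))"
    by (intro form_mult)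
  then show ?thesis using assms by (simp add: monomial_def)
qed

lemma sum_triangle: "2 * (\<Sum>i\<le>n. n - i + 1) = (n + 1) * (n + 2 :: nat)"
proof (induction n)
  case (Suc n)
  have "(\<Sum>i\<le>Suc n. Suc n - i + 1) = (Suc n + 1) + (\<Sum>i\<le>n. n - i + 1)"
    by (subst sum.atMost_Suc_shift) simp
  then show ?case using Suc by simp
qed simp

lemma independent_monomials:
  assumes a: "a \<noteq> 0"
  obtains B where "B \<subseteq> forms_over a n" "ratfun.independent B" "finite B"
    "2 * card B = (n + 1) * (n + 2)"
proof -
  let ?I = "SIGMA i:{..n}. {..n - i}"
  let ?f = "\<lambda>ij. over_line a n (monomial n ij)"
  have fin: "finite ?I" by simp
  have form: "form n (monomial n ij)" if "ij \<in> ?I" for ij using that form_monomial by auto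
  have indep: "\<forall>ij\<in>?I. c ij = 0" if c: "(\<Sum>ij\<in>?I. scale_ratfun (c ij) (?f ij)) = 0" for c
  proof -
    have "form n (\<lambda>v. \<Sum>ij\<in>?I. c ij * monomial n ij v)"
      using form by (intro form_sum form_smult)
    then have "(\<Sum>ij\<in>?I. c ij * monomial n ij v) = 0" for v
      using c over_line_sum[OF a form, where c = c] over_line_eq_0_iff[OF a] by simp
    moreover have "(\<Sum>i\<le>n. (\<Sum>j\<le>n - i. c (i, j) * y ^ j) * x ^ i) =
        (\<Sum>ij\<in>?I. c ij * monomial n ij (vector [x, y, 1]))" for x y
      unfolding sum_distrib_right
      by (subst sum.Sigma) (auto intro!: sum.cong simp: monomial_def)
    ultimately have "(\<Sum>i\<le>n. (\<Sum>j\<le>n - i. c (i, j) * y ^ j) * x ^ i) = 0" for x y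
      by simp
    then have "\<forall>i\<le>n. (\<Sum>j\<le>n - i. c (i, j) * y ^ j) = 0" for y
      by (subst polyfun_eq_0[symmetric]) blast
    then have "\<forall>j\<le>n - i. c (i, j) = 0" if "i \<le> n" for i
      using that by (subst polyfun_eq_0[symmetric]) blast
    then show ?thesis by auto
  qed
  have *: "inj_on ?f ?I" "ratfun.independent (?f ` ?I)"
    using ratfun.independent_family[where f = ?f, OF fin indep] by (auto simp only:)
  show thesis
  proof (rule that[OF _ *(2)])
    show "?f ` ?I \<subseteq> forms_over a n" using form by (auto simp: forms_over_def)
    show "2 * card (?f ` ?I) = (n + 1) * (n + 2)"
      unfolding card_image[OF *(1)] using sum_triangle[of n] by simp
  qed (use fin in simp)
qed

text \<open>The dimension of a space without a finite basis is \<open>0\<close> by convention, so a lower bound for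
  it needs finite-dimensionality. This follows from the grid: a form of degree \<open>n\<close> is determined by
  its values at \<open>(n + 1) * (n + 1)\<close> points.\<close>

lemma poly_eq_0_of_many_roots:
  fixes p :: "complex poly"
  assumes "degree p \<le> n" "\<And>j. j \<le> n \<Longrightarrow> poly p (of_nat j) = 0"
  shows "p = 0"
proof (rule ccontr)
  assume p: "p \<noteq> 0"
  have "of_nat ` {..n} \<subseteq> {x. poly p x = 0}" using assms(2) by auto
  then have "card (of_nat ` {..n} :: complex set) \<le> card {x. poly p x = 0}"
    using poly_roots_finite[OF p] by (rule card_mono[rotated])
  moreover have "card (of_nat ` {..n} :: complex set) = n + 1"
    by (subst card_image) (auto simp: inj_on_def)
  ultimately show False using card_poly_roots_bound[OF p] assms(1) by linarith
qed

lemma form_eq_0_on_grid: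
  assumes F: "form n F" and grid: "\<And>i j. i \<le> n \<Longrightarrow> j \<le> n \<Longrightarrow> F (vector [of_nat i, of_nat j, 1]) = 0"
  shows "F v = 0"
proof -
  have step: "F (vector [x, y, 1]) = 0"
    if "\<And>i. i \<le> n \<Longrightarrow> F (u + of_nat i *s w) = 0" "vector [x, y, 1] = u + t *s w" for x y t u w
  proof -
    obtain p where p: "degree p \<le> n" "\<And>t. F (u + t *s w) = poly p t"
      using form_poly_bounded[OF F] by metis
    then have "p = 0" using that(1) by (intro poly_eq_0_of_many_roots[of p n]) auto
    then show ?thesis using p(2) that(2) by simp
  qed
  have *: "vector [x, 0, 1] + y *s vector [0, 1, 0] = (vector [x, y, 1] :: vec3)"
    "vector [0, y, 1] + x *s vector [1, 0, 0] = (vector [x, y, 1] :: vec3)" for x y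
    by (simp_all add: vec_eq_iff forall_3)
  have 1: "F (vector [of_nat i, y, 1]) = 0" if "i \<le> n" for i y
    by (rule step[of "vector [of_nat i, 0, 1]" "vector [0, 1, 0]" _ _ y])
      (use grid[OF that] in \<open>simp_all add: *\<close>)
  have 2: "F (vector [x, y, 1]) = 0" for x y
    by (rule step[of "vector [0, y, 1]" "vector [1, 0, 0]" _ _ x]) (simp_all add: * 1)
  show ?thesis
    by (rule form_eq_0_on_chart[OF F]) (simp add: form_affine_chart[OF F] 2)
qed

lemma independent_forms_bound:
  assumes a: "a \<noteq> 0" and B: "B \<subseteq> forms_over a n" "ratfun.independent B" "finite B"
  shows "card B \<le> (n + 1) * (n + 1)"
proof (rule ccontr)
  assume big: "\<not> ?thesis"
  let ?I = "{..n} \<times> {..n}"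
  let ?\<phi> = "\<lambda>(i, j) f. numerator a n f (vector [of_nat i, of_nat j, 1])"
  have "\<exists>B'\<subseteq>{x \<in> forms_over a n. \<forall>i\<in>?I. ?\<phi> i x = 0}.
      ratfun.independent B' \<and> finite B' \<and> card B \<le> card B' + card ?I"
    by (rule ratfun.independent_in_common_kernel[OF _ B subspace_forms_over[OF a]])
      (auto simp: numerator_add[OF a] numerator_scale[OF a])
  then obtain B' where B': "B' \<subseteq> {x \<in> forms_over a n. \<forall>i\<in>?I. ?\<phi> i x = 0}"
    "ratfun.independent B'" "card B \<le> card B' + card ?I" by blast
  then have "card B' \<noteq> 0" using big by auto
  then obtain f where f: "f \<in> B'" by fastforce
  have "numerator a n f v = 0" for v
    by (rule form_eq_0_on_grid[OF form_numerator[OF a]]) (use f B'(1) in auto)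
  then have "f = 0"
    using over_line_numerator[OF a, of f n] f B'(1) over_line_eq_0_iff[OF a form_numerator[OF a]]
    by (metis (no_types, lifting) mem_Collect_eq subsetD)
  then show False using f B'(2) ratfun.dependent_zero by blast
qed

text \<open>Extended to a basis of \<open>V\<close>, the independent set stays finite by the previous bound.\<close>

lemma card_le_dim_of_forms:
  assumes a: "a \<noteq> 0" and V: "V \<subseteq> forms_over a n" and B: "B \<subseteq> V" "ratfun.independent B"
  shows "card B \<le> ratfun.dim V"
proof -
  obtain C where C: "B \<subseteq> C" "C \<subseteq> V" "ratfun.independent C" "V \<subseteq> ratfun.span C"
    using ratfun.maximal_independent_subset_extend[OF B] .
  have "finite C"
  proof (rule ccontr)
    assume "infinite C"
    then obtain T where T: "T \<subseteq> C" "card T = Suc ((n + 1) * (n + 1))" "finite T"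
      using infinite_arbitrarily_large by blast
    then show False
      using independent_forms_bound[OF a, of T n] ratfun.independent_mono[OF C(3) T(1)] C(2) V
      by fastforce
  qed
  then show ?thesis using ratfun.dim_unique[OF C(2,4,3) refl] C(1) card_mono by metis
qed


section \<open>Vanishing to a given order\<close>

definition line_poly :: "(vec3 \<Rightarrow> complex) \<Rightarrow> vec3 \<Rightarrow> vec3 \<Rightarrow> complex poly" where
  "line_poly F u w = (SOME q. \<forall>t. F (u + t *s w) = poly q t)"

lemma line_poly_eqI:
  assumes "\<And>t. F (u + t *s w) = poly q t"
  shows "line_poly F u w = q"
proof -
  have "\<forall>t. F (u + t *s w) = poly (line_poly F u w) t"
    unfolding line_poly_def by (rule someI[of _ q]) (use assms in simp)
  then have "poly (line_poly F u w) = poly q" using assms by auto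
  then show ?thesis by (simp add: poly_eq_poly_eq_iff)
qed

lemma poly_line_poly:
  assumes "form n F"
  shows "poly (line_poly F u w) t = F (u + t *s w)"
proof -
  obtain q where q: "\<And>t. F (u + t *s w) = poly q t" using form_poly_on_line[OF assms] by blast
  then have "line_poly F u w = q" by (rule line_poly_eqI)
  then show ?thesis using q by simp
qed

lemma line_poly_add:
  assumes "form n F" "form n G"
  shows "line_poly (\<lambda>v. F v + G v) u w = line_poly F u w + line_poly G u w"
  by (rule line_poly_eqI) (simp add: poly_line_poly[OF assms(1)] poly_line_poly[OF assms(2)])

lemma line_poly_smult:
  assumes "form n F"
  shows "line_poly (\<lambda>v. c * F v) u w = smult c (line_poly F u w)"
  by (rule line_poly_eqI) (simp add: poly_line_poly[OF assms])

text \<open>Two independent directions \<open>y\<close>, \<open>z\<close> at \<open>p\<close>, and the directions \<open>y + j z\<close>, of which infinitely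
  many are needed because conditions of every order are tested along them.\<close>

definition frame :: "proj_plane \<Rightarrow> vec3 \<times> vec3" where
  "frame p = (SOME (y, z). \<forall>w. dot w (rp p) = 0 \<longrightarrow>
     (\<exists>a b. w = a *s vcross (rp p) y + b *s vcross (rp p) z))"

definition direction :: "proj_plane \<Rightarrow> nat \<Rightarrow> vec3" where
  "direction p j = fst (frame p) + of_nat j *s snd (frame p)"

lemma frame_spans:
  assumes "dot w (rp p) = 0"
  shows "\<exists>a b. w = a *s vcross (rp p) (fst (frame p)) + b *s vcross (rp p) (snd (frame p))"
proof -
  obtain y z where "\<And>w. dot w (rp p) = 0 \<Longrightarrow>
      \<exists>a b. w = a *s vcross (rp p) y + b *s vcross (rp p) z"
    using plane_basis[OF rp_nonzero[of p]] by blast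
  then have "\<exists>yz. case yz of (y, z) \<Rightarrow> \<forall>w. dot w (rp p) = 0 \<longrightarrow>
      (\<exists>a b. w = a *s vcross (rp p) y + b *s vcross (rp p) z)"
    by auto
  from someI_ex[OF this] show ?thesis using assms by (auto simp: frame_def case_prod_unfold)
qed

text \<open>The form \<open>F = P(v, p \<times> v)\<close> has at \<open>p\<close> the leading term \<open>P(p, p \<times> v)\<close>, a binary form of
  degree \<open>k\<close>; it is zero once it vanishes in \<open>k + 1\<close> directions, and then the order of vanishing
  goes up. So order \<open>k\<close> costs \<open>1 + 2 + \<dots> + k\<close> conditions.\<close>

lemma vanishes_if_coefficients_zero:
  assumes S: "finite S" "p \<in> S" and F: "form n F" and k: "k \<le> n"
    and zero: "\<And>\<mu> j. \<mu> < k \<Longrightarrow> j \<le> \<mu> \<Longrightarrow> coeff (line_poly F (rp p) (direction p j)) \<mu> = 0"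
  shows "vanishes S n p k F"
  using k zero
proof (induction k)
  case 0
  show ?case
    using multiform_of_form[OF F, of S]
    by (auto simp: vanishes_def on_plane_def fun_upd_def intro!: exI[of _ "\<lambda>v w. F v"])
next
  case (Suc k)
  let ?e = "(\<lambda>_. 0)(p := k)"
  have "vanishes S n p k F" using Suc by (intro Suc.IH) auto
  then obtain P where P: "multiform S (n - k) ?e P" "on_plane P = F" by (auto simp: vanishes_def)
  define g where "g w = P (rp p) (\<lambda>_. w)" for w
  have sum_e: "(\<Sum>p\<in>S. ?e p) = k"
    using S by (simp add: fun_upd_def)
  have prod_e: "(\<Prod>p\<in>S. c ^ ?e p) = c ^ k" for c :: complex
    unfolding power_sum[symmetric] sum_e ..
  have dep: "P u w = P u (\<lambda>_. w p)" for u w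
    by (rule multiform_depends[OF P(1)]) (auto split: if_splits)
  have scale: "P u (\<lambda>_. c *s w) = c ^ k * P u (\<lambda>_. w)" for u c w
    using multiform_scale[OF P(1) S(1), of 1 u "\<lambda>_. c" "\<lambda>_. w"] prod_e by simp
  have g_scale: "g (c *s w) = c ^ k * g w" for c w unfolding g_def by (rule scale)
  have g_poly: "\<exists>r. degree r \<le> k \<and> (\<forall>t. g (w + t *s w') = poly r t)" for w w'
    using multiform_arc[OF P(1) S(1), of 0 0 "rp p" "\<lambda>_. w" "\<lambda>_. w'"] sum_e by (simp add: g_def)
  have lead: "g (vcross (rp p) (direction p j)) = 0" if j: "j \<le> k" for j
  proof -
    let ?d = "direction p j"
    obtain r where r: "\<And>t. P (rp p + t *s ?d) (\<lambda>_. vcross (rp p) ?d) = poly r t"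
      using multiform_arc[OF P(1) S(1), of ?d 1 "rp p" "\<lambda>_. vcross (rp p) ?d" "\<lambda>_. 0"] by auto
    have "F (rp p + t *s ?d) = poly (monom 1 k * r) t" for t
    proof -
      have "F (rp p + t *s ?d) = P (rp p + t *s ?d) (\<lambda>_. t *s vcross (rp p) ?d)"
        unfolding P(2)[symmetric] on_plane_def
        by (subst dep) (simp add: vcross_add vcross_smult)
      then show ?thesis unfolding scale r by (simp add: poly_monom)
    qed
    then have "line_poly F (rp p) ?d = monom 1 k * r" by (rule line_poly_eqI)
    then have "coeff r 0 = 0" using Suc.prems(2)[of k j] j by (simp add: coeff_monom_mult)
    then show ?thesis using r[of 0] by (simp add: g_def poly_0_coeff_0)
  qed
  let ?y = "vcross (rp p) (fst (frame p))" and ?z = "vcross (rp p) (snd (frame p))"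
  obtain r where r: "degree r \<le> k" "\<And>t. g (?y + t *s ?z) = poly r t" using g_poly by blast
  have "poly r (of_nat j) = 0" if "j \<le> k" for j
    using lead[OF that] unfolding direction_def vcross_add vcross_smult r(2) .
  then have "r = 0" by (rule poly_eq_0_of_many_roots[OF r(1)])
  then have yz: "g (?y + t *s ?z) = 0" for t using r(2) by simp
  have *: "g (a *s ?y + b *s ?z) = 0" if "a \<noteq> 0" for a b
  proof -
    have "a *s ?y + b *s ?z = a *s (?y + (b / a) *s ?z)"
      using that by (simp add: vec_eq_iff field_simps)
    then have "g (a *s ?y + b *s ?z) = a ^ k * g (?y + (b / a) *s ?z)" by (simp only: g_scale)
    then show ?thesis by (simp only: yz mult_zero_right)
  qed
  have all: "g (a *s ?y + b *s ?z) = 0" for a b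
  proof -
    obtain q where q: "\<And>t. g (b *s ?z + t *s ?y) = poly q t" using g_poly by blast
    have "poly q t = 0" if "t \<noteq> 0" for t using *[OF that, of b] q by (simp add: add.commute)
    then have "q = 0"
      using poly_roots_finite[of q] infinite_UNIV_char_0[where ?'a = complex]
        finite_subset[of UNIV "insert 0 {t. poly q t = 0}"] by auto
    then show ?thesis using q by (simp add: add.commute)
  qed
  have "P (rp p) (\<lambda>p'. vcross (rp p') v) = 0" for v
  proof -
    obtain a b where "vcross (rp p) v = a *s ?y + b *s ?z" using frame_spans dot_vcross(3) by blast
    then show ?thesis using all by (subst dep) (simp flip: g_def)
  qed
  moreover have "multiform S (Suc (n - Suc k)) ?e P" using P(1) Suc.prems(1) by (simp add: Suc_diff_Suc)
  ultimately obtain Q where "multiform S (n - Suc k) (?e(p := Suc (?e p))) Q" "on_plane Q = on_plane P"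
    using raise_order[OF _ S] by blast
  then show ?case using P(2) Suc.prems(1) by (auto simp: vanishes_def)
qed

text \<open>The expected dimension, doubled. The conditions are the coefficients of \<open>t ^ \<mu>\<close> along the
  lines \<open>p + t (y + j z)\<close> with \<open>j \<le> \<mu> < k p\<close>.\<close>

theorem dim_sections_ge:
  assumes S: "finite S" and a: "a \<noteq> 0" and k: "\<And>p. p \<in> S \<Longrightarrow> k p \<le> n"
  shows "(n + 1) * (n + 2) \<le>
    2 * h0 S (std_divisor S a (int n) (\<lambda>p. int (k p))) + (\<Sum>p\<in>S. k p * (k p + 1))"
proof -
  let ?V = "global_sections S (std_divisor S a (int n) (\<lambda>p. int (k p)))"
  let ?I = "SIGMA p:S. SIGMA \<mu>:{..<k p}. {..\<mu>}"
  let ?\<phi> = "\<lambda>(p, \<mu>, j) f. coeff (line_poly (numerator a n f) (rp p) (direction p j)) \<mu>"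
  obtain B where B: "B \<subseteq> forms_over a n" "ratfun.independent B" "finite B"
    "2 * card B = (n + 1) * (n + 2)" using independent_monomials[OF a] .
  have fin: "finite ?I" using S by auto
  have "\<exists>B'\<subseteq>{x \<in> forms_over a n. \<forall>i\<in>?I. ?\<phi> i x = 0}.
      ratfun.independent B' \<and> finite B' \<and> card B \<le> card B' + card ?I"
    by (rule ratfun.independent_in_common_kernel[OF fin B(1-3) subspace_forms_over[OF a]])
      (auto simp: numerator_add[OF a] numerator_scale[OF a] line_poly_add[OF form_numerator[OF a]
        form_numerator[OF a]] line_poly_smult[OF form_numerator[OF a]])
  then obtain B' where B': "B' \<subseteq> {x \<in> forms_over a n. \<forall>i\<in>?I. ?\<phi> i x = 0}"
    "ratfun.independent B'" "card B \<le> card B' + card ?I" by blast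
  have "B' \<subseteq> ?V"
  proof
    fix f assume "f \<in> B'"
    then have f: "f \<in> forms_over a n" "\<And>i. i \<in> ?I \<Longrightarrow> ?\<phi> i f = 0" using B'(1) by auto
    let ?F = "numerator a n f"
    have "vanishes S n p (k p) ?F" if "p \<in> S" for p
      by (rule vanishes_if_coefficients_zero[OF S that form_numerator[OF a f(1)] k[OF that]])
        (use f(2) that in force)
    then have "over_line a n ?F \<in> ?V"
      unfolding over_line_def by (rule vanishing_form_is_section[OF S a form_numerator[OF a f(1)]])
    then show "f \<in> ?V" using over_line_numerator[OF a f(1)] by simp
  qed
  moreover have "?V \<subseteq> forms_over a n"
  proof
    fix f assume "f \<in> ?V"
    then obtain F where "form n F" "f = over_line a n F"
      unfolding over_line_def by (rule section_is_form[OF S a])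
    then show "f \<in> forms_over a n" by (simp add: forms_over_def)
  qed
  ultimately have "card B' \<le> h0 S (std_divisor S a (int n) (\<lambda>p. int (k p)))"
    unfolding h0_def using card_le_dim_of_forms[OF a _ _ B'(2)] by blast
  moreover have "2 * card ?I = (\<Sum>p\<in>S. k p * (k p + 1))"
  proof -
    have "2 * (\<Sum>\<mu><m. Suc \<mu>) = m * (m + 1)" for m by (induction m) auto
    then show ?thesis using S by (simp add: sum_distrib_left)
  qed
  ultimately show ?thesis using B(4) B'(3) by linarith
qed

section \<open>The incidence geometry of a net\<close>

lemma partition_disjoint_blocks:
  "partition_on A P \<Longrightarrow> B \<in> P \<Longrightarrow> B' \<in> P \<Longrightarrow> L \<in> B \<Longrightarrow> L \<in> B' \<Longrightarrow> B = B'"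
  by (auto simp: partition_on_def disjoint_def)

lemma card_offdiagonal:
  assumes "finite R"
  shows "card {(x, y) \<in> R \<times> R. x \<noteq> y} = card R * (card R - 1)"
proof -
  have "{(x, y) \<in> R \<times> R. x \<noteq> y} = R \<times> R - (\<lambda>x. (x, x)) ` R" by auto
  moreover have "card ((\<lambda>x. (x, x)) ` R) = card R" by (rule card_image) (simp add: inj_on_def)
  moreover have "card (R \<times> R - (\<lambda>x. (x, x)) ` R) = card (R \<times> R) - card ((\<lambda>x. (x, x)) ` R)"
    using assms by (intro card_Diff_subset) auto
  ultimately show ?thesis by (simp add: card_cartesian_product diff_mult_distrib2)
qed

text \<open>Both facts hold because an ordered pair of distinct lines meets in exactly one point: the sets
  \<open>W p\<close> of pairs of lines through the points \<open>p\<close> are disjoint.\<close>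

lemma
  assumes A: "finite \<A>"
  shows finite_L2: "finite (L2 \<A>)"
    and sum_pairs_L2: "(\<Sum>p\<in>L2 \<A>. card {L \<in> \<A>. p on L} * (card {L \<in> \<A>. p on L} - 1))
      \<le> card \<A> * (card \<A> - 1)"
proof -
  define W where "W p = {(L, L') \<in> {L \<in> \<A>. p on L} \<times> {L \<in> \<A>. p on L}. L \<noteq> L'}" for p
  have fin: "finite {L \<in> \<A>. p on L}" for p using A by simp
  have card_W: "card (W p) = card {L \<in> \<A>. p on L} * (card {L \<in> \<A>. p on L} - 1)" for p
    unfolding W_def by (rule card_offdiagonal[OF fin])
  have disj: "p = q" if "LL \<in> W p" "LL \<in> W q" for p q LL
    using that lines_meet_unique by (auto simp: W_def)
  have "W p \<noteq> {}" if "p \<in> L2 \<A>" for p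
    using that card_W[of p] by (auto simp: L2_def)
  then have "\<exists>LL. LL \<in> W p" if "p \<in> L2 \<A>" for p using that by blast
  then obtain w where w: "\<And>p. p \<in> L2 \<A> \<Longrightarrow> w p \<in> W p" by metis
  have "inj_on w (L2 \<A>)" using w disj by (metis inj_onI)
  moreover have "w ` L2 \<A> \<subseteq> \<A> \<times> \<A>"
  proof (rule image_subsetI)
    fix p assume "p \<in> L2 \<A>"
    then show "w p \<in> \<A> \<times> \<A>" using w[of p] by (auto simp: W_def)
  qed
  ultimately show fin2: "finite (L2 \<A>)" using A by (meson finite_SigmaI inj_on_finite)
  have W_sub: "W p \<subseteq> {(L, L') \<in> \<A> \<times> \<A>. L \<noteq> L'}" for p by (auto simp: W_def)
  have fin_pairs: "finite {(L, L') \<in> \<A> \<times> \<A>. L \<noteq> L'}"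
    by (rule finite_subset[OF _ finite_cartesian_product[OF A A]]) auto
  have "(\<Sum>p\<in>L2 \<A>. card (W p)) = card (\<Union>p\<in>L2 \<A>. W p)"
  proof (rule card_UN_disjoint[symmetric, OF fin2])
    show "\<forall>p\<in>L2 \<A>. finite (W p)" using finite_subset[OF W_sub fin_pairs] by simp
    show "\<forall>p\<in>L2 \<A>. \<forall>q\<in>L2 \<A>. p \<noteq> q \<longrightarrow> W p \<inter> W q = {}" using disj by fastforce
  qed
  also have "\<dots> \<le> card {(L, L') \<in> \<A> \<times> \<A>. L \<noteq> L'}"
    by (intro card_mono[OF fin_pairs] UN_least W_sub)
  also have "\<dots> = card \<A> * (card \<A> - 1)" by (rule card_offdiagonal[OF A])
  finally show "(\<Sum>p\<in>L2 \<A>. card {L \<in> \<A>. p on L} * (card {L \<in> \<A>. p on L} - 1))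
      \<le> card \<A> * (card \<A> - 1)" unfolding card_W .
qed

locale net =
  fixes k m :: nat and \<A> :: "line set" and P :: "line set set" and Z :: "proj_plane set"
  assumes is_net: "is_net k \<A> P Z" and order: "net_order \<A> P Z m"
begin

lemma net:
  shows k3: "3 \<le> k" and finite_lines: "finite \<A>" and part: "partition_on \<A> P"
    and card_P: "card P = k" and finite_Z: "finite Z"
    and meet_in_Z: "\<And>B B' L L' p. B \<in> P \<Longrightarrow> B' \<in> P \<Longrightarrow> B \<noteq> B' \<Longrightarrow> L \<in> B \<Longrightarrow> L' \<in> B' \<Longrightarrow>
      p on L \<Longrightarrow> p on L' \<Longrightarrow> p \<in> Z"
    and unique_line: "\<And>p B. p \<in> Z \<Longrightarrow> B \<in> P \<Longrightarrow> \<exists>!L. L \<in> B \<and> p on L"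
    and card_block: "\<And>B. B \<in> P \<Longrightarrow> card B = m"
    and card_line: "\<And>L. L \<in> \<A> \<Longrightarrow> card (line_points L \<inter> Z) = m"
proof -
  show "p \<in> Z" if "B \<in> P" "B' \<in> P" "B \<noteq> B'" "L \<in> B" "L' \<in> B'" "p on L" "p on L'" for B B' L L' p
  proof -
    have "line_points L \<inter> line_points L' \<subseteq> Z"
      using is_net that(1-5) unfolding is_net_def by blast
    then show ?thesis using that(6,7) by (auto simp: line_points_def)
  qed
qed (use is_net order in \<open>simp_all add: is_net_def net_order_def\<close>)

lemma block_subset: "B \<in> P \<Longrightarrow> B \<subseteq> \<A>"
  using part by (auto simp: partition_on_def)

lemma finite_block: "B \<in> P \<Longrightarrow> finite B"
  using block_subset finite_lines finite_subset by blast

lemma finite_P: "finite P"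
  using card_P k3 by (metis card.infinite not_numeral_le_zero)

lemma m_pos: "0 < m"
proof -
  have "P \<noteq> {}" using card_P k3 by auto
  then obtain B where "B \<in> P" by blast
  moreover from this have "B \<noteq> {}" using part by (auto simp: partition_on_def)
  ultimately show ?thesis using card_block finite_block by (metis card_gt_0_iff)
qed

lemma two_blocks:
  obtains B B' where "B \<in> P" "B' \<in> P" "B \<noteq> B'"
proof -
  have "\<not> card P \<le> 1" using card_P k3 by simp
  then show thesis using that finite_P by (metis card_le_Suc0_iff_eq One_nat_def)
qed

lemma card_lines: "card \<A> = k * m"
proof -
  have "card (\<Union>P) = (\<Sum>B\<in>P. card B)"
    using part finite_block by (intro card_Union_disjoint) (auto simp: partition_on_def)
  then show ?thesis using part card_block card_P by (simp add: partition_on_def)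
qed

lemma block_of_line: "L \<in> \<A> \<Longrightarrow> \<exists>B\<in>P. L \<in> B"
  using part by (auto simp: partition_on_def)

lemma lines_through_Z:
  assumes p: "p \<in> Z"
  shows "card {L \<in> \<A>. p on L} = k"
proof -
  define g where "g B = (THE L. L \<in> B \<and> p on L)" for B
  have g: "g B \<in> B \<and> p on g B" if "B \<in> P" for B
    unfolding g_def using theI'[OF unique_line[OF p that]] .
  have "bij_betw g P {L \<in> \<A>. p on L}"
  proof (rule bij_betw_imageI)
    show "inj_on g P" using g partition_disjoint_blocks[OF part] by (metis inj_onI)
    show "g ` P = {L \<in> \<A>. p on L}"
    proof
      show "g ` P \<subseteq> {L \<in> \<A>. p on L}" using g block_subset by blast
      show "{L \<in> \<A>. p on L} \<subseteq> g ` P"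
      proof
        fix L assume L: "L \<in> {L \<in> \<A>. p on L}"
        then obtain B where B: "B \<in> P" "L \<in> B" using block_of_line by blast
        then have "L = g B" using unique_line[OF p B(1)] g[OF B(1)] L by blast
        then show "L \<in> g ` P" using B(1) by blast
      qed
    qed
  qed
  then show ?thesis using bij_betw_same_card card_P by fastforce
qed

lemma Z_subset_L2: "Z \<subseteq> L2 \<A>"
  using lines_through_Z k3 by (auto simp: L2_def)

text \<open>Lines of different blocks meet in \<open>Z\<close>, so the lines through any other point belong to one
  block.\<close>

lemma lines_off_Z:
  assumes "p \<notin> Z"
  shows "card {L \<in> \<A>. p on L} \<le> m"
proof (cases "{L \<in> \<A>. p on L} = {}")
  case False
  then obtain L B where L: "L \<in> \<A>" "p on L" "B \<in> P" "L \<in> B" using block_of_line by blast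
  have "{L \<in> \<A>. p on L} \<subseteq> B"
    using block_of_line meet_in_Z[OF L(3) _ _ L(4) _ L(2)] assms by blast
  then have "card {L \<in> \<A>. p on L} \<le> card B" by (rule card_mono[OF finite_block[OF L(3)]])
  then show ?thesis using card_block[OF L(3)] by simp
next
  case True
  then show ?thesis unfolding True by simp
qed

text \<open>The lines of two blocks meet in distinct points of \<open>Z\<close>, since each point of \<open>Z\<close> lies on only
  one line of each block.\<close>

lemma card_Z_ge: "m * m \<le> card Z"
proof -
  obtain B B' where B: "B \<in> P" "B' \<in> P" "B \<noteq> B'" by (rule two_blocks)
  have "\<exists>q. q on fst LL \<and> q on snd LL" if "LL \<in> B \<times> B'" for LL
    using that lines_meet[of "fst LL" "snd LL"] partition_disjoint_blocks[OF part B(1,2)] B(3)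
    by (metis mem_Times_iff)
  then obtain q where q: "\<And>LL. LL \<in> B \<times> B' \<Longrightarrow> q LL on fst LL \<and> q LL on snd LL" by metis
  have qZ: "q LL \<in> Z" if "LL \<in> B \<times> B'" for LL
    using meet_in_Z[OF B, of "fst LL" "snd LL"] q[OF that] that by auto
  have "inj_on q (B \<times> B')"
  proof (rule inj_onI)
    fix x y assume xy: "x \<in> B \<times> B'" "y \<in> B \<times> B'" "q x = q y"
    have "fst x = fst y"
      using unique_line[OF qZ[OF xy(1)] B(1)] q[OF xy(1)] q[OF xy(2)] xy by auto
    moreover have "snd x = snd y"
      using unique_line[OF qZ[OF xy(1)] B(2)] q[OF xy(1)] q[OF xy(2)] xy by auto
    ultimately show "x = y" by (simp add: prod_eq_iff)
  qed
  then have "card (B \<times> B') \<le> card Z"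
    using qZ finite_Z by (intro card_inj_on_le[of q]) auto
  then show ?thesis using card_block B by (simp add: card_cartesian_product)
qed

end


section \<open>Forms vanishing on the base points of a net\<close>

lemma plane_span:
  assumes "a \<noteq> 0" "dot a w0 = 0" "dot a w1 = 0" "vcross w0 w1 \<noteq> 0" "dot a w = 0"
  obtains \<alpha> \<beta> where "w = \<alpha> *s w0 + \<beta> *s w1"
proof -
  obtain e where e: "dot e (vcross w0 w1) = 1" using dot_normalised[OF assms(4)] by blast
  obtain c where c: "a = c *s vcross w0 w1"
    using common_orthogonal[OF assms(4), of a] assms(2,3) by (metis dot_commute)
  then have "dot w (vcross w0 w1) = 0"
    using assms(1,5) by (auto simp: dot_smult dot_commute)
  moreover have "dot e (vcross w0 w1) *s w = dot e (vcross w w1) *s w0 +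
      dot e (vcross w0 w) *s w1 + dot w (vcross w0 w1) *s e"
    by (simp add: vec_eq_iff forall_3 dot_3 algebra_simps)
  ultimately show thesis using e that by simp
qed

lemma form_vanishes_on_line:
  assumes F: "form n F" and a: "a \<noteq> 0" and W: "finite W" "n < card W"
    and line: "\<And>w. w \<in> W \<Longrightarrow> dot a w = 0" and zero: "\<And>w. w \<in> W \<Longrightarrow> F w = 0"
    and indep: "\<And>w w'. w \<in> W \<Longrightarrow> w' \<in> W \<Longrightarrow> w \<noteq> w' \<Longrightarrow> vcross w w' \<noteq> 0"
    and v: "dot a v = 0"
  shows "F v = 0"
proof (cases "n = 0")
  case True
  obtain w where "w \<in> W" using W by fastforce
  then show ?thesis
    using zero form_scale[OF F, of 0 v] form_scale[OF F, of 0 w] True by simp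
next
  case False
  \<comment> \<open>With \<open>w0\<close> at infinity, the restriction of \<open>F\<close> to the line is a polynomial with the other
    points of \<open>W\<close>, at least \<open>n\<close>, as roots and without a term of degree \<open>n\<close>.\<close>
  obtain w0 where w0: "w0 \<in> W" using W by fastforce
  have "0 < card (W - {w0})" using W False w0 by simp
  then obtain w1 where w1: "w1 \<in> W" "w1 \<noteq> w0" by (metis Diff_iff card_gt_0_iff ex_in_conv singletonI)
  have i01: "vcross w0 w1 \<noteq> 0" using indep w0 w1 by blast
  have "\<exists>\<alpha> \<beta>. w = \<alpha> *s w0 + \<beta> *s w1" if "dot a w = 0" for w
    using plane_span[OF a line[OF w0] line[OF w1(1)] i01 that] by blast
  then obtain \<alpha> \<beta> where ab: "\<And>w. dot a w = 0 \<Longrightarrow> w = \<alpha> w *s w0 + \<beta> w *s w1" by metis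
  obtain q where q: "degree q \<le> n" "coeff q n = F w0" "\<And>t. F (w1 + t *s w0) = poly q t"
    using form_poly_bounded[OF F] by metis
  have \<beta>: "\<beta> w \<noteq> 0" if "w \<in> W - {w0}" for w
  proof
    assume "\<beta> w = 0"
    then have "w = \<alpha> w *s w0" using ab[OF line, of w] that by simp
    then have "vcross w0 w = 0" by (metis vcross_smult(1) vcross_self vector_smult_rzero)
    then show False using indep[OF w0, of w] that by auto
  qed
  have eq: "w = \<beta> w *s (w1 + (\<alpha> w / \<beta> w) *s w0)" if "dot a w = 0" "\<beta> w \<noteq> 0" for w
  proof -
    have "\<beta> w *s (w1 + (\<alpha> w / \<beta> w) *s w0) = \<alpha> w *s w0 + \<beta> w *s w1"
      using that(2) by (simp add: vec_eq_iff field_simps)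
    then show ?thesis using ab[OF that(1)] by simp
  qed
  have F_eq: "F w = \<beta> w ^ n * poly q (\<alpha> w / \<beta> w)" if "dot a w = 0" "\<beta> w \<noteq> 0" for w
    using form_scale[OF F] q(3) eq[OF that] by metis
  have "q = 0"
  proof (rule ccontr)
    assume q0: "q \<noteq> 0"
    let ?t = "\<lambda>w. \<alpha> w / \<beta> w"
    have "inj_on ?t (W - {w0})"
    proof (rule inj_onI, rule ccontr)
      fix w w' assume w: "w \<in> W - {w0}" "w' \<in> W - {w0}" "?t w = ?t w'" "w \<noteq> w'"
      have "w = \<beta> w *s (w1 + ?t w *s w0)" by (rule eq[OF line \<beta>]) (use w in auto)
      moreover have "w' = \<beta> w' *s (w1 + ?t w *s w0)"
        unfolding w(3) by (rule eq[OF line \<beta>]) (use w in auto)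
      ultimately have "vcross w w' =
          vcross (\<beta> w *s (w1 + ?t w *s w0)) (\<beta> w' *s (w1 + ?t w *s w0))"
        by (rule arg_cong2)
      then have "vcross w w' = 0" by (simp only: vcross_smult vcross_self vector_smult_rzero)
      then show False using indep w by blast
    qed
    then have "card (?t ` (W - {w0})) = card W - 1" using card_image W(1) w0 by fastforce
    moreover have "?t ` (W - {w0}) \<subseteq> {t. poly q t = 0}"
      using F_eq \<beta> line zero by fastforce
    then have "card (?t ` (W - {w0})) \<le> card {t. poly q t = 0}"
      by (rule card_mono[OF poly_roots_finite[OF q0]])
    ultimately have "n \<le> degree q" using card_poly_roots_bound[OF q0] W(2) by linarith
    then have "degree q = n" using q(1) by simp
    then show False using q0 q(2) zero[OF w0] by (metis leading_coeff_0_iff)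
  qed
  show ?thesis
  proof (cases "\<beta> v = 0")
    case True
    then have "v = \<alpha> v *s w0" using ab[OF v] by simp
    then show ?thesis using form_scale[OF F, of "\<alpha> v" w0] zero[OF w0] by simp
  next
    case False
    then show ?thesis using F_eq[OF v] \<open>q = 0\<close> by simp
  qed
qed

definition block_form :: "line set \<Rightarrow> vec3 \<Rightarrow> complex" where
  "block_form B v = (\<Prod>L\<in>B. dot (rp L) v)"

lemma form_block_form: "finite B \<Longrightarrow> form (card B) (block_form B)"
  using form_prod[of B "\<lambda>_. 1" "\<lambda>L. dot (rp L)"] form_dot
  by (simp add: block_form_def[abs_def])

context net
begin

lemma Z_vectors:
  assumes "L \<in> \<A>"
  defines "W \<equiv> rp ` (line_points L \<inter> Z)"
  shows "finite W" "card W = m" "\<And>w. w \<in> W \<Longrightarrow> dot (rp L) w = 0"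
    "\<And>w w'. w \<in> W \<Longrightarrow> w' \<in> W \<Longrightarrow> w \<noteq> w' \<Longrightarrow> vcross w w' \<noteq> 0"
proof -
  show "finite W" using finite_Z by (simp add: W_def)
  have "inj rp" by (metis abs_rp injI)
  then show "card W = m"
    unfolding W_def using card_line[OF assms(1)] by (metis card_image inj_on_subset subset_UNIV)
  show "dot (rp L) w = 0" if "w \<in> W" for w using that by (auto simp: W_def line_points_def on_iff)
  show "vcross w w' \<noteq> 0" if "w \<in> W" "w' \<in> W" "w \<noteq> w'" for w w'
    using that by (auto simp: W_def intro!: vcross_rp_nonzero)
qed

text \<open>Lines of one block are split off one by one: the degree of what remains is always smaller
  than the number of its zeros on the next line.\<close>

lemma split_off_block:
  assumes B: "B \<in> P" and T: "finite T" "T \<subseteq> B" "card T < m"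
    and G: "form (card T) G" "\<And>p L. p \<in> Z \<Longrightarrow> L \<in> T \<Longrightarrow> p on L \<Longrightarrow> G (rp p) = 0"
  shows "\<exists>c. \<forall>v. G v = c * block_form T v"
  using T G
proof (induction T arbitrary: G)
  case empty
  have "G v = G 0" for v using form_scale[OF empty.prems(3), of 0 v] by simp
  then show ?case by (intro exI[of _ "G 0"]) (auto simp: block_form_def)
next
  case (insert L T)
  have L: "L \<in> \<A>" using insert.prems(1) block_subset[OF B] by auto
  have many: "card (insert L T) < card (rp ` (line_points L \<inter> Z))"
    using insert.prems(2) Z_vectors(2)[OF L] by simp
  have zero: "G w = 0" if "w \<in> rp ` (line_points L \<inter> Z)" for w
    using that insert.prems(4) by (auto simp: line_points_def)
  have van: "G v = 0" if "dot (rp L) v = 0" for v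
    by (rule form_vanishes_on_line[OF insert.prems(3) rp_nonzero Z_vectors(1)[OF L] many
          Z_vectors(3)[OF L] zero Z_vectors(4)[OF L] that])
  then obtain H where H: "form (card T) H" "\<And>v. G v = dot (rp L) v * H v"
    using form_div_line[OF insert.prems(3), of "rp L"] van insert(1,2) by auto
  have "H (rp p) = 0" if p: "p \<in> Z" "L' \<in> T" "p on L'" for p L'
  proof -
    have "L' \<noteq> L" using p insert(2) by auto
    then have "\<not> p on L" using unique_line[OF p(1) B] p insert.prems(1) by blast
    then show ?thesis using insert.prems(4)[of p L'] p H(2)[of "rp p"] by (simp add: on_iff)
  qed
  then obtain c where "\<And>v. H v = c * block_form T v"
    using insert.IH[OF _ _ H(1)] insert.prems insert(1,2) by auto
  then show ?case using H(2) insert(1,2) by (intro exI[of _ c]) (auto simp: block_form_def)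
qed

text \<open>No linear form of the other block vanishes on all of \<open>L\<close>, hence neither does their product.
  The point found lies off \<open>Z\<close>, because the product does vanish there.\<close>

lemma point_off_block:
  assumes B: "B \<in> P" "B' \<in> P" "B \<noteq> B'" and L: "L \<in> B"
  obtains q where "dot (rp L) q = 0" "block_form B' q \<noteq> 0"
proof -
  have nz: "\<exists>v. dot (rp L') (vcross (rp L) v) \<noteq> 0" if "L' \<in> B'" for L'
  proof -
    have "L' \<noteq> L" using that L B partition_disjoint_blocks[OF part] by blast
    then have "vcross (rp L') (rp L) \<noteq> 0" by (rule vcross_rp_nonzero)
    moreover have "dot (rp L') (vcross (rp L) v) = dot v (vcross (rp L') (rp L))" for v
      by (simp add: dot_3 algebra_simps)
    ultimately show ?thesis using dot_cnj_nonzero by metis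
  qed
  have "\<exists>v. (\<Prod>L'\<in>B'. dot (rp L') (vcross (rp L) v)) \<noteq> 0"
    by (rule form_prod_nonzero[OF finite_block[OF B(2)] form_dot_vcross nz])
  then obtain v where "(\<Prod>L'\<in>B'. dot (rp L') (vcross (rp L) v)) \<noteq> 0" by blast
  then show thesis by (intro that[of "vcross (rp L) v"]) (simp_all add: block_form_def)
qed

lemma block_form_zero:
  assumes "B \<in> P" "p \<in> Z"
  shows "block_form B (rp p) = 0"
  using unique_line[OF assms(2,1)] finite_block[OF assms(1)]
  by (auto simp: block_form_def on_iff)

text \<open>One value on a line of the first block is corrected by the product of the second; then this
  line has one zero more than the degree and splits off, and after it all others of its block.\<close>

lemma pencil:
  assumes B: "B \<in> P" "B' \<in> P" "B \<noteq> B'"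
    and F: "form m F" "\<And>p. p \<in> Z \<Longrightarrow> F (rp p) = 0"
  shows "\<exists>c c'. \<forall>v. F v = c * block_form B v + c' * block_form B' v"
proof -
  have "B \<noteq> {}" using B(1) part by (auto simp: partition_on_def)
  then obtain L where L: "L \<in> B" by blast
  then have LA: "L \<in> \<A>" using block_subset[OF B(1)] by auto
  obtain q where q: "dot (rp L) q = 0" "block_form B' q \<noteq> 0" by (rule point_off_block[OF B L])
  let ?c = "F q / block_form B' q"
  define G where "G v = F v - ?c * block_form B' v" for v
  have fB': "form m (block_form B')" using form_block_form[OF finite_block[OF B(2)]] card_block[OF B(2)] by simp
  have fG: "form m G" unfolding G_def[abs_def] by (intro form_diff F form_smult fB')
  have Gq: "G q = 0" using q(2) by (simp add: G_def)
  have GZ: "G (rp p) = 0" if "p \<in> Z" for p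
    using F(2)[OF that] block_form_zero[OF B(2) that] by (simp add: G_def)
  let ?W = "rp ` (line_points L \<inter> Z)"
  have off: "vcross (rp p) q \<noteq> 0 \<and> vcross q (rp p) \<noteq> 0" if p: "p \<in> Z" for p
  proof -
    have "vcross (rp p) q \<noteq> 0"
    proof
      assume "vcross (rp p) q = 0"
      then obtain d where "q = d *s rp p" using vcross_eq_0_imp rp_nonzero by blast
      then show False
        using q(2) form_scale[OF fB', of d "rp p"] block_form_zero[OF B(2) p] by simp
    qed
    moreover have "vcross q (rp p) = - vcross (rp p) q"
      by (simp add: vec_eq_iff forall_3)
    ultimately show ?thesis by simp
  qed
  have "q \<notin> ?W" using off by fastforce
  then have card: "m < card (insert q ?W)"
    using Z_vectors(1,2)[OF LA] by simp
  have "G v = 0" if "dot (rp L) v = 0" for v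
  proof (rule form_vanishes_on_line[OF fG rp_nonzero _ card _ _ _ that])
    show "finite (insert q ?W)" using Z_vectors(1)[OF LA] by simp
    show "dot (rp L) w = 0" if "w \<in> insert q ?W" for w using that q(1) Z_vectors(3)[OF LA] by auto
    show "G w = 0" if "w \<in> insert q ?W" for w using that Gq GZ by auto
    show "vcross w w' \<noteq> 0" if "w \<in> insert q ?W" "w' \<in> insert q ?W" "w \<noteq> w'" for w w'
      using that Z_vectors(4)[OF LA, of w w'] off by auto
  qed
  then obtain H where H: "form (m - 1) H" "\<And>v. G v = dot (rp L) v * H v"
    using form_div_line[OF fG rp_nonzero] by metis
  have cardB: "card (B - {L}) = m - 1" using card_block[OF B(1)] finite_block[OF B(1)] L by simp
  have "\<exists>c. \<forall>v. H v = c * block_form (B - {L}) v"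
  proof (rule split_off_block[OF B(1)])
    show "finite (B - {L})" "B - {L} \<subseteq> B" using finite_block[OF B(1)] by auto
    show "card (B - {L}) < m" using cardB m_pos by simp
    show "form (card (B - {L})) H" using H(1) cardB by simp
    show "H (rp p) = 0" if p: "p \<in> Z" "L' \<in> B - {L}" "p on L'" for p L'
    proof -
      have "\<not> p on L" using unique_line[OF p(1) B(1)] p L by blast
      then show ?thesis using GZ[OF p(1)] H(2)[of "rp p"] by (simp add: on_iff)
    qed
  qed
  then obtain c where c: "\<And>v. H v = c * block_form (B - {L}) v" by blast
  have "F v = c * block_form B v + ?c * block_form B' v" for v
  proof -
    have "block_form B v = dot (rp L) v * block_form (B - {L}) v"
      unfolding block_form_def using finite_block[OF B(1)] L by (rule prod.remove)
    then show ?thesis using H(2)[of v] c[of v] by (simp add: G_def algebra_simps)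
  qed
  then show ?thesis by blast
qed

end


section \<open>The decomposition\<close>

lemma vanishes_order_0: "form n F \<Longrightarrow> vanishes S n p 0 F"
  using multiform_of_form[of n F S]
  by (auto simp: vanishes_def on_plane_def fun_upd_def intro!: exI[of _ "\<lambda>v w. F v"])

lemma vanishes_order_1:
  assumes "form n F" "0 < n" "finite S" "p \<in> S" "F (rp p) = 0"
  shows "vanishes S n p 1 F"
proof -
  obtain a where a: "n = Suc a" using assms(2) by (cases n) auto
  obtain Q where "multiform S a ((\<lambda>_. 0)(p := Suc 0)) Q" "on_plane Q = on_plane (\<lambda>v w. F v)"
    using raise_order[OF multiform_of_form[OF assms(1)[unfolded a]] assms(3,4)] assms(5) by auto
  then show ?thesis using a by (auto simp: vanishes_def on_plane_def[of "\<lambda>v w. F v", abs_def])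
qed

context net
begin

text \<open>Independence of the two products: each has a zero where the other has none.\<close>

lemma dim_pencil:
  assumes a: "a \<noteq> 0"
  shows "h0 (L2 \<A>) (std_divisor (L2 \<A>) a (int m) (\<lambda>p. int (if p \<in> Z then 1 else 0))) = 2"
    (is "h0 ?S ?D = 2")
proof -
  have S: "finite ?S" by (rule finite_L2[OF finite_lines])
  obtain B B' where B: "B \<in> P" "B' \<in> P" "B \<noteq> B'" by (rule two_blocks)
  have fB: "form m (block_form C)" if "C \<in> P" for C
    using form_block_form[OF finite_block[OF that]] card_block[OF that] by simp
  define f where "f b = (if b then block_form B else block_form B')" for b
  have ff: "form m (f b)" for b using fB B by (simp add: f_def)
  let ?g = "\<lambda>b. over_line a m (f b)"
  have sec: "over_line a m (f b) \<in> global_sections ?S ?D" for b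
    unfolding over_line_def
  proof (rule vanishing_form_is_section[OF S a ff])
    fix p assume p: "p \<in> ?S"
    have "f b (rp p) = 0" if "p \<in> Z" using block_form_zero that B by (simp add: f_def)
    then show "vanishes ?S m p (if p \<in> Z then 1 else 0) (f b)"
      using vanishes_order_0[OF ff] vanishes_order_1[OF ff m_pos S p] by simp
  qed
  have "\<forall>b\<in>UNIV. c b = 0" if c: "(\<Sum>b\<in>UNIV. scale_ratfun (c b) (?g b)) = 0" for c
  proof -
    have "form m (\<lambda>v. \<Sum>b\<in>UNIV. c b * f b v)" by (intro form_sum form_smult ff)
    then have "(\<Sum>b\<in>UNIV. c b * f b v) = 0" for v
      using c over_line_sum[OF a ff, where c = c] over_line_eq_0_iff[OF a] by simp
    then have eq: "c True * block_form B v + c False * block_form B' v = 0" for v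
      by (simp add: UNIV_bool f_def add.commute)
    have "C \<noteq> {}" if "C \<in> P" for C using that part by (auto simp: partition_on_def)
    then obtain L L' where L: "L \<in> B" "L' \<in> B'" using B by blast
    have zero: "block_form C q = 0" if "C \<in> P" "M \<in> C" "dot (rp M) q = 0" for C M q
      using that finite_block by (auto simp: block_form_def)
    obtain q where q: "dot (rp L) q = 0" "block_form B' q \<noteq> 0" by (rule point_off_block[OF B L(1)])
    obtain q' where q': "dot (rp L') q' = 0" "block_form B q' \<noteq> 0"
      using point_off_block[OF B(2,1) _ L(2)] B(3) by metis
    have "c False = 0" using eq[of q] zero[OF B(1) L(1) q(1)] q(2) by simp
    moreover have "c True = 0" using eq[of q'] zero[OF B(2) L(2) q'(1)] q'(2) by simp
    ultimately show ?thesis by (metis (full_types))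
  qed
  from ratfun.independent_family[where f = ?g, OF finite this]
  have indep: "inj ?g" "ratfun.independent (range ?g)" by auto
  show ?thesis
    unfolding h0_def
  proof (rule ratfun.dim_unique[OF _ _ indep(2)])
    show "range ?g \<subseteq> global_sections ?S ?D" using sec by auto
    show "card (range ?g) = 2" using card_image[OF indep(1)] by simp
    show "global_sections ?S ?D \<subseteq> ratfun.span (range ?g)"
    proof
      fix h assume h: "h \<in> global_sections ?S ?D"
      obtain F where F: "form m F" "h = quot F (\<lambda>v. dot a v ^ m)" by (rule section_is_form[OF S a h])
      have "F (rp p) = 0" if "p \<in> Z" for p
        by (rule section_vanishes[OF S a F(1) _ _ h[unfolded F(2)]]) (use that Z_subset_L2 in auto)
      then obtain c c' where c: "\<And>v. F v = c * block_form B v + c' * block_form B' v"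
        using pencil[OF B F(1)] by blast
      have "h = over_line a m (\<lambda>v. c * f True v + c' * f False v)"
        unfolding F(2) over_line_def by (rule arg_cong2[of _ _ _ _ quot]) (auto simp: f_def c)
      also have "\<dots> = scale_ratfun c (?g True) + scale_ratfun c' (?g False)"
        by (simp add: over_line_scale[OF a ff] over_line_add[OF a] form_smult ff)
      also have "\<dots> \<in> ratfun.span (range ?g)"
        by (intro ratfun.span_add ratfun.span_scale ratfun.span_base) auto
      finally show "h \<in> ratfun.span (range ?g)" .
    qed
  qed
qed

text \<open>The multiplicities \<open>\<mu>(p)\<close> of \<open>D\<^sub>\<A>\<close>, lowered by one on \<open>Z\<close>.\<close>

definition residual_mult :: "proj_plane \<Rightarrow> nat" where
  "residual_mult p = card {L \<in> \<A>. p on L} - 1 - (if p \<in> Z then 1 else 0)"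

lemma mu_eq:
  assumes "p \<in> L2 \<A>"
  shows "mu \<A> p = int (if p \<in> Z then 1 else 0) + int (residual_mult p)"
  using assms lines_through_Z[of p] k3 by (auto simp: mu_def residual_mult_def L2_def)

text \<open>The dimension count \<open>dim_sections_ge\<close> presupposes that no multiplicity exceeds the degree.\<close>

lemma residual_mult_le: "residual_mult p \<le> (k - 1) * m - 1"
proof (cases "p \<in> Z")
  case True
  have "k - 1 \<le> (k - 1) * m" using m_pos by simp
  moreover have "residual_mult p = k - 1 - 1"
    using lines_through_Z[OF True] True by (simp add: residual_mult_def)
  ultimately show ?thesis by linarith
next
  case False
  have "1 * m \<le> (k - 1) * m" using k3 by (intro mult_le_mono1) simp
  moreover have "residual_mult p \<le> m - 1"
    using lines_off_Z[OF False] False by (simp add: residual_mult_def)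
  ultimately show ?thesis by linarith
qed

text \<open>At a point of \<open>Z\<close>, the conditions drop (doubled) from \<open>k (k - 1)\<close> to \<open>(k - 2) (k - 1)\<close>.\<close>

lemma sum_residual_conditions:
  "(\<Sum>p\<in>L2 \<A>. residual_mult p * (residual_mult p + 1)) + 2 * (k - 1) * (m * m)
    \<le> k * m * (k * m - 1)"
proof -
  let ?r = "\<lambda>p. card {L \<in> \<A>. p on L}"
  have S: "finite (L2 \<A>)" by (rule finite_L2[OF finite_lines])
  have split: "residual_mult p * (residual_mult p + 1) + (if p \<in> Z then 2 * (k - 1) else 0) =
      ?r p * (?r p - 1)" if p: "p \<in> L2 \<A>" for p
  proof (cases "p \<in> Z")
    case True
    obtain j where j: "k = j + 2" using k3 by (metis add.commute le_Suc_ex numeral_3_eq_3 add_2_eq_Suc Suc_leD numeral_2_eq_2)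
    show ?thesis using lines_through_Z[OF True] True unfolding residual_mult_def j
      by (simp add: algebra_simps)
  next
    case False
    then show ?thesis using p by (simp add: residual_mult_def L2_def mult.commute)
  qed
  have "(\<Sum>p\<in>L2 \<A>. residual_mult p * (residual_mult p + 1)) + 2 * (k - 1) * (m * m)
      \<le> (\<Sum>p\<in>L2 \<A>. residual_mult p * (residual_mult p + 1)) + 2 * (k - 1) * card Z"
    using card_Z_ge by simp
  also have "\<dots> = (\<Sum>p\<in>L2 \<A>. residual_mult p * (residual_mult p + 1)) +
      (\<Sum>p\<in>L2 \<A>. if p \<in> Z then 2 * (k - 1) else 0)"
    using S Z_subset_L2 by (simp add: sum.inter_restrict[symmetric] Int_absorb1 mult.commute)
  also have "\<dots> = (\<Sum>p\<in>L2 \<A>. ?r p * (?r p - 1))"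
    unfolding sum.distrib[symmetric] by (rule sum.cong) (simp_all only: split)
  also have "\<dots> \<le> k * m * (k * m - 1)"
    using sum_pairs_L2[OF finite_lines] card_lines by simp
  finally show ?thesis .
qed

lemma dim_residual:
  assumes a: "a \<noteq> 0"
  shows "int (k * m) - int ((m + 1) choose 2) \<le>
    int (h0 (L2 \<A>) (std_divisor (L2 \<A>) a (int ((k - 1) * m - 1)) (\<lambda>p. int (residual_mult p))))"
    (is "_ \<le> int ?h")
proof -
  let ?n = "(k - 1) * m - 1"
  have "0 < (k - 1) * m" using k3 m_pos by simp
  then have n: "?n + 1 = (k - 1) * m" "?n + 2 = (k - 1) * m + 1" by auto
  have "(k - 1) * m * ((k - 1) * m + 1) \<le>
      2 * ?h + (\<Sum>p\<in>L2 \<A>. residual_mult p * (residual_mult p + 1))"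
    using dim_sections_ge[OF finite_L2[OF finite_lines] a residual_mult_le] unfolding n .
  then have nat_bound: "(k - 1) * m * ((k - 1) * m + 1) + 2 * (k - 1) * (m * m) \<le>
      2 * ?h + k * m * (k * m - 1)"
    using sum_residual_conditions by linarith
  define x where "x = int k"
  define y where "y = int m"
  have "1 \<le> k * m" using k3 m_pos by (simp add: Suc_leI)
  then have xy: "int (k * m - 1) = x * y - 1" "int (k - 1) = x - 1"
    using k3 by (simp_all add: x_def y_def of_nat_diff)
  define h where "h = ?h"
  have "int ((k - 1) * m * ((k - 1) * m + 1) + 2 * (k - 1) * (m * m)) \<le>
      int (2 * h + k * m * (k * m - 1))"
    using nat_bound unfolding h_def by (simp only: of_nat_le_iff)
  then have "(x - 1) * y * ((x - 1) * y + 1) + 2 * (x - 1) * (y * y) \<le>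
      2 * int ?h + x * y * (x * y - 1)"
    unfolding h_def[symmetric]
    by (simp only: of_nat_add of_nat_mult xy of_nat_1 of_nat_numeral x_def[symmetric] y_def[symmetric])
  then have "2 * (x * y) - y * (y + 1) \<le> 2 * int ?h" by (simp add: algebra_simps)
  moreover have "2 * int ((m + 1) choose 2) = y * (y + 1)"
  proof -
    have "2 * ((m + 1) choose 2) = (m + 1) * m" by (simp add: choose_two)
    then show ?thesis by (simp add: y_def algebra_simps flip: of_nat_mult of_nat_add)
  qed
  ultimately show ?thesis by (simp add: x_def y_def)
qed

end

theorem theorem4p10:
  fixes \<A> :: "line set" and k m :: nat
  assumes "is_km_net k m \<A>"
  shows "\<exists>A B. is_divisor (L2 \<A>) A \<and> is_divisor (L2 \<A>) B \<and>
           represents_D \<A> (div_plus A B) \<and>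
           h0 (L2 \<A>) A = 2 \<and>
           int (h0 (L2 \<A>) B) \<ge> int (k * m) - int ((m + 1) choose 2)"
proof -
  obtain P Z where PZ: "is_net k \<A> P Z" "net_order \<A> P Z m"
    using assms by (auto simp: is_km_net_def)
  interpret net k m \<A> P Z using PZ by unfold_locales
  let ?S = "L2 \<A>"
  have S: "finite ?S" by (rule finite_L2[OF finite_lines])
  define a :: vec3 where "a = vector [1, 0, 0]"
  have a: "a \<noteq> 0" by (simp add: a_def vec_eq_iff forall_3)
  define A where "A = std_divisor ?S a (int m) (\<lambda>p. int (if p \<in> Z then 1 else 0))"
  define B where "B = std_divisor ?S a (int ((k - 1) * m - 1)) (\<lambda>p. int (residual_mult p))"
  have "0 < (k - 1) * m" using k3 m_pos by simp
  moreover have "k * m = m + (k - 1) * m" using k3 by (cases k) auto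
  ultimately have deg: "int (card \<A>) - 1 = int m + int ((k - 1) * m - 1)"
    unfolding card_lines by linarith
  have "represents_D \<A> (div_plus A B)"
  proof (rule std_represents_D[OF S a])
    fix x assume x: "x \<in> blowup ?S"
    have "std_divisor ?S a (int (card \<A>) - 1) (mu \<A>) x =
        std_divisor ?S a (int (card \<A>) - 1)
          (\<lambda>p. int (if p \<in> Z then 1 else 0) + int (residual_mult p)) x"
      unfolding std_divisor_def using mu_eq by (simp cong: prod.cong)
    also have "\<dots> = A x * B x"
      unfolding deg A_def B_def by (rule std_divisor_add[OF S a x])
    finally show "div_plus A B x = std_divisor ?S a (int (card \<A>) - 1) (mu \<A>) x"
      by (simp add: div_plus_def)
  qed
  moreover have "is_divisor ?S A" "is_divisor ?S B"
    unfolding A_def B_def by (rule std_is_divisor[OF S a])+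
  moreover have "h0 ?S A = 2" unfolding A_def by (rule dim_pencil[OF a])
  moreover have "int (h0 ?S B) \<ge> int (k * m) - int ((m + 1) choose 2)"
    unfolding B_def by (rule dim_residual[OF a])
  ultimately show ?thesis by blast
qed

end
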